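(* Let $n\ge1$. The set $R(A,\tau)=R_+\cup W\cup R_-\subset\mathcal{L}_X$ defined below is a Gröbner–Shirshov basis for the Lie superalgebra $L=\mathcal{L}_X/\langle R(A,\tau)\rangle$, i.e. $R(A,\tau)$ is closed under Lie composition.
   Context: Let $k$ be a field with $\mathrm{char}(k)\ne2,3$. Let $\Omega=\{1,\dots,n\}$, $\tau=\{n\}$, and $A=(a_{ij})$ with $a_{ii}=2$ for all $i$, $a_{n,n-1}=-2$, $a_{ij}=-1$ if $|i-j|=1$ and $(i,j)\ne(n,n-1)$, $a_{ij}=0$ if $|i-j|>1$. Let $X=\{e_i,h_i,f_i:i\in\Omega\}$ with $e_n,f_n$ odd and all other generators even, ordered by $e_i\succ h_j\succ f_k$ for all $i,j,k$, and $e_i\succ e_j$, $h_i\succ h_j$, $f_i\succ f_j$ iff $i>j$. $\mathcal A_X$ is the free associative $k$-algebra on $X$ with $[x,y]=xy-(-1)^{|x||y|}yx$, $\mathcal L_X\subset\mathcal A_X$ the free Lie superalgebra on $X$. Juxtaposition $uv$ means $[u,v]$; $[abc]=[a,[b,c]]$, $\{abc\}=[[a,b],c]$; for $i>j$, $e_{ij}=[e_i,[e_{i-1},[\dots,[e_{j+1},e_j]\dots]]]$, $e_{ii}=e_i$; $f_{ij}$ similarly. Relations: $W$: $[h_i,h_j]$ ($i>j$), $[e_i,f_j]-\delta_{ij}h_i$, $[e_j,h_i]+a_{ij}e_j$, $[h_i,f_j]+a_{ij}f_j$. $R_+$: (I) $e_ie_j$ ($n\ge i>j+1>1$); (II) $e_{ij}e_{i-1}$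 ($n\ge i>j\ge1$); (III) $e_{ij}e_{i,j-1}$ ($n>i\ge j>1$); (IV) $[e_{n,i}\,e_{n,j}\,e_{n,j-1}]$ ($n\ge i\ge j>1$); (V) $\{e_{n,i}\,e_{n,j}\,e_{n,i-1}\}$ ($n\ge i>j\ge1$); (VI) $(e_{n,i}e_{n,j})(e_{n,i}e_{n,j-1})$ ($n\ge i>j>1$). $R_-$: the same with $f$ in place of $e$. Every relation is normalized to be monic; $\langle R(A,\tau)\rangle$ is the Lie ideal generated. Gröbner–Shirshov notions: $X^*$ the associative words; $u<1$ for nonempty $u$, $xu'<yv'$ iff $x\prec y$ or ($x=y$, $u'<v'$); $u\ll v$ iff $l(u)<l(v)$ or ($l(u)=l(v)$, $u<v$). $\bar p$ is the $\ll$-largest word of $p\ne0$; monic means its coefficient is $1$. LS word: $u\in X$ or $vw>wv$ for all factorizations $u=vw$ into nonempty words; super-LS: LS or $vv$ with $v$ an odd LS word. For a super-LS word $u=avb$ with $v$ super-LS, $[u]_v$ is the standard Lyndon–Shirshov bracketing $(a[v]b)$ of $u$ containing the standard bracketing $[v]$, divided by its leading coefficient ($1$ or $2$); $[u]_p$ substitutes a monic $p$ with $\bar p=v$ for $[v]$. For monic $p,q\in\mathcal L_X$: if $\bar pa=b\bar q=w$ with $a,b\in X^*$, $l(\bar p)>l(b)$, then $\langle p,q\rangle_w=[w]_p-[w]_q$; if $\bar p=a\bar qb=w$, then $\langle p,q\rangle_w=p-[w]_q$. For a set $S$ of monic elements, $f\equiv_Lg\bmod(S,w)$ means $f-g=\sum\alpha_i(a_i(s_i)b_i)$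 with $s_i\in S$, $a_i,b_i\in X^*$, $(a_i(s_i)b_i)$ an iterated superbracket of the letters of $a_i$, $s_i$, and the letters of $b_i$, with leading word $\ll w$. $S$ is a Gröbner–Shirshov basis if $\langle f,g\rangle_w\equiv_L0\bmod(S,w)$ for all $f,g\in S$ and all $w$ for which it is defined. *)

theory Defs
  imports Main "HOL-Library.Poly_Mapping"
begin

datatype letter = E nat | H nat | F nat

fun lidx :: "letter \<Rightarrow> nat" where
  "lidx (E i) = i" | "lidx (H i) = i" | "lidx (F i) = i"

fun lkind :: "letter \<Rightarrow> nat" where
  "lkind (E i) = 2" | "lkind (H i) = 1" | "lkind (F i) = 0"

definition lless :: "letter \<Rightarrow> letter \<Rightarrow> bool" where
  "lless x y \<longleftrightarrow> lkind x < lkind y \<or> (lkind x = lkind y \<and> lidx x < lidx y)"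

definition inX :: "nat \<Rightarrow> letter \<Rightarrow> bool" where
  "inX n x \<longleftrightarrow> 1 \<le> lidx x \<and> lidx x \<le> n"

definition oddl :: "nat \<Rightarrow> letter \<Rightarrow> bool" where
  "oddl n x \<longleftrightarrow> x = E n \<or> x = F n"

definition oddw :: "nat \<Rightarrow> letter list \<Rightarrow> bool" where
  "oddw n u \<longleftrightarrow> odd (length (filter (oddl n) u))"

fun wless :: "letter list \<Rightarrow> letter list \<Rightarrow> bool" where
  "wless [] v = False"
| "wless (x # u) [] = True"
| "wless (x # u) (y # v) = (lless x y \<or> (x = y \<and> wless u v))"

definition dlless :: "letter list \<Rightarrow> letter list \<Rightarrow> bool" where
  "dlless u v \<longleftrightarrow> length u < length v \<or> (length u = length v \<and> wless u v)"

definition LS :: "letter list \<Rightarrow> bool" where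
  "LS u \<longleftrightarrow> u \<noteq> [] \<and> (\<forall>v w. u = v @ w \<and> v \<noteq> [] \<and> w \<noteq> [] \<longrightarrow> wless (w @ v) (v @ w))"

definition superLS :: "nat \<Rightarrow> letter list \<Rightarrow> bool" where
  "superLS n u \<longleftrightarrow> LS u \<or> (\<exists>v. u = v @ v \<and> LS v \<and> oddw n v)"

datatype 'a btree = Lf 'a | Nd "'a btree" "'a btree"

fun leaves :: "'a btree \<Rightarrow> 'a list" where
  "leaves (Lf x) = [x]"
| "leaves (Nd l r) = leaves l @ leaves r"

definition lsk :: "letter list \<Rightarrow> nat" where
  "lsk u = (if \<exists>k. 0 < k \<and> k < length u \<and> LS (drop k u)
            then (LEAST k. 0 < k \<and> k < length u \<and> LS (drop k u)) else 1)"

(* standard Lyndon-Shirshov bracketing [u] = [[v][w]], w the longest proper LS suffix;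
   the nat argument is fuel (length u suffices) *)
fun sbt_aux :: "nat \<Rightarrow> letter list \<Rightarrow> letter btree" where
  "sbt_aux 0 u = Lf (hd u)"
| "sbt_aux (Suc f) u = (if length u \<le> 1 then Lf (hd u)
      else Nd (sbt_aux f (take (lsk u) u)) (sbt_aux f (drop (lsk u) u)))"

definition sbt :: "letter list \<Rightarrow> letter btree" where
  "sbt u = sbt_aux (length u) u"

definition sbw :: "letter list \<Rightarrow> letter btree" where
  "sbw u = (if LS u then sbt u
            else Nd (sbt (take (length u div 2) u)) (sbt (take (length u div 2) u)))"

definition lfact :: "letter list \<Rightarrow> letter list list" where
  "lfact c = (THE cs. concat cs = c \<and> (\<forall>x\<in>set cs. LS x)
                \<and> sorted_wrt (\<lambda>x y. x = y \<or> wless x y) cs)"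

(* [[...[[v][c1]][c2]...][ck]] with a hole (None) in place of [v] *)
definition repl :: "letter list \<Rightarrow> letter list \<Rightarrow> letter option btree" where
  "repl v word = foldl (\<lambda>acc c. Nd acc (map_btree Some (sbt c))) (Lf None)
                   (lfact (drop (length v) word))"

(* Given [u] and an occurrence of v at position s: [u] = (a[vc]d);
   replace the subtree [vc] by [[..[[v][c1]]..][ck]] with a hole for [v] *)
fun mk :: "letter list \<Rightarrow> nat \<Rightarrow> letter btree \<Rightarrow> letter option btree" where
  "mk v s (Lf x) = repl v [x]"
| "mk v s (Nd l r) =
     (if s + length v \<le> length (leaves l) then Nd (mk v s l) (map_btree Some r)
      else if length (leaves l) \<le> s then Nd (map_btree Some l) (mk v (s - length (leaves l)) r)
      else repl v (leaves (Nd l r)))"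

type_synonym 'k wpoly = "letter list \<Rightarrow>\<^sub>0 'k"

definition pmul :: "'k::field wpoly \<Rightarrow> 'k wpoly \<Rightarrow> 'k wpoly" where
  "pmul p q = (\<Sum>u\<in>Poly_Mapping.keys p. \<Sum>v\<in>Poly_Mapping.keys q. Poly_Mapping.single (u @ v) (Poly_Mapping.lookup p u * Poly_Mapping.lookup q v))"

definition smul :: "'k::field \<Rightarrow> 'k wpoly \<Rightarrow> 'k wpoly" where
  "smul c p = pmul (Poly_Mapping.single [] c) p"

definition lt :: "letter \<Rightarrow> 'k::field wpoly" where
  "lt x = Poly_Mapping.single [x] 1"

definition oddpart :: "nat \<Rightarrow> 'k::field wpoly \<Rightarrow> 'k wpoly" where
  "oddpart n p = (\<Sum>u\<in>{u\<in>Poly_Mapping.keys p. oddw n u}. Poly_Mapping.single u (Poly_Mapping.lookup p u))"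

(* bilinear extension of [x,y] = xy - (-1)^{|x||y|} yx for homogeneous x, y *)
definition br :: "nat \<Rightarrow> 'k::field wpoly \<Rightarrow> 'k wpoly \<Rightarrow> 'k wpoly" where
  "br n p q = pmul p q - pmul q p + smul 2 (pmul (oddpart n q) (oddpart n p))"

inductive_set free_lie :: "nat \<Rightarrow> 'k::field wpoly set" for n where
  gen: "inX n x \<Longrightarrow> lt x \<in> free_lie n"
| zero: "0 \<in> free_lie n"
| add: "p \<in> free_lie n \<Longrightarrow> q \<in> free_lie n \<Longrightarrow> p + q \<in> free_lie n"
| scal: "p \<in> free_lie n \<Longrightarrow> smul c p \<in> free_lie n"
| brk: "p \<in> free_lie n \<Longrightarrow> q \<in> free_lie n \<Longrightarrow> br n p q \<in> free_lie n"

definition lw :: "'k::field wpoly \<Rightarrow> letter list" where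
  "lw p = (THE w. w \<in> Poly_Mapping.keys p \<and> (\<forall>u\<in>Poly_Mapping.keys p. u \<noteq> w \<longrightarrow> dlless u w))"

definition monic :: "'k::field wpoly \<Rightarrow> bool" where
  "monic p \<longleftrightarrow> p \<noteq> 0 \<and> Poly_Mapping.lookup p (lw p) = 1"

definition mon :: "'k::field wpoly \<Rightarrow> 'k wpoly" where
  "mon p = smul (inverse (Poly_Mapping.lookup p (lw p))) p"

fun evt :: "nat \<Rightarrow> 'k::field wpoly \<Rightarrow> letter option btree \<Rightarrow> 'k wpoly" where
  "evt n p (Lf None) = p"
| "evt n p (Lf (Some x)) = lt x"
| "evt n p (Nd l r) = br n (evt n p l) (evt n p r)"

(* [u]_p for u = a \<bar>p\<bar> b with |a| = s, normalized to be monic *)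
definition brk :: "nat \<Rightarrow> letter list \<Rightarrow> nat \<Rightarrow> 'k::field wpoly \<Rightarrow> 'k wpoly" where
  "brk n u s p = (let e = evt n p (mk (lw p) s (sbw u)) in smul (inverse (Poly_Mapping.lookup e u)) e)"

definition hole_tree :: "nat \<Rightarrow> letter option btree \<Rightarrow> bool" where
  "hole_tree n t \<longleftrightarrow> length (filter (\<lambda>x. x = None) (leaves t)) = 1
      \<and> (\<forall>y. Some y \<in> set (leaves t) \<longrightarrow> inX n y)"

definition congS :: "nat \<Rightarrow> 'k::field wpoly set \<Rightarrow> letter list \<Rightarrow> 'k wpoly \<Rightarrow> 'k wpoly \<Rightarrow> bool" where
  "congS n S w f g \<longleftrightarrow> (\<exists>xs :: ('k \<times> 'k wpoly \<times> letter option btree) list.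
      f - g = sum_list (map (\<lambda>(c, s, t). smul c (evt n s t)) xs)
      \<and> (\<forall>(c, s, t)\<in>set xs. s \<in> S \<and> hole_tree n t
           \<and> (evt n s t = 0 \<or> dlless (lw (evt n s t)) w)))"

definition GSB :: "nat \<Rightarrow> 'k::field wpoly set \<Rightarrow> bool" where
  "GSB n S \<longleftrightarrow> S \<subseteq> {p \<in> free_lie n. monic p}
     \<and> (\<forall>p\<in>S. \<forall>q\<in>S. \<forall>w a b. superLS n w \<and> (\<forall>x\<in>set a. inX n x) \<and> (\<forall>x\<in>set b. inX n x)
           \<and> lw p @ a = w \<and> b @ lw q = w \<and> length b < length (lw p)
           \<longrightarrow> congS n S w (brk n w 0 p - brk n w (length b) q) 0)
     \<and> (\<forall>p\<in>S. \<forall>q\<in>S. \<forall>a b. (\<forall>x\<in>set a. inX n x) \<and> (\<forall>x\<in>set b. inX n x)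
           \<and> lw p = a @ lw q @ b
           \<longrightarrow> congS n S (lw p) (p - brk n (lw p) (length a) q) 0)"

definition acoef :: "nat \<Rightarrow> nat \<Rightarrow> nat \<Rightarrow> int" where
  "acoef n i j = (if i = j then 2 else if i = n \<and> j = n - 1 then -2
                  else if i = j + 1 \<or> j = i + 1 then -1 else 0)"

fun gij :: "nat \<Rightarrow> (nat \<Rightarrow> letter) \<Rightarrow> nat \<Rightarrow> nat \<Rightarrow> 'k::field wpoly" where
  "gij n C 0 j = lt (C 0)"
| "gij n C (Suc i) j = (if j < Suc i then br n (lt (C (Suc i))) (gij n C i j) else lt (C (Suc i)))"

definition Rside :: "nat \<Rightarrow> (nat \<Rightarrow> letter) \<Rightarrow> 'k::field wpoly set" where
  "Rside n C =
     {br n (lt (C i)) (lt (C j)) | i j. i \<le> n \<and> j + 1 < i \<and> 1 < j + 1}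
   \<union> {br n (gij n C i j) (lt (C (i - 1))) | i j. i \<le> n \<and> j < i \<and> 1 \<le> j}
   \<union> {br n (gij n C i j) (gij n C i (j - 1)) | i j. i < n \<and> j \<le> i \<and> 1 < j}
   \<union> {br n (gij n C n i) (br n (gij n C n j) (gij n C n (j - 1))) | i j. i \<le> n \<and> j \<le> i \<and> 1 < j}
   \<union> {br n (br n (gij n C n i) (gij n C n j)) (gij n C n (i - 1)) | i j. i \<le> n \<and> j < i \<and> 1 \<le> j}
   \<union> {br n (br n (gij n C n i) (gij n C n j)) (br n (gij n C n i) (gij n C n (j - 1)))
        | i j. i \<le> n \<and> j < i \<and> 1 < j}"

definition Wrel :: "nat \<Rightarrow> 'k::field wpoly set" where
  "Wrel n =
     {br n (lt (H i)) (lt (H j)) | i j. i \<le> n \<and> j < i \<and> 1 \<le> j}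
   \<union> {br n (lt (E i)) (lt (F j)) - (if i = j then lt (H i) else 0)
        | i j. i \<in> {1..n} \<and> j \<in> {1..n}}
   \<union> {br n (lt (E j)) (lt (H i)) + smul (of_int (acoef n i j)) (lt (E j))
        | i j. i \<in> {1..n} \<and> j \<in> {1..n}}
   \<union> {br n (lt (H i)) (lt (F j)) + smul (of_int (acoef n i j)) (lt (F j))
        | i j. i \<in> {1..n} \<and> j \<in> {1..n}}"

definition Rset :: "nat \<Rightarrow> 'k::field wpoly set" where
  "Rset n = mon ` (Rside n E \<union> Wrel n \<union> Rside n F)"

end

theory Submission
  imports Defs "HOL.Vector_Spaces" "HOL-Library.Multiset"
begin

text \<open>
  A family of monic Lie polynomials whose leading words are Lyndon--Shirshov words is a
  Groebner--Shirshov basis as soon as its irreducible words are the leading words of elements that stay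
  linearly independent in some quotient killing the family: a composition lies in the ideal, and
  subtracting from it, one leading word at a time, suitable multiples of bracketed relations leaves a
  combination of these independent elements that vanishes in the quotient, hence is zero. No
  composition has to be computed.

  For the relations of type \<open>B(0,n)\<close> the irreducible words are, besides the letters \<open>h\<^sub>i\<close>, the words of
  \<open>e\<^sub>i\<^sub>j\<close> and of \<open>[e\<^sub>n\<^sub>i, e\<^sub>n\<^sub>j]\<close> and their analogues for \<open>f\<close>, one for every root. Independence is read off
  from matrix entries in the natural representation of \<open>osp(1,2n)\<close> of dimension \<open>2n+1\<close>.
\<close>

section \<open>Noncommutative polynomials and the superbracket\<close>

text \<open>Subtracting leading words one at a time requires that elements of the free Lie
  superalgebra be combinations of standard bracketings of super-LS words. This half of Shirshov's
  theorem is proved from scratch: brackets of standard bracketings are rewritten by the Jacobi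
  identity, and the resulting words are kept above a bound so that the rewriting ends. The super
  case adds the squares v v of odd words v. Their bracketings have leading coefficient 2, and they
  are reduced by reducing one of the two factors v.

  The quotient is never formed. Its role is played by the kernel of a representation of the free
  associative algebra, a two-sided ideal, so it contains every bracketed relation once it contains
  the relations.

  The list of irreducible words comes from cutting a word into blocks with descending indices that
  start at its largest letter. A block is a prefix of every longer block, so too many blocks create
  a border, a proper suffix that is also a prefix, and an LS word has none.\<close>

instantiation list :: (type) monoid_add
begin

definition zero_list_def: "0 = ([] :: 'a list)"

definition plus_list_def: "u + v = (u @ v :: 'a list)"

instance by standard (simp_all add: zero_list_def plus_list_def)

end

lemma sum_single_lookup: "(\<Sum>u\<in>Poly_Mapping.keys p. Poly_Mapping.single u (Poly_Mapping.lookup p u)) = p"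
proof (rule poly_mapping_eqI)
  fix k
  have "Poly_Mapping.lookup (\<Sum>u\<in>Poly_Mapping.keys p. Poly_Mapping.single u (Poly_Mapping.lookup p u)) k
      = (\<Sum>u\<in>Poly_Mapping.keys p. if u = k then Poly_Mapping.lookup p u else 0)"
    by (auto simp: lookup_sum lookup_single when_def intro!: sum.cong)
  then show "Poly_Mapping.lookup (\<Sum>u\<in>Poly_Mapping.keys p. Poly_Mapping.single u (Poly_Mapping.lookup p u)) k
      = Poly_Mapping.lookup p k"
    by (simp add: in_keys_iff)
qed

text \<open>Words are a monoid under concatenation, so the product of \<open>poly_mapping\<close> is
  that of the free associative algebra, and its ring laws become available for the double sum that
  defines \<open>pmul\<close>.\<close>

lemma pmul_eq: "pmul p q = p * q"
proof -
  have "p * q = (\<Sum>u\<in>Poly_Mapping.keys p. Poly_Mapping.single u (Poly_Mapping.lookup p u))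
              * (\<Sum>v\<in>Poly_Mapping.keys q. Poly_Mapping.single v (Poly_Mapping.lookup q v))"
    by (simp only: sum_single_lookup)
  then show ?thesis
    by (simp add: pmul_def sum_product mult_single plus_list_def)
qed

lemma smul_eq: "smul c p = Poly_Mapping.single 0 c * p"
  by (simp add: smul_def pmul_eq zero_list_def)

lemma lookup_smul [simp]: "Poly_Mapping.lookup (smul c p) u = c * Poly_Mapping.lookup p u"
  by (simp add: smul_eq map.rep_eq when_def flip: mult_map_scale_conv_mult)

global_interpretation wp: vector_space "smul :: 'k::field \<Rightarrow> 'k wpoly \<Rightarrow> 'k wpoly"
  by standard (auto intro!: poly_mapping_eqI simp: lookup_add algebra_simps)

lemma smul_mult_left: "smul c p * q = smul c (p * q)"
  by (simp add: smul_eq mult.assoc)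

lemma smul_mult_right:
  fixes p q :: "'k::field wpoly"
  shows "p * smul c q = smul c (p * q)"
proof -
  have "p * Poly_Mapping.single 0 c = Poly_Mapping.single 0 c * p" for p :: "'k::field wpoly"
  proof -
    have "(\<Sum>u\<in>Poly_Mapping.keys p. Poly_Mapping.single u (Poly_Mapping.lookup p u)) * Poly_Mapping.single 0 c
        = Poly_Mapping.single 0 c * (\<Sum>u\<in>Poly_Mapping.keys p. Poly_Mapping.single u (Poly_Mapping.lookup p u))"
      unfolding sum_distrib_left sum_distrib_right
      by (simp add: mult_single mult.commute)
    then show ?thesis by (simp only: sum_single_lookup)
  qed
  then show ?thesis by (simp add: smul_eq flip: mult.assoc)
qed

lemma lookup_oddpart: "Poly_Mapping.lookup (oddpart n p) u = (if oddw n u then Poly_Mapping.lookup p u else 0)"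
proof -
  have "Poly_Mapping.lookup (oddpart n p) u
      = (\<Sum>v\<in>{v \<in> Poly_Mapping.keys p. oddw n v}. if v = u then Poly_Mapping.lookup p v else 0)"
    unfolding oddpart_def by (auto simp: lookup_sum lookup_single when_def intro!: sum.cong)
  then show ?thesis by (simp add: in_keys_iff)
qed

lemma oddpart_add: "oddpart n (p + q) = oddpart n p + oddpart n q"
  by (rule poly_mapping_eqI) (simp add: lookup_oddpart lookup_add)

lemma oddpart_smul: "oddpart n (smul c p) = smul c (oddpart n p)"
  by (rule poly_mapping_eqI) (simp add: lookup_oddpart)

lemma br_eq: "br n p q = p * q - q * p + smul 2 (oddpart n q * oddpart n p)"
  by (simp add: br_def pmul_eq)

lemma br_add_left: "br n (p + p') q = br n p q + br n p' q"
  by (simp add: br_eq oddpart_add algebra_simps wp.scale_right_distrib)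

lemma br_add_right: "br n p (q + q') = br n p q + br n p q'"
  by (simp add: br_eq oddpart_add algebra_simps wp.scale_right_distrib)

lemma br_smul_left: "br n (smul c p) q = smul c (br n p q)"
  by (simp add: br_eq oddpart_smul smul_mult_left smul_mult_right wp.scale_right_distrib
      wp.scale_right_diff_distrib mult.commute)

lemma br_smul_right: "br n p (smul c q) = smul c (br n p q)"
  by (simp add: br_eq oddpart_smul smul_mult_left smul_mult_right wp.scale_right_distrib
      wp.scale_right_diff_distrib mult.commute)

lemma br_zero_left [simp]: "br n 0 q = 0"
  using br_smul_left[of n 0 0 q] by simp

lemma br_zero_right [simp]: "br n p 0 = 0"
  using br_smul_right[of n p 0 0] by simp

lemma br_span_right:
  assumes "x \<in> wp.span A" and "\<And>y. y \<in> A \<Longrightarrow> br n p y \<in> wp.span C"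
  shows "br n p x \<in> wp.span C"
  using assms(1)
  by (induction rule: wp.span_induct_alt)
    (auto simp: br_add_right br_smul_right wp.span_zero intro!: wp.span_add wp.span_scale assms(2))

lemma br_span_left:
  assumes "x \<in> wp.span A" and "\<And>y. y \<in> A \<Longrightarrow> br n y q \<in> wp.span C"
  shows "br n x q \<in> wp.span C"
  using assms(1)
  by (induction rule: wp.span_induct_alt)
    (auto simp: br_add_left br_smul_left wp.span_zero intro!: wp.span_add wp.span_scale assms(2))

text \<open>The parity is a parameter and not a function of \<open>p\<close>, because 0 has both
  parities and a sum of words of mixed parity has none.\<close>

definition hom :: "nat \<Rightarrow> bool \<Rightarrow> 'k::field wpoly \<Rightarrow> bool" where
  "hom n b p \<longleftrightarrow> (\<forall>u\<in>Poly_Mapping.keys p. oddw n u = b)"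

lemma oddw_append [simp]: "oddw n (u @ v) \<longleftrightarrow> oddw n u \<noteq> oddw n v"
  by (simp add: oddw_def)

lemma oddpart_hom: "hom n b p \<Longrightarrow> oddpart n p = (if b then p else 0)"
  by (intro poly_mapping_eqI) (auto simp: lookup_oddpart hom_def in_keys_iff)

lemma hom_mult:
  assumes "hom n b p" "hom n c q"
  shows "hom n (b \<noteq> c) (p * q)"
  unfolding hom_def
proof
  fix u assume "u \<in> Poly_Mapping.keys (p * q)"
  then obtain x y where "u = x @ y" "x \<in> Poly_Mapping.keys p" "y \<in> Poly_Mapping.keys q"
    using keys_mult[of p q] by (auto simp: plus_list_def)
  then show "oddw n u \<longleftrightarrow> b \<noteq> c" using assms by (auto simp: hom_def)
qed

lemma hom_add: "hom n b p \<Longrightarrow> hom n b q \<Longrightarrow> hom n b (p + q)"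
  by (auto simp: hom_def in_keys_iff lookup_add)

lemma hom_smul: "hom n b p \<Longrightarrow> hom n b (smul c p)"
  by (auto simp: hom_def in_keys_iff)

lemma hom_diff: "hom n b p \<Longrightarrow> hom n b q \<Longrightarrow> hom n b (p - q)"
  using hom_add[of n b p "smul (-1) q"] hom_smul[of n b q "-1"] by simp

lemma br_hom:
  assumes "hom n b p" "hom n c q"
  shows "br n p q = (if b \<and> c then p * q + q * p else p * q - q * p)"
proof -
  have "smul 2 x = x + x" for x :: "'k::field wpoly"
    using wp.scale_left_distrib[of 1 1 x] by simp
  then show ?thesis
    by (auto simp: br_eq oddpart_hom[OF assms(1)] oddpart_hom[OF assms(2)] algebra_simps)
qed

lemma hom_br:
  assumes "hom n b p" "hom n c q"
  shows "hom n (b \<noteq> c) (br n p q)"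
  using hom_mult[OF assms] hom_mult[OF assms(2,1)] hom_add[of n "b \<noteq> c"] hom_diff[of n "b \<noteq> c"]
  by (auto simp: br_hom[OF assms])

lemma hom_lt: "hom n (oddl n x) (lt x)"
  by (simp add: hom_def lt_def oddw_def)

lemma br_commute:
  assumes "hom n b p" "hom n c q"
  shows "br n p q = smul (if b \<and> c then 1 else - 1) (br n q p)"
  by (auto simp: br_hom[OF assms] br_hom[OF assms(2,1)])

text \<open>Once the three parities are fixed, every bracket is a commutator or an anticommutator,
  and each of the eight cases follows from associativity.\<close>

lemma br_jacobi:
  assumes "hom n a p" "hom n b q" "hom n c r"
  shows "br n (br n p q) r = br n p (br n q r) - smul (if a \<and> b then - 1 else 1) (br n q (br n p r))"
proof -
  note 1 = br_hom[OF assms(1,2)] br_hom[OF assms(2,3)] br_hom[OF assms(1,3)]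
  note 2 = br_hom[OF hom_br[OF assms(1,2)] assms(3)] br_hom[OF assms(1) hom_br[OF assms(2,3)]]
    br_hom[OF assms(2) hom_br[OF assms(1,3)]]
  show ?thesis unfolding 2 unfolding 1
    by (cases a; cases b; cases c) (simp_all add: algebra_simps)
qed

section \<open>Lyndon--Shirshov words\<close>

lemma lless_irrefl [simp]: "\<not> lless x x"
  by (simp add: lless_def)

lemma lless_trans: "lless x y \<Longrightarrow> lless y z \<Longrightarrow> lless x z"
  by (auto simp: lless_def)

lemma lless_linear: "lless x y \<or> x = y \<or> lless y x"
  by (cases x; cases y) (auto simp: lless_def)

lemma wless_irrefl [simp]: "\<not> wless u u"
  by (induction u) auto

lemma wless_Nil [simp]: "wless u [] \<longleftrightarrow> u \<noteq> []"
  by (cases u) auto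

lemma wless_trans: "wless u v \<Longrightarrow> wless v w \<Longrightarrow> wless u w"
proof (induction u arbitrary: v w)
  case (Cons x u)
  then show ?case
    by (cases v; cases w) (auto dest: lless_trans)
qed simp

lemma wless_linear: "wless u v \<or> u = v \<or> wless v u"
proof (induction u arbitrary: v)
  case (Cons x u)
  then show ?case using lless_linear by (cases v) auto
qed (metis wless_Nil)

lemma wless_asym: "wless u v \<Longrightarrow> \<not> wless v u"
  using wless_trans wless_irrefl by blast

lemma wless_append_same [simp]: "wless (p @ u) (p @ v) \<longleftrightarrow> wless u v"
  by (induction p) auto

lemma wless_append_left [simp]: "wless (u @ v) u \<longleftrightarrow> v \<noteq> []"
  using wless_append_same[of u v "[]"] by simp

text \<open>The part of \<^const>\<open>wless\<close> decided at a differing letter; unlike \<^const>\<open>wless\<close>, it is stable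
  under appending arbitrary words on the right.\<close>

fun sless :: "letter list \<Rightarrow> letter list \<Rightarrow> bool" where
  "sless (x # u) (y # v) = (lless x y \<or> (x = y \<and> sless u v))"
| "sless _ _ = False"

lemma sless_Nil [simp]: "\<not> sless u []"
  by (cases u) auto

lemma sless_irrefl [simp]: "\<not> sless u u"
  by (induction u) auto

lemma sless_append: "sless u v \<Longrightarrow> sless (u @ a) (v @ b)"
  by (induction u v rule: sless.induct) auto

lemma sless_append_same [simp]: "sless (p @ u) (p @ v) \<longleftrightarrow> sless u v"
  by (induction p) auto

lemma sless_trans: "sless u v \<Longrightarrow> sless v w \<Longrightarrow> sless u w"
proof (induction u arbitrary: v w)
  case (Cons x u)
  then show ?case
    by (cases v; cases w) (auto dest: lless_trans)
qed simp

lemma wless_iff_sless: "wless u v \<longleftrightarrow> sless u v \<or> (\<exists>z. z \<noteq> [] \<and> u = v @ z)"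
proof (induction u arbitrary: v)
  case (Cons x u)
  then show ?case by (cases v) auto
qed simp

lemma sless_imp_wless: "sless u v \<Longrightarrow> wless u v"
  by (simp add: wless_iff_sless)

lemma wless_imp_sless: "wless u v \<Longrightarrow> length u \<le> length v \<Longrightarrow> sless u v"
  by (auto simp: wless_iff_sless)

lemma sless_prefix: "\<not> sless u (u @ z)"
  using sless_append_same[of u "[]" z] by simp

text \<open>A proper suffix w of an LS word cannot also be a prefix: if u = v w = w z, the rotations
  w v and z w are below u, and cancelling gives v < z and z <= v for words of equal length. So the
  comparison with a suffix is decided at a differing letter and survives extension to the
  right.\<close>

lemma LS_iff_suffix: "LS u \<longleftrightarrow> u \<noteq> [] \<and> (\<forall>v w. u = v @ w \<and> v \<noteq> [] \<and> w \<noteq> [] \<longrightarrow> sless w u)"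
proof
  assume u: "LS u"
  have "sless w u" if vw: "u = v @ w" "v \<noteq> []" "w \<noteq> []" for v w
  proof -
    have rot: "wless (w @ v) (v @ w)" using u vw by (auto simp: LS_def)
    consider "sless w u" | z where "u = w @ z" | "sless u w" | z where "w = u @ z"
      using wless_linear[of u w] unfolding wless_iff_sless by (metis append_Nil2)
    then show ?thesis
    proof cases
      case 2
      then have "length (v @ w) = length (w @ z)" using vw(1) by simp
      then have z: "length z = length v" "z \<noteq> []" using vw(2) by auto
      have "wless v z" using rot 2 vw by (metis wless_append_same)
      moreover have "wless (z @ w) (v @ w)" using u vw(1,3) 2 z by (metis LS_def)
      then have "sless z v \<or> z = v"
      proof -
        have "sless (z @ w) (v @ w)" using \<open>wless (z @ w) (v @ w)\<close> z by (auto intro: wless_imp_sless)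
        moreover have "sless v z" using \<open>wless v z\<close> z by (simp add: wless_imp_sless)
        ultimately show ?thesis using sless_append sless_irrefl sless_trans by blast
      qed
      ultimately show ?thesis using wless_asym sless_imp_wless wless_irrefl by blast
    next
      case 3
      then have "sless (u @ []) (w @ v)" by (rule sless_append)
      then show ?thesis using rot vw(1) sless_imp_wless wless_asym by fastforce
    next
      case 4
      then have "length u \<le> length w" by simp
      then show ?thesis using vw by simp
    qed
  qed
  then show "u \<noteq> [] \<and> (\<forall>v w. u = v @ w \<and> v \<noteq> [] \<and> w \<noteq> [] \<longrightarrow> sless w u)"
    using u by (auto simp: LS_def)
next
  assume *: "u \<noteq> [] \<and> (\<forall>v w. u = v @ w \<and> v \<noteq> [] \<and> w \<noteq> [] \<longrightarrow> sless w u)"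
  have "wless (w @ v) (v @ w)" if "u = v @ w" "v \<noteq> []" "w \<noteq> []" for v w
    using sless_append[of w u v "[]"] * that by (auto intro: sless_imp_wless)
  then show "LS u" using * by (auto simp: LS_def)
qed

lemma LS_suffix: "LS (v @ w) \<Longrightarrow> v \<noteq> [] \<Longrightarrow> w \<noteq> [] \<Longrightarrow> sless w (v @ w)"
  by (auto simp: LS_iff_suffix)

lemma LS_nonempty: "LS u \<Longrightarrow> u \<noteq> []"
  by (simp add: LS_def)

lemma LS_single [simp]: "LS [x]"
  by (auto simp: LS_def Cons_eq_append_conv)

lemma LS_rotate: "LS (u @ v) \<Longrightarrow> u \<noteq> [] \<Longrightarrow> v \<noteq> [] \<Longrightarrow> wless (v @ u) (u @ v)"
  by (simp add: LS_def)

text \<open>A proper suffix loses to the whole word at a differing letter, which a prefix never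
  does. Long irreducible words are excluded by this contradiction.\<close>

lemma LS_unbordered: "LS u \<Longrightarrow> u = a @ w \<Longrightarrow> u = w @ b \<Longrightarrow> a \<noteq> [] \<Longrightarrow> w \<noteq> [] \<Longrightarrow> False"
  using LS_suffix[of a w] sless_prefix by metis

text \<open>The delicate point is v < u v when v = u z: cancelling u leaves z < v, which holds
  because z is a proper suffix of v.\<close>

lemma LS_concat:
  assumes u: "LS u" and v: "LS v" and vu: "wless v u"
  shows "LS (u @ v)"
proof -
  have vuv: "sless v (u @ v)"
    using vu unfolding wless_iff_sless
  proof
    assume "sless v u"
    then show ?thesis using sless_append[of v u "[]" v] by simp
  next
    assume "\<exists>z. z \<noteq> [] \<and> v = u @ z"
    then obtain z where z: "z \<noteq> []" "v = u @ z" by blast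
    then show ?thesis using LS_suffix[of u z] v LS_nonempty[OF u] by simp
  qed
  have "sless w (u @ v)" if w: "u @ v = t @ w" "t \<noteq> []" "w \<noteq> []" for t w
  proof -
    consider "w = v" | s where "s \<noteq> []" "v = s @ w" | s where "s \<noteq> []" "w = s @ v" "u = t @ s"
      using w(1) by (auto simp: append_eq_append_conv2)
    then show ?thesis
    proof cases
      case 2
      then show ?thesis using LS_suffix[of s w] v w vuv sless_trans by blast
    next
      case 3
      then show ?thesis using LS_suffix[of t s] u w sless_append by blast
    qed (use vuv in simp)
  qed
  then show ?thesis using LS_nonempty[OF u] by (auto simp: LS_iff_suffix)
qed

text \<open>A suffix starting inside x is compared within x y, a later one within y z. The word of
  every overlap composition is therefore an LS word and never a square.\<close>

lemma LS_overlap: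
  assumes xy: "LS (x @ y)" and yz: "LS (y @ z)" and y: "y \<noteq> []"
  shows "LS (x @ y @ z)"
proof (cases "x = []")
  case False
  have 1: "sless (y @ z) (x @ y @ z)"
    using sless_append[OF LS_suffix[OF xy False y], of z z] by simp
  have "sless w (x @ y @ z)" if w: "x @ y @ z = t @ w" "t \<noteq> []" "w \<noteq> []" for t w
  proof -
    consider "w = y @ z" | s where "s \<noteq> []" "y @ z = s @ w" | s where "s \<noteq> []" "w = s @ y @ z" "x = t @ s"
      using w(1) by (auto simp: append_eq_append_conv2[of x]) blast
    then show ?thesis
    proof cases
      case 2
      then show ?thesis using LS_suffix[of s w] yz w 1 sless_trans by metis
    next
      case 3
      then have "sless (s @ y) (x @ y)" using LS_suffix[of t "s @ y"] xy w by simp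
      then show ?thesis using sless_append[of "s @ y" "x @ y" z z] 3 by simp
    qed (use 1 in simp)
  qed
  then show ?thesis using False by (auto simp: LS_iff_suffix)
qed (use yz in simp)

section \<open>Factorization into nondecreasing Lyndon--Shirshov words\<close>

abbreviation wle :: "letter list \<Rightarrow> letter list \<Rightarrow> bool" where
  "wle u v \<equiv> u = v \<or> wless u v"

lemma wle_trans: "wle u v \<Longrightarrow> wle v w \<Longrightarrow> wle u w"
  using wless_trans by blast

lemma wless_wle_trans: "wless u v \<Longrightarrow> wle v w \<Longrightarrow> wless u w"
  using wless_trans by blast

text \<open>The Chen--Fox--Lyndon factorization. The factors do not decrease because
  \<open>wless\<close> is the reverse of a lexicographic order in which prefixes come first.\<close>

definition is_lfact :: "letter list list \<Rightarrow> bool" where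
  "is_lfact cs \<longleftrightarrow> (\<forall>x\<in>set cs. LS x) \<and> sorted_wrt wle cs"

lemma is_lfact_merge:
  "\<forall>x\<in>set cs. LS x \<Longrightarrow> \<not> sorted_wrt wle cs \<Longrightarrow>
    \<exists>ds. concat ds = concat cs \<and> (\<forall>x\<in>set ds. LS x) \<and> length ds < length cs"
proof (induction cs)
  case (Cons c cs)
  show ?case
  proof (cases "sorted_wrt wle cs")
    case True
    then obtain d ds where cs: "cs = d # ds" using Cons.prems by (cases cs) auto
    have "\<not> wle c d"
    proof
      assume "wle c d"
      then have "sorted_wrt wle (c # cs)"
        using True unfolding cs by (auto dest: wless_trans)
      then show False using Cons.prems(2) by simp
    qed
    then have "wless d c" using wless_linear[of c d] by auto
    then have "LS (c @ d)" using Cons.prems(1) cs by (auto intro: LS_concat)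
    then show ?thesis using Cons.prems(1) cs by (intro exI[of _ "(c @ d) # ds"]) auto
  next
    case False
    then obtain ds where "concat ds = concat cs" "\<forall>x\<in>set ds. LS x" "length ds < length cs"
      using Cons by auto
    then show ?thesis using Cons.prems(1) by (intro exI[of _ "c # ds"]) auto
  qed
qed simp

text \<open>In a factorization with the fewest LS factors, a descent between neighbours could be
  merged by \<open>LS_concat\<close>.\<close>

lemma lfact_exists: "\<exists>cs. concat cs = c \<and> is_lfact cs"
proof -
  define P where "P cs \<longleftrightarrow> concat cs = c \<and> (\<forall>x\<in>set cs. LS x)" for cs
  let ?m = "arg_min length P"
  have "P (map (\<lambda>x. [x]) c)" by (simp add: P_def)
  then have m: "P ?m" and min: "\<And>ds. P ds \<Longrightarrow> length ?m \<le> length ds"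
    by (auto intro: arg_min_natI arg_min_nat_le)
  have "sorted_wrt wle ?m"
  proof (rule ccontr)
    assume "\<not> sorted_wrt wle ?m"
    then obtain ds where "P ds" "length ds < length ?m"
      using is_lfact_merge[of ?m] m unfolding P_def by auto
    then show False using min[of ds] by simp
  qed
  then show ?thesis using m unfolding P_def is_lfact_def by blast
qed

lemma is_lfact_Cons: "is_lfact (c # cs) \<longleftrightarrow> LS c \<and> is_lfact cs \<and> (\<forall>d\<in>set cs. wle c d)"
  by (auto simp: is_lfact_def)

lemma concat_prefix:
  assumes "concat cs = p @ q" "q \<noteq> []"
  shows "\<exists>as c bs r. cs = as @ c # bs \<and> p = concat as @ r \<and> (\<exists>r'. r' \<noteq> [] \<and> c = r @ r')"
  using assms
proof (induction cs arbitrary: p)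
  case (Cons d ds)
  then obtain us where "d = p @ us \<and> us @ concat ds = q \<or> d @ us = p \<and> concat ds = us @ q"
    by (auto simp: append_eq_append_conv2)
  then consider r where "p = d @ r" "concat ds = r @ q" | r where "r \<noteq> []" "d = p @ r"
    by (cases "us = []") auto
  then show ?case
  proof cases
    case 1
    then obtain as c bs r' where "ds = as @ c # bs \<and> r = concat as @ r' \<and> (\<exists>r''. r'' \<noteq> [] \<and> c = r' @ r'')"
      using Cons.IH[of r] Cons.prems by blast
    then show ?thesis using 1 by (intro exI[of _ "d # as"] exI[of _ c] exI[of _ bs] exI[of _ r']) auto
  next
    case 2
    then show ?thesis by (intro exI[of _ "[]"] exI[of _ d] exI[of _ ds] exI[of _ p]) auto
  qed
qed simp

text \<open>If \<open>d\<close> went beyond \<open>c\<close>, it would end with a nonempty prefix x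
  of a later factor x y, and x < d <= c <= x y <= x would follow. Uniqueness of the factorization
  rests on this.\<close>

lemma lfact_first_maximal:
  assumes cs: "is_lfact (c # cs)" and d: "LS d" and eq: "concat (c # cs) = d @ e"
  shows "length d \<le> length c"
proof (rule ccontr)
  assume len: "\<not> length d \<le> length c"
  then obtain d' where d': "d = c @ d'" "d' \<noteq> []"
    using eq by (auto simp: append_eq_append_conv2)
  have c: "c \<noteq> []" using cs LS_nonempty by (auto simp: is_lfact_Cons)
  have "\<exists>as x y b. cs = as @ (x @ y) # b \<and> d' = concat as @ x \<and> x \<noteq> []"
  proof (cases e rule: rev_cases)
    case Nil
    then have "concat cs = d'" using eq d' by simp
    then obtain ys y where "cs = ys @ [y]" using d'(2) by (cases cs rule: rev_cases) auto
    moreover from this have "y \<noteq> []" using cs LS_nonempty by (auto simp: is_lfact_def)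
    ultimately show ?thesis using \<open>concat cs = d'\<close>
      by (intro exI[of _ ys] exI[of _ y] exI[of _ "[]"] exI[of _ "[]"]) simp
  next
    case (snoc e' z)
    have "concat cs = d' @ e" using eq d' by simp
    \<comment> \<open>Cutting one letter earlier selects the factor containing the last letter of
      \<open>d'\<close>, so \<open>x\<close> is nonempty even if \<open>d'\<close> ends at a factor
      boundary.\<close>
    also have "d' = butlast d' @ [last d']" using d'(2) by simp
    finally have "concat cs = butlast d' @ (last d' # e)" by simp
    then obtain as x b r r' where *: "cs = as @ x # b" "butlast d' = concat as @ r" "r' \<noteq> []" "x = r @ r'"
      using concat_prefix[of cs "butlast d'" "last d' # e"] by blast
    have "concat as @ r @ r' @ concat b = concat cs" using * by simp
    also have "\<dots> = concat as @ r @ (last d' # e)"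
      using \<open>concat cs = butlast d' @ (last d' # e)\<close> *(2) by simp
    finally have "r' @ concat b = last d' # e" by simp
    then obtain r'' where "r' = last d' # r''" using *(3) by (cases r') auto
    moreover have "d' = concat as @ r @ [last d']"
      using *(2) d'(2) by (metis append_assoc append_butlast_last_id)
    ultimately show ?thesis using * by (intro exI[of _ as] exI[of _ "r @ [last d']"] exI[of _ r''] exI[of _ b]) simp
  qed
  then obtain as x y b where *: "cs = as @ (x @ y) # b" "d' = concat as @ x" "x \<noteq> []" by blast
  have "sless x d"
    using LS_suffix[of "c @ concat as" x] d d' * c by simp
  moreover have "wle d c" using d' by simp
  moreover have "wle c (x @ y)" using cs * by (auto simp: is_lfact_Cons)
  moreover have "wle (x @ y) x" by simp
  ultimately show False
    by (metis sless_imp_wless wle_trans wless_asym wless_irrefl)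
qed

lemma lfact_unique: "is_lfact cs \<Longrightarrow> is_lfact ds \<Longrightarrow> concat cs = concat ds \<Longrightarrow> cs = ds"
proof (induction cs arbitrary: ds)
  case Nil
  then show ?case using LS_nonempty by (cases ds) (auto simp: is_lfact_def)
next
  case (Cons c cs)
  then have c: "LS c" by (simp add: is_lfact_Cons)
  then obtain d ds' where ds: "ds = d # ds'"
    using Cons.prems LS_nonempty by (cases ds) auto
  have d: "LS d" using Cons.prems ds by (simp add: is_lfact_Cons)
  have "length c \<le> length d"
    using lfact_first_maximal[of d ds' c "concat cs"] Cons.prems ds c by simp
  moreover have "length d \<le> length c"
    using lfact_first_maximal[of c cs d "concat ds'"] Cons.prems ds d by simp
  ultimately have "c = d \<and> concat cs = concat ds'" using Cons.prems(3) ds by auto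
  then show ?case using Cons ds by (auto simp: is_lfact_Cons)
qed

lemma is_lfact_lfact: "is_lfact (lfact c) \<and> concat (lfact c) = c"
proof -
  have "\<exists>!cs. concat cs = c \<and> is_lfact cs" using lfact_exists lfact_unique by blast
  then have "concat (lfact c) = c \<and> is_lfact (lfact c)"
    unfolding lfact_def is_lfact_def by (rule theI')
  then show ?thesis by simp
qed

lemma is_lfact_nonempty: "c \<noteq> [] \<Longrightarrow> \<exists>a as z bs. c = a @ concat as \<and> c = concat bs @ z \<and> LS a \<and> LS z \<and> wle a z"
proof -
  assume c: "c \<noteq> []"
  obtain cs where cs: "concat cs = c" "is_lfact cs" using lfact_exists by blast
  then have ne: "cs \<noteq> []" using c by auto
  have "hd cs = last cs \<or> wless (hd cs) (last cs)"
    using cs(2) ne by (cases cs) (auto simp: is_lfact_Cons)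
  moreover have "LS (hd cs)" "LS (last cs)" using cs(2) ne by (auto simp: is_lfact_def)
  moreover have "c = hd cs @ concat (tl cs)"
    using cs(1) ne by (cases cs) auto
  moreover have "c = concat (butlast cs) @ last cs"
    using cs(1) ne by (cases cs rule: rev_cases) auto
  ultimately show ?thesis by blast
qed

section \<open>Standard factorization of a Lyndon--Shirshov word\<close>

lemma lsk:
  assumes "1 < length u"
  shows "0 < lsk u" "lsk u < length u" "LS (drop (lsk u) u)"
    "\<And>k. 0 < k \<Longrightarrow> k < length u \<Longrightarrow> LS (drop k u) \<Longrightarrow> lsk u \<le> k"
proof -
  let ?P = "\<lambda>k. 0 < k \<and> k < length u \<and> LS (drop k u)"
  have "drop (length u - 1) u = [last u]"
    using assms by (cases u rule: rev_cases) auto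
  then have ex: "?P (length u - 1)" using assms by simp
  then have eq: "lsk u = (LEAST k. ?P k)" unfolding lsk_def by (metis (no_types, lifting))
  show "0 < lsk u" "lsk u < length u" "LS (drop (lsk u) u)"
    unfolding eq using LeastI[of ?P, OF ex] by auto
  show "lsk u \<le> k" if "0 < k" "k < length u" "LS (drop k u)" for k
    unfolding eq using that by (intro Least_le) auto
qed

text \<open>The left part l is LS: if its factorization had first and last factors c <= d, then d r
  would not be LS by maximality of r, so d <= r and u < c <= d <= r, against r < u.\<close>

lemma LS_standard_factorization:
  assumes u: "LS u" and len: "1 < length u"
  obtains l r where "u = l @ r" "LS l" "LS r" "wless r l" "length l = lsk u"
    "l = take (lsk u) u" "r = drop (lsk u) u"
    "\<And>s t. u = s @ t \<Longrightarrow> s \<noteq> [] \<Longrightarrow> LS t \<Longrightarrow> length t \<le> length r"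
proof
  define l r where lr: "l = take (lsk u) u" "r = drop (lsk u) u"
  note lsk = lsk[OF len]
  show eq: "u = l @ r" and r: "LS r" and length: "length l = lsk u"
    using lr lsk by auto
  show maxr: "length t \<le> length r" if "u = s @ t" "s \<noteq> []" "LS t" for s t
  proof -
    have "lsk u \<le> length s" using lsk(4)[of "length s"] that LS_nonempty[of t] by simp
    then show ?thesis using that lr by simp
  qed
  have l0: "l \<noteq> []" using lsk lr by auto
  have ru: "sless r u" using LS_suffix[of l r] u eq l0 LS_nonempty[OF r] by simp
  show "wless r l"
    using ru wless_append_left[of l r] eq LS_nonempty[OF r] by (metis sless_imp_wless wless_trans)
  obtain cs where cs: "concat cs = l" "is_lfact cs" using lfact_exists by blast
  have "\<not> (\<exists>c d ds. cs = c # ds @ [d])"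
  proof
    assume "\<exists>c d ds. cs = c # ds @ [d]"
    then obtain c d ds where csd: "cs = c # ds @ [d]" by blast
    then have *: "LS c" "LS d" "wle c d" "l = c @ concat ds @ d"
      using cs by (auto simp: is_lfact_def)
    have "u = (c @ concat ds) @ (d @ r)" using * eq by simp
    from maxr[OF this] have "\<not> LS (d @ r)"
      using LS_nonempty[OF *(1)] LS_nonempty[OF *(2)] by auto
    then have "wle d r" using LS_concat[of d r] * r wless_linear[of d r] by blast
    moreover have "wle u c" using * eq LS_nonempty[OF r] by simp
    ultimately have "wle u r" using * wle_trans by blast
    then show False using ru by (metis sless_imp_wless wless_asym wless_irrefl)
  qed
  moreover have "cs \<noteq> []" using cs l0 by auto
  ultimately obtain c where "cs = [c]"
    by (cases cs; cases "tl cs" rule: rev_cases) auto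
  then show "LS l" using cs by (simp add: is_lfact_def)
qed (auto)

text \<open>This tells when [u][v] is already the standard bracketing of u v. A longer LS suffix s v
  would give v < s v < a <= z <= v, where a and z are the first and last LS factors of s: z is an LS
  suffix of u, hence a suffix of the right standard factor of u, and so at most v.\<close>

lemma lsk_append:
  assumes u: "LS u" and v: "LS v" and vu: "wless v u"
    and r: "1 < length u \<Longrightarrow> wle (drop (lsk u) u) v"
  shows "lsk (u @ v) = length u"
proof -
  have u0: "u \<noteq> []" and v0: "v \<noteq> []" using u v LS_nonempty by auto
  then have len: "1 < length (u @ v)" by (cases u; cases v) auto
  note lsk = lsk[OF len]
  have le: "lsk (u @ v) \<le> length u" using lsk(4)[of "length u"] u0 v0 v by simp
  moreover have "\<not> lsk (u @ v) < length u"
  proof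
    assume lt: "lsk (u @ v) < length u"
    define s where "s = drop (lsk (u @ v)) u"
    have s: "s \<noteq> []" "LS (s @ v)" using lt lsk by (auto simp: s_def)
    obtain t where us: "u = t @ s" "t \<noteq> []"
      using that[of "take (lsk (u @ v)) u"] lt lsk(1) u0 by (auto simp: s_def)
    have len1: "1 < length u" using lt lsk(1) by linarith
    obtain a as z bs where *: "s = a @ concat as" "s = concat bs @ z" "LS a" "LS z" "wle a z"
      using is_lfact_nonempty[OF s(1)] by blast
    obtain l r' where lr: "u = l @ r'" "r' = drop (lsk u) u"
      and maxr: "\<And>s t. u = s @ t \<Longrightarrow> s \<noteq> [] \<Longrightarrow> LS t \<Longrightarrow> length t \<le> length r'" and r': "LS r'"
      using LS_standard_factorization[OF u len1] by metis
    have uz: "u = (t @ concat bs) @ z" using us(1) *(2) by simp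
    then have "length z \<le> length r'" using maxr us(2) * by blast
    moreover obtain y where "l = (t @ concat bs) @ y \<and> y @ r' = z \<or> l @ y = t @ concat bs \<and> r' = y @ z"
      using uz lr(1) append_eq_append_conv2[of l r' "t @ concat bs" z] by auto
    ultimately have y: "r' = y @ z" by auto
    then have "wle z r'" using LS_suffix[of y z] r' LS_nonempty[OF *(4)] sless_imp_wless by (cases "y = []") auto
    then have "wle a v" using * r[OF len1] lr wle_trans by metis
    moreover have "wless (s @ v) a" using * v0 by simp
    moreover have "wless v (s @ v)" using LS_suffix[of s v] s v0 by (simp add: sless_imp_wless)
    ultimately show False by (metis wless_trans wless_asym)
  qed
  ultimately show ?thesis by simp
qed

text \<open>As x x < x, something must exclude words v between them. If v = x z, then z < x, for
  otherwise v would have a border or the suffix z would exceed v.\<close>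

lemma wless_square:
  assumes v: "LS v" and x: "LS x" and vx: "wless v x"
  shows "wless v (x @ x)"
proof (cases "sless v x")
  case True
  then show ?thesis using sless_append[of v x "[]" x] sless_imp_wless by simp
next
  case False
  then obtain z where z: "z \<noteq> []" "v = x @ z" using vx by (auto simp: wless_iff_sless)
  have "sless z v" using LS_suffix[of x z] v z LS_nonempty[OF x] by simp
  have "wless z x"
  proof (rule ccontr)
    assume "\<not> wless z x"
    then have "z = x \<or> sless x z \<or> (\<exists>y. y \<noteq> [] \<and> x = z @ y)"
      using wless_linear[of z x] by (auto simp: wless_iff_sless)
    then show False
    proof (elim disjE exE conjE)
      assume "z = x" then show False using z v LS_unbordered[of v x x x] LS_nonempty[OF x] by simp
    next
      assume "sless x z"
      then have "sless (x @ z) (z @ [])" by (rule sless_append)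
      then show False using \<open>sless z v\<close> z by (metis append_Nil2 sless_trans sless_irrefl)
    next
      fix y assume "x = z @ y"
      then show False using LS_unbordered[of v x z "y @ z"] v z LS_nonempty[OF x] by simp
    qed
  qed
  then show ?thesis using z by simp
qed

text \<open>Otherwise v glued to the right standard factor would be a longer proper LS suffix. So a
  node that cuts an occurrence of v begins with v, which justifies the last case of
  \<open>mk\<close>.\<close>

lemma LS_straddling_factor:
  assumes "1 < length u" "LS u" "LS v" "u = a @ v @ b"
    "lsk u < length a + length v" "length a < lsk u"
  shows "a = []"
proof (rule ccontr)
  assume a: "a \<noteq> []"
  obtain l r where lr: "u = l @ r" "LS r" "length l = lsk u"
    and maxr: "\<And>s t. u = s @ t \<Longrightarrow> s \<noteq> [] \<Longrightarrow> LS t \<Longrightarrow> length t \<le> length r"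
    using LS_standard_factorization[OF assms(2,1)] by metis
  have "l @ r = a @ v @ b" using lr assms(4) by simp
  then obtain s where "a @ s = l \<and> v @ b = s @ r \<or> a = l @ s \<and> s @ v @ b = r"
    by (metis append_eq_append_conv2)
  then have s: "l = a @ s" "s \<noteq> []" "v @ b = s @ r" using lr(3) assms(6) by auto
  then obtain t where "v @ t = s \<and> b = t @ r \<or> v = s @ t \<and> t @ b = r"
    by (metis append_eq_append_conv2)
  then have t: "v = s @ t" "t \<noteq> []" "r = t @ b"
    using s(1) lr(3) assms(5) by auto
  have "LS (s @ t @ b)" using LS_overlap[of s t b] assms(3) t lr by simp
  then show False using maxr[of a "s @ t @ b"] a lr s t by simp
qed

section \<open>Leading words and standard bracketings\<close>

lemma dlless_irrefl [simp]: "\<not> dlless u u"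
  by (simp add: dlless_def)

lemma dlless_trans: "dlless u v \<Longrightarrow> dlless v w \<Longrightarrow> dlless u w"
  by (auto simp: dlless_def dest: wless_trans)

lemma dlless_linear: "dlless u v \<or> u = v \<or> dlless v u"
  using wless_linear by (auto simp: dlless_def)

lemma dlless_append_left: "dlless u u' \<Longrightarrow> dlless (u @ v) (u' @ v)"
  by (auto simp: dlless_def) (metis sless_append sless_imp_wless wless_imp_sless order_refl)

lemma dlless_append_right: "dlless v v' \<Longrightarrow> dlless (u @ v) (u @ v')"
  by (auto simp: dlless_def)

lemma ex_dlless_max:
  assumes "finite A" "A \<noteq> {}"
  shows "\<exists>u\<in>A. \<forall>x\<in>A. x = u \<or> dlless x u"
  using assms
proof (induction A rule: finite_ne_induct)
  case (insert a A)
  then obtain u where u: "u \<in> A" "\<forall>x\<in>A. x = u \<or> dlless x u" by blast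
  show ?case
  proof (cases "dlless u a")
    case True
    then have "\<forall>x\<in>insert a A. x = a \<or> dlless x a" using u by (auto dest: dlless_trans)
    then show ?thesis by blast
  next
    case False
    then have "\<forall>x\<in>insert a A. x = u \<or> dlless x u" using u dlless_linear[of u a] by auto
    then show ?thesis using u(1) by blast
  qed
qed auto

text \<open>Lengths are compared first, so descent along \<open>dlless\<close> over the letters of X
  terminates.\<close>

lemma finite_dlless: "finite {u. set u \<subseteq> {x. inX n x} \<and> dlless u w}"
proof (rule finite_subset)
  have "{x. inX n x} \<subseteq> E ` {..n} \<union> H ` {..n} \<union> F ` {..n}"
  proof
    fix x assume "x \<in> {x. inX n x}"
    then show "x \<in> E ` {..n} \<union> H ` {..n} \<union> F ` {..n}" by (cases x) (auto simp: inX_def)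
  qed
  then have "finite {x. inX n x}" by (rule finite_subset) auto
  then show "finite {u. set u \<subseteq> {x. inX n x} \<and> length u \<le> length w}"
    by (rule finite_lists_length_le)
qed (auto simp: dlless_def)

text \<open>Kept as a relation so that sums and products can be treated without the description
  operator in \<open>lw\<close>.\<close>

definition lead :: "'k::field wpoly \<Rightarrow> letter list \<Rightarrow> 'k \<Rightarrow> bool" where
  "lead p u c \<longleftrightarrow> Poly_Mapping.lookup p u = c \<and> c \<noteq> 0
    \<and> (\<forall>x. Poly_Mapping.lookup p x \<noteq> 0 \<longrightarrow> x = u \<or> dlless x u)"

lemma lead_lw:
  assumes "lead p u c"
  shows "lw p = u"
  unfolding lw_def
proof (rule the_equality)
  show "u \<in> Poly_Mapping.keys p \<and> (\<forall>x\<in>Poly_Mapping.keys p. x \<noteq> u \<longrightarrow> dlless x u)"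
    using assms by (auto simp: lead_def in_keys_iff)
  then show "w = u" if "w \<in> Poly_Mapping.keys p \<and> (\<forall>x\<in>Poly_Mapping.keys p. x \<noteq> w \<longrightarrow> dlless x w)" for w
    using that dlless_trans[of u w u] dlless_irrefl[of u] by metis
qed

lemma ex_lead:
  assumes "p \<noteq> 0"
  shows "\<exists>u c. lead p u c"
proof -
  obtain u where "u \<in> Poly_Mapping.keys p" "\<forall>x\<in>Poly_Mapping.keys p. x = u \<or> dlless x u"
    using ex_dlless_max[OF finite_keys, of p] assms by auto
  then have "lead p u (Poly_Mapping.lookup p u)" by (auto simp: lead_def in_keys_iff Ball_def)
  then show ?thesis by blast
qed

lemma lead_nonzero: "lead p u c \<Longrightarrow> p \<noteq> 0"
  by (auto simp: lead_def)

lemma lead_coeff: "lead p u c \<Longrightarrow> c \<noteq> 0"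
  by (auto simp: lead_def)

lemma lead_monic: "lead p u 1 \<Longrightarrow> monic p"
  using lead_lw[of p u 1] lead_nonzero[of p u 1] by (simp add: monic_def lead_def)

lemma lead_mon: "lead p u 1 \<Longrightarrow> mon p = p"
  using lead_lw[of p u 1] by (simp add: mon_def lead_def)

lemma lead_smul: "lead p u c \<Longrightarrow> d \<noteq> 0 \<Longrightarrow> lead (smul d p) u (d * c)"
  by (auto simp: lead_def)

definition wbelow :: "letter list \<Rightarrow> 'k::field wpoly \<Rightarrow> bool" where
  "wbelow w p \<longleftrightarrow> (\<forall>x. Poly_Mapping.lookup p x \<noteq> 0 \<longrightarrow> dlless x w)"

lemma wbelow_lead: "wbelow w p \<Longrightarrow> lead p u c \<Longrightarrow> dlless u w"
  by (auto simp: wbelow_def lead_def)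

lemma lead_wbelow: "lead p u c \<Longrightarrow> dlless u w \<Longrightarrow> wbelow w p"
  by (auto simp: wbelow_def lead_def dest: dlless_trans)

lemma wbelow_lw: "wbelow w p \<longleftrightarrow> p = 0 \<or> dlless (lw p) w"
proof (cases "p = 0")
  case False
  then obtain u c where "lead p u c" using ex_lead by blast
  then show ?thesis using False lead_lw[of p u c] wbelow_lead[of w p u c] lead_wbelow[of p u c w] by blast
qed (simp add: wbelow_def)

lemma wbelow_add: "wbelow w p \<Longrightarrow> wbelow w q \<Longrightarrow> wbelow w (p + q)"
  unfolding wbelow_def lookup_add by (metis add_0)

lemma wbelow_smul: "wbelow w p \<Longrightarrow> wbelow w (smul c p)"
  by (auto simp: wbelow_def)

lemma lead_diff_wbelow: "lead p u c \<Longrightarrow> lead q u c \<Longrightarrow> wbelow u (p - q)"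
  unfolding wbelow_def lead_def lookup_minus by (metis diff_self)

lemma lead_add_wbelow: "lead p u c \<Longrightarrow> wbelow u q \<Longrightarrow> lead (p + q) u c"
  unfolding wbelow_def lead_def lookup_add by (metis add_0 add_0_right dlless_irrefl)

lemma lookup_mult_nonzero:
  assumes "Poly_Mapping.lookup (p * q) x \<noteq> (0 :: 'k::field)"
  shows "\<exists>u v. x = u @ v \<and> Poly_Mapping.lookup p u \<noteq> 0 \<and> Poly_Mapping.lookup q v \<noteq> 0"
proof -
  have "x \<in> Poly_Mapping.keys (p * q)" using assms by (simp add: in_keys_iff)
  then obtain u v where "x = u + v" "u \<in> Poly_Mapping.keys p" "v \<in> Poly_Mapping.keys q"
    using keys_mult[of p q] by blast
  then show ?thesis unfolding plus_list_def in_keys_iff by blast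
qed

lemma lead_split: "lead p u c \<Longrightarrow> \<exists>p'. p = Poly_Mapping.single u c + p' \<and> wbelow u p'"
  by (rule exI[of _ "p - Poly_Mapping.single u c"])
    (auto simp: wbelow_def lead_def lookup_minus lookup_single when_def split: if_splits)

lemma lead_single: "c \<noteq> 0 \<Longrightarrow> lead (Poly_Mapping.single u c) u c"
  by (auto simp: lead_def lookup_single when_def)

lemma lead_mult:
  assumes "lead p u c" "lead q v d"
  shows "lead (p * q) (u @ v) (c * d)"
proof -
  obtain p' q' where p': "p = Poly_Mapping.single u c + p'" "wbelow u p'"
    and q': "q = Poly_Mapping.single v d + q'" "wbelow v q'"
    using assms lead_split by metis
  have "p * q = Poly_Mapping.single (u @ v) (c * d) + (Poly_Mapping.single u c * q' + p' * q)"
    by (simp add: p' q' algebra_simps mult_single plus_list_def)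
  moreover have "wbelow (u @ v) (Poly_Mapping.single u c * q')"
    unfolding wbelow_def
  proof (intro allI impI)
    fix x assume "Poly_Mapping.lookup (Poly_Mapping.single u c * q') x \<noteq> 0"
    then obtain a b where "x = a @ b" "a = u" "dlless b v"
      using q'(2) unfolding wbelow_def by (metis lookup_mult_nonzero lookup_single_not_eq)
    then show "dlless x (u @ v)"
      using dlless_append_right by blast
  qed
  moreover have "wbelow (u @ v) (p' * q)"
    unfolding wbelow_def
  proof (intro allI impI)
    fix x assume "Poly_Mapping.lookup (p' * q) x \<noteq> 0"
    then obtain a b where "x = a @ b" "dlless a u" "b = v \<or> dlless b v"
      using p'(2) assms(2) unfolding wbelow_def lead_def by (meson lookup_mult_nonzero)
    then show "dlless x (u @ v)"
      using dlless_append_left dlless_append_right dlless_trans by blast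
  qed
  moreover have "c * d \<noteq> 0" using assms by (simp add: lead_def)
  ultimately show ?thesis
    using lead_add_wbelow[OF lead_single wbelow_add] by metis
qed

lemma lead_br:
  assumes "hom n a p" "hom n b q" "lead p u c" "lead q v d" "wless (v @ u) (u @ v)"
  shows "lead (br n p q) (u @ v) (c * d)"
proof -
  have "dlless (v @ u) (u @ v)" using assms(5) by (simp add: dlless_def)
  then have 1: "wbelow (u @ v) (q * p)"
    using lead_mult[OF assms(4,3)] lead_wbelow by blast
  then have 2: "wbelow (u @ v) (- (q * p))" using wbelow_smul[of _ "q * p" "- 1"] by simp
  show ?thesis
    using lead_add_wbelow[OF lead_mult[OF assms(3,4)] 1] lead_add_wbelow[OF lead_mult[OF assms(3,4)] 2]
    by (simp add: br_hom[OF assms(1,2)])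
qed

text \<open>For odd factors both products have the leading word u u and their coefficients add up,
  so characteristic 2 must be excluded.\<close>

lemma lead_br_square:
  assumes "hom n True p" "hom n True q" "lead p u c" "lead q u d" "(2::'k::field) \<noteq> 0"
  shows "lead (br n p q) (u @ u) (2 * c * d :: 'k)"
proof -
  have "Poly_Mapping.lookup (p * q + q * p) (u @ u) = 2 * c * d" "2 * c * d \<noteq> 0"
    using lead_mult[OF assms(3,4)] lead_mult[OF assms(4,3)] assms(5)
    by (simp_all add: lead_def lookup_add)
  moreover have "x = u @ u \<or> dlless x (u @ u)" if "Poly_Mapping.lookup (p * q + q * p) x \<noteq> 0" for x
    using lead_mult[OF assms(3,4)] lead_mult[OF assms(4,3)] that
    unfolding lead_def lookup_add by (metis add_0)
  ultimately show ?thesis by (simp add: br_hom[OF assms(1,2)] lead_def)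
qed

lemma lead_lt: "lead (lt x) [x] 1"
  by (simp add: lt_def lead_single)

section \<open>Standard bracketings and their leading words\<close>

lemma sbt_aux_fuel: "length u \<le> f \<Longrightarrow> length u \<le> g \<Longrightarrow> u \<noteq> [] \<Longrightarrow> sbt_aux f u = sbt_aux g u"
proof (induction "length u" arbitrary: u f g rule: less_induct)
  case less
  from less.prems obtain f' g' where fg: "f = Suc f'" "g = Suc g'"
    by (cases f; cases g; cases u) auto
  show ?case
  proof (cases "length u \<le> 1")
    case False
    then have "0 < lsk u" "lsk u < length u" using lsk[of u] by auto
    moreover from this have "sbt_aux f' (take (lsk u) u) = sbt_aux g' (take (lsk u) u)"
      by (intro less.hyps) (use less.prems fg in auto)
    moreover have "sbt_aux f' (drop (lsk u) u) = sbt_aux g' (drop (lsk u) u)"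
      by (intro less.hyps) (use less.prems fg calculation in auto)
    ultimately show ?thesis by (simp add: fg)
  qed (simp add: fg)
qed

lemma sbt_single: "sbt [x] = Lf x"
  by (simp add: sbt_def)

lemma sbt_Nd:
  assumes "1 < length u"
  shows "sbt u = Nd (sbt (take (lsk u) u)) (sbt (drop (lsk u) u))"
proof -
  obtain f where f: "length u = Suc f" using assms by (cases "length u") auto
  have "0 < lsk u" "lsk u < length u" using lsk[OF assms] by auto
  then have "sbt_aux f (take (lsk u) u) = sbt (take (lsk u) u)"
    "sbt_aux f (drop (lsk u) u) = sbt (drop (lsk u) u)"
    using f unfolding sbt_def by (auto intro!: sbt_aux_fuel)
  then show ?thesis using assms f by (simp add: sbt_def)
qed

lemma leaves_sbt: "u \<noteq> [] \<Longrightarrow> leaves (sbt u) = u"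
proof (induction "length u" arbitrary: u rule: less_induct)
  case less
  show ?case
  proof (cases "1 < length u")
    case True
    note lsk = lsk[OF True]
    then show ?thesis using less by (simp add: sbt_Nd[OF True])
  next
    case False
    then obtain x where "u = [x]" using less.prems by (cases u) auto
    then show ?thesis by (simp add: sbt_single)
  qed
qed

text \<open>The tree has no hole, so the polynomial 0 passed to \<open>evt\<close> is only a
  placeholder.\<close>

definition bracketing :: "nat \<Rightarrow> letter list \<Rightarrow> 'k::field wpoly" where
  "bracketing n u = evt n 0 (map_btree Some (sbw u))"

lemma evt_map_Some: "evt n p (map_btree Some t) = evt n 0 (map_btree Some t)"
  by (induction t) auto

lemma evt_sbt: "LS u \<Longrightarrow> evt n p (map_btree Some (sbt u)) = bracketing n u"
  using evt_map_Some[of n p "sbt u"] by (simp add: bracketing_def sbw_def)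

lemma bracketing_single [simp]: "bracketing n [x] = lt x"
  by (simp add: bracketing_def sbw_def sbt_single)

lemma bracketing_Nd:
  assumes "LS u" "1 < length u"
  shows "bracketing n u = br n (bracketing n (take (lsk u) u)) (bracketing n (drop (lsk u) u))"
proof -
  obtain l r where "l = take (lsk u) u" "r = drop (lsk u) u" "LS l" "LS r"
    using LS_standard_factorization[OF assms] by metis
  then show ?thesis
    unfolding evt_sbt[OF assms(1), of n 0, symmetric] sbt_Nd[OF assms(2)] by (simp add: evt_sbt)
qed

lemma not_LS_square: "v \<noteq> [] \<Longrightarrow> \<not> LS (v @ v)"
  by (metis LS_rotate wless_irrefl)

lemma bracketing_square:
  assumes "LS v"
  shows "bracketing n (v @ v) = br n (bracketing n v) (bracketing n v)"
  using not_LS_square[OF LS_nonempty[OF assms]] assms evt_sbt[OF assms, of n 0]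
  by (simp add: bracketing_def sbw_def)

lemma LS_induct [consumes 1, case_names single Nd]:
  assumes "LS u" and "\<And>x. P [x]"
    and "\<And>l r. LS (l @ r) \<Longrightarrow> LS l \<Longrightarrow> LS r \<Longrightarrow> wless r l \<Longrightarrow> lsk (l @ r) = length l \<Longrightarrow>
      P l \<Longrightarrow> P r \<Longrightarrow> P (l @ r)"
  shows "P u"
  using assms(1)
proof (induction "length u" arbitrary: u rule: less_induct)
  case less
  show ?case
  proof (cases "1 < length u")
    case True
    obtain l r where lr: "u = l @ r" "LS l" "LS r" "wless r l" "length l = lsk u"
      using LS_standard_factorization[OF less.prems True] by metis
    have "l \<noteq> []" "r \<noteq> []" using lr LS_nonempty by auto
    then have "length l < length u" "length r < length u" using lr(1) by auto
    then have "P l" "P r" using less.hyps lr by blast+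
    moreover have "LS (l @ r)" "lsk (l @ r) = length l" using less.prems lr(1,5) by auto
    ultimately show ?thesis using assms(3)[of l r] lr by blast
  next
    case False
    then obtain x where "u = [x]" using LS_nonempty[OF less.prems] by (cases u) auto
    then show ?thesis using assms(2) by simp
  qed
qed

lemma bracketing_append:
  assumes "LS (l @ r)" "lsk (l @ r) = length l" "LS l" "LS r"
  shows "bracketing n (l @ r) = br n (bracketing n l) (bracketing n r)"
  using bracketing_Nd[OF assms(1), of n] assms LS_nonempty[of l] LS_nonempty[of r]
  by (cases l; cases r) auto

lemma hom_bracketing_LS: "LS u \<Longrightarrow> hom n (oddw n u) (bracketing n u)"
proof (induction u rule: LS_induct)
  case (single x)
  then show ?case using hom_lt[of n x] by (cases "oddl n x") (simp_all add: oddw_def)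
next
  case (Nd l r)
  then show ?case using hom_br[of n "oddw n l" _ "oddw n r"] by (simp add: bracketing_append)
qed

lemma lead_bracketing_LS: "LS u \<Longrightarrow> lead (bracketing n u) u 1"
proof (induction u rule: LS_induct)
  case (single x)
  then show ?case using lead_lt by simp
next
  case (Nd l r)
  then show ?case
    using lead_br[OF hom_bracketing_LS hom_bracketing_LS Nd.IH] LS_rotate[of l r] LS_nonempty
    by (simp add: bracketing_append)
qed

lemma superLS_cases [consumes 1, case_names LS square]:
  assumes "superLS n u"
  obtains "LS u" | v where "u = v @ v" "LS v" "oddw n v"
  using assms by (auto simp: superLS_def)

lemma hom_bracketing: "superLS n u \<Longrightarrow> hom n (oddw n u) (bracketing n u)"
proof (induction rule: superLS_cases)
  case (square v)
  then show ?case using hom_br[OF hom_bracketing_LS[of v n] hom_bracketing_LS[of v n]] by (simp add: bracketing_square)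
qed (rule hom_bracketing_LS)

lemma lead_bracketing:
  assumes "(2::'k::field) \<noteq> 0" "superLS n u"
  shows "\<exists>c. lead (bracketing n u :: 'k wpoly) u c"
  using assms(2)
proof (cases rule: superLS_cases)
  case (square v)
  then have "hom n True (bracketing n v :: 'k wpoly)" using hom_bracketing_LS[of v n] by simp
  from lead_br_square[OF this this lead_bracketing_LS lead_bracketing_LS assms(1)] show ?thesis
    using square by (auto simp: bracketing_square)
qed (use lead_bracketing_LS in blast)

lemma free_lie_bracketing:
  assumes "superLS n u" "set u \<subseteq> {x. inX n x}"
  shows "bracketing n u \<in> free_lie n"
proof -
  have LS: "bracketing n u \<in> free_lie n" if "LS u" "set u \<subseteq> {x. inX n x}" for u
    using that by (induction u rule: LS_induct) (auto simp: bracketing_append intro: free_lie.intros)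
  show ?thesis using assms
    by (induction rule: superLS_cases) (auto simp: bracketing_square intro!: LS free_lie.brk)
qed

section \<open>Standard bracketings span the free Lie superalgebra\<close>

text \<open>Comparing roots instead of words treats v and its square v v alike.\<close>

definition root :: "letter list \<Rightarrow> letter list" where
  "root u = (if LS u then u else take (length u div 2) u)"

lemma root_LS [simp]: "LS u \<Longrightarrow> root u = u"
  by (simp add: root_def)

lemma root_square [simp]: "LS v \<Longrightarrow> root (v @ v) = v"
  using not_LS_square[OF LS_nonempty] by (simp add: root_def)

lemma LS_root: "superLS n u \<Longrightarrow> LS (root u)"
  by (auto elim: superLS_cases)

lemma wle_root: "superLS n u \<Longrightarrow> wle u (root u)"
  by (auto elim!: superLS_cases dest: LS_nonempty)

lemma mset_root: "superLS n u \<Longrightarrow> mset (root u) \<subseteq># mset u"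
  by (auto elim!: superLS_cases)

text \<open>Rewriting a bracket preserves the multiset of letters, so fixing it leaves finitely many
  candidate words; the lower bound \<open>v\<close> drives the induction.\<close>

definition above_span :: "nat \<Rightarrow> letter list \<Rightarrow> letter multiset \<Rightarrow> 'k::field wpoly set" where
  "above_span n v M = wp.span {bracketing n w | w. superLS n w \<and> mset w = M \<and> wless v w}"

lemma above_span_mono: "wless v v' \<Longrightarrow> x \<in> above_span n v' M \<Longrightarrow> x \<in> above_span n v M"
  unfolding above_span_def by (rule subsetD[OF wp.span_mono]) (auto dest: wless_trans)

lemma above_span_br_right:
  assumes "x \<in> above_span n v M"
    and "\<And>w. superLS n w \<Longrightarrow> mset w = M \<Longrightarrow> wless v w \<Longrightarrow> br n p (bracketing n w) \<in> above_span n v M'"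
  shows "br n p x \<in> above_span n v M'"
  unfolding above_span_def
  by (rule br_span_right[OF assms(1)[unfolded above_span_def]])
    (use assms(2) in \<open>auto simp: above_span_def\<close>)

lemma br_bracketing_commute:
  assumes "superLS n a" "superLS n b"
    and "br n (bracketing n b) (bracketing n a) \<in> (above_span n v M :: 'k::field wpoly set)"
  shows "br n (bracketing n a) (bracketing n b :: 'k wpoly) \<in> above_span n v M"
  using assms(3) unfolding br_commute[OF hom_bracketing[OF assms(1)] hom_bracketing[OF assms(2)]]
    above_span_def by (rule wp.span_scale)

lemma jacobi_above_span:
  assumes "superLS n a" "superLS n b" "superLS n c"
    and "br n (bracketing n a) (br n (bracketing n b) (bracketing n c :: 'k::field wpoly)) \<in> above_span n v M"
    and "br n (bracketing n b) (br n (bracketing n a) (bracketing n c :: 'k wpoly)) \<in> above_span n v M"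
  shows "br n (br n (bracketing n a) (bracketing n b)) (bracketing n c :: 'k wpoly) \<in> above_span n v M"
  unfolding br_jacobi[OF assms(1-3)[THEN hom_bracketing]]
  using assms(4,5) unfolding above_span_def by (intro wp.span_diff wp.span_scale)

text \<open>Both words are x or x x for one LS word x. For odd x, the element [x][x] is twice an
  associative square and commutes with [x], so only the bracket of [x] with itself survives; for
  even x that one vanishes too.\<close>

lemma br_same_root:
  assumes "superLS n a" "superLS n b" "root a = root b"
  shows "br n (bracketing n a) (bracketing n b) = (0 :: 'k::field wpoly) \<or>
    a = b \<and> LS a \<and> oddw n a \<and> br n (bracketing n a) (bracketing n b :: 'k wpoly) = bracketing n (a @ a)"
proof -
  define x where "x = root a"
  have x: "LS x" "root b = x" using LS_root[OF assms(1)] assms(3) by (auto simp: x_def)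
  let ?x = "bracketing n x :: 'k wpoly"
  have hx: "hom n (oddw n x) ?x" by (rule hom_bracketing_LS[OF x(1)])
  have ab: "(c = x) \<or> (c = x @ x \<and> oddw n x)" if "superLS n c" "root c = x" for c
    using that by (auto elim!: superLS_cases)
  have sq: "br n ?x ?x = (if oddw n x then bracketing n (x @ x) else 0)"
    using br_hom[OF hx hx] by (simp add: bracketing_square[OF x(1)])
  have sq2: "br n (br n ?x ?x) (br n ?x ?x) = 0"
    using br_hom[OF hom_br[OF hx hx] hom_br[OF hx hx]] by simp
  have sq1: "br n (br n ?x ?x) ?x = 0" "br n ?x (br n ?x ?x) = 0" if "oddw n x"
    using that br_hom[OF hom_br[OF hx hx] hx] br_hom[OF hx hom_br[OF hx hx]]
    by (simp_all add: br_hom[OF hx hx] algebra_simps)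
  note bsq = bracketing_square[OF x(1), of n]
  have A: "a = x \<or> (a = x @ x \<and> oddw n x)" by (rule ab[OF assms(1)]) (simp add: x_def)
  have B: "b = x \<or> (b = x @ x \<and> oddw n x)" by (rule ab[OF assms(2) x(2)])
  show ?thesis
  proof (cases "a = x \<and> b = x")
    case True
    then show ?thesis using sq x(1) by (cases "oddw n x") auto
  next
    case False
    then have odd: "oddw n x" using A B by auto
    show ?thesis using False A B sq1[OF odd] sq2 by (elim disjE) (simp_all add: bsq)
  qed
qed

lemma superLS_squareI: "LS v \<Longrightarrow> oddw n v \<Longrightarrow> superLS n (v @ v)"
  by (auto simp: superLS_def)

text \<open>Closure of the span under brackets is proved by induction on the multiset of letters and, for a
  fixed multiset, downwards on the smaller root \<open>v\<close> of the two factors: when the larger factor is not a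
  letter, the Jacobi identity splits it, and all resulting brackets have both roots above \<open>v\<close>.\<close>

definition br_rises :: "'k::field itself \<Rightarrow> nat \<Rightarrow> letter multiset \<Rightarrow> letter list \<Rightarrow> bool" where
  "br_rises _ n M v \<longleftrightarrow> (\<forall>a b. superLS n a \<longrightarrow> superLS n b \<longrightarrow> mset a + mset b = M \<longrightarrow> root b = v \<longrightarrow>
    wless v (root a) \<longrightarrow> br n (bracketing n a) (bracketing n b :: 'k wpoly) \<in> above_span n v M)"

text \<open>If the roots differ, the smaller one exceeds \<open>v\<close> and \<open>rises\<close>
  applies to it. If they agree, only a square can survive, and it exceeds \<open>v\<close> by
  \<open>wless_square\<close>.\<close>

lemma br_above_span_strict:
  assumes rises: "\<And>v'. wless v v' \<Longrightarrow> mset v' \<subseteq># M \<Longrightarrow> br_rises TYPE('k::field) n M v'" and v: "LS v"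
    and ab: "superLS n a" "superLS n b" "mset a + mset b = M" "wless v (root a)" "wless v (root b)"
  shows "br n (bracketing n a) (bracketing n b :: 'k wpoly) \<in> above_span n v M"
proof -
  have sub: "mset (root a) \<subseteq># M" "mset (root b) \<subseteq># M"
    using mset_root[OF ab(1)] mset_root[OF ab(2)] ab(3)
    by (auto intro: subset_mset.order_trans)
  consider "root a = root b" | "wless (root b) (root a)" | "wless (root a) (root b)"
    using wless_linear by blast
  then show ?thesis
  proof cases
    case 1
    from br_same_root[OF ab(1,2) 1] show ?thesis
    proof (elim disjE conjE)
      assume "a = b" and a: "LS a" "oddw n a" and
        eq: "br n (bracketing n a) (bracketing n b :: 'k wpoly) = bracketing n (a @ a)"
      have "wless v (a @ a)" using wless_square[OF v a(1)] ab(4) a(1) by simp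
      moreover have "mset (a @ a) = M" using ab(3) \<open>a = b\<close> by simp
      ultimately show ?thesis
        unfolding eq above_span_def using superLS_squareI[OF a] by (intro wp.span_base) blast
    qed (simp add: above_span_def wp.span_zero)
  next
    case 2
    then have "br n (bracketing n a) (bracketing n b :: 'k wpoly) \<in> above_span n (root b) M"
      using rises[OF ab(5) sub(2)] ab by (simp add: br_rises_def)
    then show ?thesis by (rule above_span_mono[OF ab(5)])
  next
    case 3
    then have "br n (bracketing n b) (bracketing n a :: 'k wpoly) \<in> above_span n (root a) M"
      using rises[OF ab(4) sub(1)] ab by (simp add: br_rises_def add.commute)
    then show ?thesis using above_span_mono[OF ab(4)] br_bracketing_commute[OF ab(1,2)] by blast
  qed
qed

lemma br_rises_step:
  assumes smaller: "\<And>M' v'. size M' < size M \<Longrightarrow> br_rises TYPE('k::field) n M' v'"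
    and higher: "\<And>v'. wless v v' \<Longrightarrow> mset v' \<subseteq># M \<Longrightarrow> br_rises TYPE('k) n M v'"
  shows "br_rises TYPE('k) n M v"
proof (cases "LS v")
  case False
  then show ?thesis using LS_root by (auto simp: br_rises_def)
next
  case v: True
  note strict = br_above_span_strict[OF higher v]
  have vroot: "wless v (root w)" if "wless v w" "superLS n w" for w
    using that(1) wle_root[OF that(2)] by (rule wless_wle_trans)
  have sv: "superLS n v" using v by (simp add: superLS_def)
  have low: "br n (bracketing n c) (bracketing n v :: 'k wpoly) \<in> above_span n v (mset c + mset v)"
    if "superLS n c" "wless v (root c)" "size (mset c + mset v) < size M" for c
    using smaller[OF that(3), of v, unfolded br_rises_def, rule_format, OF that(1) sv refl root_LS[OF v] that(2)] .
  have main: "br n (bracketing n a) (bracketing n v :: 'k wpoly) \<in> above_span n v M"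
    if a: "superLS n a" "mset a + mset v = M" "wless v (root a)" for a
    using a(1)
  proof (cases rule: superLS_cases)
    case LS
    then have va: "wless v a" using a by simp
    have LSav: "LS (a @ v)" by (rule LS_concat[OF LS v va])
    show ?thesis
    \<comment> \<open>The right standard factor r of \<open>a\<close> decides. If r <= v, the
      bracket is already standard; if r > v, both factors of \<open>a\<close> exceed
      \<open>v\<close> and the Jacobi identity applies.\<close>
    proof (cases "1 < length a \<and> wless v (drop (lsk a) a)")
      case False
      then have "lsk (a @ v) = length a"
        using lsk_append[OF LS v va] wless_linear[of v "drop (lsk a) a"] by auto
      then have "bracketing n (a @ v) = br n (bracketing n a) (bracketing n v :: 'k wpoly)"
        by (rule bracketing_append[OF LSav _ LS v])
      moreover have "wless v (a @ v)"
        using LS_suffix[OF LSav] LS_nonempty[OF LS] LS_nonempty[OF v] sless_imp_wless by blast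
      moreover have "superLS n (a @ v)" "mset (a @ v) = M" using LSav a by (auto simp: superLS_def)
      ultimately show ?thesis 
        unfolding above_span_def by (metis (mono_tags, lifting) mem_Collect_eq wp.span_base)
    next
      case True
      obtain l r where lr: "a = l @ r" "LS l" "LS r" "wless r l" "length l = lsk a" "r = drop (lsk a) a"
        using LS_standard_factorization[OF LS] True by metis
      have vr: "wless v r" using True unfolding lr(6) by simp
      then have vl: "wless v l" using lr(4) by (rule wless_trans)
      have s: "superLS n l" "superLS n r" using lr(2,3) by (auto simp: superLS_def)
      have M: "M = mset l + mset r + mset v" using a(2) lr(1) by simp
      have "br n (br n (bracketing n l) (bracketing n r)) (bracketing n v :: 'k wpoly) \<in> above_span n v M"
      proof (rule jacobi_above_span[OF s sv])
        \<comment> \<open>The inner bracket has fewer letters, hence is a combination of bracketings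
          of words w > v; then \<open>l\<close> and w both have roots above
          \<open>v\<close>.\<close>
        show "br n (bracketing n l) (br n (bracketing n r) (bracketing n v :: 'k wpoly)) \<in> above_span n v M"
        proof (rule above_span_br_right)
          show "br n (bracketing n r) (bracketing n v :: 'k wpoly) \<in> above_span n v (mset r + mset v)"
            using low[OF s(2)] vr lr(3) M LS_nonempty[OF lr(2)] by simp
          fix w assume "superLS n w" "mset w = mset r + mset v" "wless v w"
          then show "br n (bracketing n l) (bracketing n w :: 'k wpoly) \<in> above_span n v M"
            using strict[OF _ _ s(1), of w] vl lr(2) M vroot[of w] by (simp add: add.assoc)
        qed
        show "br n (bracketing n r) (br n (bracketing n l) (bracketing n v :: 'k wpoly)) \<in> above_span n v M"
        proof (rule above_span_br_right)
          show "br n (bracketing n l) (bracketing n v :: 'k wpoly) \<in> above_span n v (mset l + mset v)"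
            using low[OF s(1)] vl lr(2) M LS_nonempty[OF lr(3)] by simp
          fix w assume "superLS n w" "mset w = mset l + mset v" "wless v w"
          then show "br n (bracketing n r) (bracketing n w :: 'k wpoly) \<in> above_span n v M"
            using strict[OF _ _ s(2), of w] vr lr(3) M vroot[of w] by (simp add: add_ac)
        qed
      qed
      moreover have "LS (l @ r)" "lsk (l @ r) = length l" using LS lr(1,5) by auto
      ultimately show ?thesis using lr(1-3) by (simp add: bracketing_append)
    qed
  next
    case (square u)
    have u: "superLS n u" "wless v (root u)" using square a by (auto simp: superLS_def)
    \<comment> \<open>For a square a = u u, both terms of the Jacobi identity contain this same
      double bracket.\<close>
    have *: "br n (bracketing n u) (br n (bracketing n u) (bracketing n v :: 'k wpoly)) \<in> above_span n v M"
    proof (rule above_span_br_right)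
      show "br n (bracketing n u) (bracketing n v :: 'k wpoly) \<in> above_span n v (mset u + mset v)"
        using low[OF u] square(1) a(2) LS_nonempty[OF square(2)] by auto
      fix w assume "superLS n w" "mset w = mset u + mset v" "wless v w"
      then show "br n (bracketing n u) (bracketing n w :: 'k wpoly) \<in> above_span n v M"
        using strict[OF _ _ u(1), of w] u(2) square(1) a(2) vroot[of w] by auto
    qed
    show ?thesis
      using jacobi_above_span[OF u(1) u(1) sv * *] bracketing_square[OF square(2)] square(1) by metis
  qed
  show ?thesis
    unfolding br_rises_def
  proof (intro allI impI)
    fix a b
    assume a: "superLS n a" and b: "superLS n b" and M: "mset a + mset b = M" and "root b = v"
      and va: "wless v (root a)"
    from b show "br n (bracketing n a) (bracketing n b :: 'k wpoly) \<in> above_span n v M"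
    proof (cases rule: superLS_cases)
      case LS
      then show ?thesis using main[OF a] M va \<open>root b = v\<close> by simp
    next
      case (square v')
      then have bv: "b = v @ v" using \<open>root b = v\<close> by simp
      have av: "br n (bracketing n v) (bracketing n a :: 'k wpoly) \<in> above_span n v (mset a + mset v)"
        using low[OF a va] M bv LS_nonempty[OF v] br_bracketing_commute[OF sv a] by auto
      \<comment> \<open>For b = v v, the factors are exchanged and [v][v] is unfolded against [a];
        what is left are brackets with a single [v], covered by \<open>main\<close>.\<close>
      have *: "br n (bracketing n v) (br n (bracketing n v) (bracketing n a :: 'k wpoly)) \<in> above_span n v M"
      proof (rule above_span_br_right[OF av])
        fix w assume "superLS n w" "mset w = mset a + mset v" "wless v w"
        then show "br n (bracketing n v) (bracketing n w :: 'k wpoly) \<in> above_span n v M"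
          using main[of w] M bv vroot[of w] br_bracketing_commute[OF sv] by (simp add: add.assoc)
      qed
      show ?thesis
        using jacobi_above_span[OF sv sv a * *] bracketing_square[OF v, of n] bv b
          br_bracketing_commute[OF a b] by metis
    qed
  qed
qed

text \<open>Outer induction on the number of letters, inner induction on the finite number of words
  above \<open>v\<close> made from letters of \<open>M\<close>.\<close>

lemma br_rises: "br_rises TYPE('k::field) n M v"
proof (induction M arbitrary: v rule: measure_induct_rule[of size])
  case (less M)
  note smaller = less.IH
  have fin: "finite {v'. mset v' \<subseteq># M \<and> wless v v'}" for v
  proof (rule finite_subset)
    show "finite {v'. set v' \<subseteq> set_mset M \<and> length v' \<le> size M}"
      by (rule finite_lists_length_le) simp
  qed (auto dest: size_mset_mono mset_subset_eqD)
  show ?case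
  proof (induction "card {v'. mset v' \<subseteq># M \<and> wless v v'}" arbitrary: v rule: less_induct)
    case less
    show ?case
    proof (rule br_rises_step[OF smaller])
      fix v' assume v': "wless v v'" "mset v' \<subseteq># M"
      show "br_rises TYPE('k) n M v'"
      proof (rule less.hyps)
        show "card {w. mset w \<subseteq># M \<and> wless v' w} < card {w. mset w \<subseteq># M \<and> wless v w}"
        proof (rule psubset_card_mono[OF fin])
          have "v' \<in> {w. mset w \<subseteq># M \<and> wless v w}" using v' by simp
          moreover have "v' \<notin> {w. mset w \<subseteq># M \<and> wless v' w}" by simp
          moreover have "{w. mset w \<subseteq># M \<and> wless v' w} \<subseteq> {w. mset w \<subseteq># M \<and> wless v w}"
            using v'(1) by (auto dest: wless_trans)
          ultimately show "{w. mset w \<subseteq># M \<and> wless v' w} \<subset> {w. mset w \<subseteq># M \<and> wless v w}"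
            by blast
        qed
      qed
    qed
  qed
qed

lemma br_bracketing_span:
  assumes a: "superLS n a" and b: "superLS n b"
  shows "br n (bracketing n a) (bracketing n b :: 'k::field wpoly)
    \<in> wp.span {bracketing n w | w. superLS n w \<and> set w = set a \<union> set b}"
    (is "_ \<in> ?V")
proof -
  have sub: "above_span n v (mset a + mset b) \<subseteq> ?V" for v
    unfolding above_span_def
    by (rule wp.span_mono) (auto simp flip: set_mset_mset simp: set_mset_union)
  consider "root a = root b" | "wless (root b) (root a)" | "wless (root a) (root b)"
    using wless_linear by blast
  then show ?thesis
  proof cases
    case 1
    from br_same_root[OF a b 1] show ?thesis
    proof (elim disjE conjE)
      assume "a = b" and a: "LS a" "oddw n a" and
        eq: "br n (bracketing n a) (bracketing n b :: 'k wpoly) = bracketing n (a @ a)"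
      then show ?thesis
        unfolding eq using superLS_squareI[OF a] by (intro wp.span_base) auto
    qed (simp add: wp.span_zero)
  next
    case 2
    then show ?thesis using br_rises[of n "mset a + mset b" "root b"] a b sub by (auto simp: br_rises_def)
  next
    case 3
    then show ?thesis using br_rises[of n "mset a + mset b" "root a"] a b sub br_bracketing_commute[OF a b]
      by (fastforce simp: br_rises_def add.commute)
  qed
qed

lemma free_lie_letters: "p \<in> free_lie n \<Longrightarrow> Poly_Mapping.lookup p u \<noteq> 0 \<Longrightarrow> set u \<subseteq> {x. inX n x}"
proof (induction arbitrary: u rule: free_lie.induct)
  case (gen x)
  then show ?case by (auto simp: lt_def lookup_single when_def split: if_splits)
next
  case (add p q)
  then show ?case unfolding lookup_add by (metis add_0)
next
  case (brk p q)
  have *: "Poly_Mapping.lookup (p * q) u \<noteq> 0 \<or> Poly_Mapping.lookup (q * p) u \<noteq> 0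
      \<or> Poly_Mapping.lookup (oddpart n q * oddpart n p) u \<noteq> 0"
    using brk.prems by (auto simp: br_eq lookup_add lookup_minus)
  have odd: "set v \<subseteq> {x. inX n x}" if "Poly_Mapping.lookup (oddpart n r) v \<noteq> 0" "r = p \<or> r = q" for r v
    using that brk.IH by (auto simp: lookup_oddpart split: if_splits)
  from * show ?case
  proof (elim disjE)
    assume "Poly_Mapping.lookup (oddpart n q * oddpart n p) u \<noteq> 0"
    then obtain a b where "u = a @ b" "Poly_Mapping.lookup (oddpart n q) a \<noteq> 0"
      "Poly_Mapping.lookup (oddpart n p) b \<noteq> 0"
      using lookup_mult_nonzero by blast
    then show ?thesis using odd[of q a] odd[of p b] by simp
  next
    assume "Poly_Mapping.lookup (p * q) u \<noteq> 0"
    then obtain a b where "u = a @ b" "Poly_Mapping.lookup p a \<noteq> 0" "Poly_Mapping.lookup q b \<noteq> 0"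
      using lookup_mult_nonzero by blast
    then show ?thesis using brk.IH(1)[of a] brk.IH(2)[of b] by simp
  next
    assume "Poly_Mapping.lookup (q * p) u \<noteq> 0"
    then obtain a b where "u = a @ b" "Poly_Mapping.lookup q a \<noteq> 0" "Poly_Mapping.lookup p b \<noteq> 0"
      using lookup_mult_nonzero by blast
    then show ?thesis using brk.IH(2)[of a] brk.IH(1)[of b] by simp
  qed
qed auto

lemma free_lie_diff: "p \<in> free_lie n \<Longrightarrow> q \<in> free_lie n \<Longrightarrow> p - q \<in> free_lie n"
  using free_lie.add[of p n "smul (- 1) q"] free_lie.scal[of q n "- 1"] by simp

text \<open>The spanning half of the basis theorem: letters are standard bracketings, and brackets
  of standard bracketings stay in the span.\<close>

lemma free_lie_span:
  "p \<in> free_lie n \<Longrightarrow> p \<in> wp.span {bracketing n w | w. superLS n w \<and> set w \<subseteq> {x. inX n x}}"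
  (is "_ \<Longrightarrow> _ \<in> wp.span ?V")
proof (induction rule: free_lie.induct)
  case (gen x)
  have "lt x = bracketing n [x] \<and> superLS n [x] \<and> set [x] \<subseteq> {x. inX n x}"
    using gen by (simp add: superLS_def)
  then show ?case by (intro wp.span_base) blast
next
  case (brk p q)
  show ?case
  proof (rule br_span_left[OF brk.IH(1)], rule br_span_right[OF brk.IH(2)])
    fix x y assume "x \<in> ?V" "y \<in> ?V"
    then obtain a b where *: "x = bracketing n a" "superLS n a" "set a \<subseteq> {x. inX n x}"
      "y = bracketing n b" "superLS n b" "set b \<subseteq> {x. inX n x}" by blast
    have "wp.span {bracketing n w | w. superLS n w \<and> set w = set a \<union> set b} \<subseteq> wp.span ?V"
      by (rule wp.span_mono) (use * in auto)
    then show "br n x y \<in> wp.span ?V" using br_bracketing_span[OF *(2,5)] * by blast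
  qed
qed (auto intro: wp.span_zero wp.span_add wp.span_scale)

text \<open>Distinct bracketings have distinct leading words, so the largest one that occurs cannot
  cancel and must itself be below \<open>W\<close>.\<close>

lemma span_bracketing_wbelow:
  assumes two: "(2::'k::field) \<noteq> 0" and P: "\<And>w. P w \<Longrightarrow> superLS n w"
    and p: "p \<in> wp.span {bracketing n w | w. P w}" and below: "wbelow W (p :: 'k wpoly)"
  shows "p \<in> wp.span {bracketing n w | w. P w \<and> dlless w W}"
proof -
  obtain t r where t: "finite t" "t \<subseteq> {bracketing n w | w. P w}" and pt: "p = (\<Sum>a\<in>t. smul (r a) a)"
    using p unfolding wp.span_explicit by blast
  define t' where "t' = {a\<in>t. r a \<noteq> 0}"
  have pt': "p = (\<Sum>a\<in>t'. smul (r a) a)"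
    unfolding pt t'_def using t(1) by (intro sum.mono_neutral_right) auto
  have fin: "finite t'" using t by (simp add: t'_def)
  have lead: "\<exists>c. lead a (lw a) c \<and> P (lw a) \<and> a = bracketing n (lw a)" if "a \<in> t'" for a
  proof -
    obtain w where w: "a = bracketing n w" "P w" using \<open>a \<in> t'\<close> t(2) unfolding t'_def by blast
    then obtain c where "lead a w c" using lead_bracketing[OF two P[OF w(2)]] by auto
    then show ?thesis using w lead_lw by metis
  qed
  have "dlless (lw a) W" if "a \<in> t'" for a
  proof -
    obtain u where u: "u \<in> lw ` t'" "\<forall>x\<in>lw ` t'. x = u \<or> dlless x u"
      using ex_dlless_max[of "lw ` t'"] fin \<open>a \<in> t'\<close> by blast
    then obtain m where m: "m \<in> t'" "u = lw m" by blast
    have zero: "Poly_Mapping.lookup b (lw m) = 0" if b: "b \<in> t' - {m}" for b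
    proof -
      have "lw b \<noteq> lw m" using lead[of b] lead[OF m(1)] b by auto
      then have "dlless (lw b) (lw m)" using u m b by auto
      then show ?thesis using lead[of b] b unfolding lead_def by (metis DiffD1 dlless_irrefl dlless_trans)
    qed
    have "Poly_Mapping.lookup p (lw m) = (\<Sum>b\<in>t'. r b * Poly_Mapping.lookup b (lw m))"
      unfolding pt' by (simp add: lookup_sum)
    also have "\<dots> = r m * Poly_Mapping.lookup m (lw m)"
      using fin m zero by (subst sum.remove[of _ m]) auto
    finally have "Poly_Mapping.lookup p (lw m) \<noteq> 0"
      using m lead[OF m(1)] by (auto simp: t'_def lead_def)
    then have "dlless (lw m) W" using below by (simp add: wbelow_def)
    then show ?thesis using u m \<open>a \<in> t'\<close> by (metis dlless_trans imageI)
  qed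
  then have "smul (r a) a \<in> wp.span {bracketing n w | w. P w \<and> dlless w W}" if "a \<in> t'" for a
    using that lead[OF that] by (intro wp.span_scale wp.span_base) blast
  then show ?thesis unfolding pt' by (rule wp.span_sum)
qed

section \<open>Bracketings with a marked factor\<close>

lemma leaves_map_btree: "leaves (map_btree f t) = map f (leaves t)"
  by (induction t) auto

lemma leaves_foldl:
  "\<forall>c\<in>set cs. LS c \<Longrightarrow> leaves (foldl (\<lambda>acc c. Nd acc (map_btree Some (sbt c))) t cs)
    = leaves t @ map Some (concat cs)"
  by (induction cs arbitrary: t) (auto simp: leaves_map_btree leaves_sbt LS_nonempty)

lemma leaves_repl: "leaves (repl v w) = None # map Some (drop (length v) w)"
  using is_lfact_lfact[of "drop (length v) w"] by (simp add: repl_def leaves_foldl is_lfact_def)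

lemma leaves_mk:
  "length (filter (\<lambda>x. x = None) (leaves (mk v s t))) = 1 \<and>
    (\<forall>y. Some y \<in> set (leaves (mk v s t)) \<longrightarrow> y \<in> set (leaves t))"
proof (induction v s t rule: mk.induct)
  case (1 v s x)
  then show ?case by (auto simp: leaves_repl filter_empty_conv dest: in_set_dropD)
next
  case (2 v s l r)
  then show ?case
    by (auto simp: leaves_repl leaves_map_btree filter_empty_conv simp del: drop_append dest: in_set_dropD)
qed

lemma hole_tree_mk:
  assumes "u \<noteq> []" "set u \<subseteq> {x. inX n x}"
  shows "hole_tree n (mk v s (sbt u))"
  using leaves_mk[of v s "sbt u"] assms by (auto simp: hole_tree_def leaves_sbt)

text \<open>The next factor c satisfies c < v: if v <= c, the last factor would be at least v,
  although it is a proper suffix of an LS word beginning with v and so lies below v. Hence v c is LS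
  and takes the place of v.\<close>

lemma lead_foldl:
  assumes "hom n (oddw n v) (evt n p t)" "lead (evt n p t) v 1" "LS v" "LS (v @ concat cs)" "is_lfact cs"
  shows "hom n (oddw n (v @ concat cs)) (evt n p (foldl (\<lambda>acc c. Nd acc (map_btree Some (sbt c))) t cs))
    \<and> lead (evt n p (foldl (\<lambda>acc c. Nd acc (map_btree Some (sbt c))) t cs)) (v @ concat cs) 1"
  using assms
proof (induction cs arbitrary: t v)
  case (Cons c cs)
  have c: "LS c" "is_lfact cs" "\<forall>d\<in>set cs. wle c d" using Cons.prems(5) by (auto simp: is_lfact_Cons)
  have v0: "v \<noteq> []" and c0: "c \<noteq> []" using LS_nonempty Cons.prems(3) c by auto
  obtain d ds where d: "c # cs = ds @ [d]" by (metis list.simps(3) rev_exhaust)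
  then have cd: "wle c d" "LS d"
    using c Cons.prems(5) by (auto simp: is_lfact_def) (metis append_eq_Cons_conv in_set_conv_decomp list.inject)+
  have "wless c v"
  proof (rule ccontr)
    assume "\<not> wless c v"
    then have "wle v d" using wless_linear[of c v] cd wle_trans by metis
    moreover have eq: "v @ concat (c # cs) = (v @ concat ds) @ d" using d by simp
    then have "sless d (v @ concat (c # cs))"
      using LS_suffix[of "v @ concat ds" d] Cons.prems(4) v0 LS_nonempty[OF cd(2)] by simp
    moreover have "wless (v @ concat (c # cs)) v" using c0 by simp
    ultimately show False by (metis sless_imp_wless wless_trans wless_irrefl)
  qed
  then have vc: "LS (v @ c)" using LS_concat[OF Cons.prems(3) c(1)] by simp
  let ?t = "Nd t (map_btree Some (sbt c))"
  have "hom n (oddw n (v @ c)) (evt n p ?t)" "lead (evt n p ?t) (v @ c) 1"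
    using hom_br[OF Cons.prems(1) hom_bracketing_LS[OF c(1), of n]]
      lead_br[OF Cons.prems(1) hom_bracketing_LS[OF c(1), of n] Cons.prems(2) lead_bracketing_LS[OF c(1), of n]]
      LS_rotate[OF vc v0 c0] by (simp_all add: evt_sbt[OF c(1)])
  then show ?case using Cons.IH[of "v @ c" ?t] vc c Cons.prems(4) by simp
qed simp

text \<open>Descend in the standard bracketing until v fills a leaf or is cut by a node. In the
  latter case v is a prefix by \<open>LS_straddling_factor\<close>, and \<open>lead_foldl\<close>
  takes over.\<close>

lemma lead_mk:
  assumes "hom n (oddw n v) p" "lead p v 1" "LS v" "LS u" "u = a @ v @ b"
  shows "hom n (oddw n u) (evt n p (mk v (length a) (sbt u))) \<and> lead (evt n p (mk v (length a) (sbt u))) u 1"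
  using assms(4,5)
proof (induction "length u" arbitrary: u a b rule: less_induct)
  case less
  note v0 = LS_nonempty[OF assms(3)]
  have repl: "hom n (oddw n (v @ b')) (evt n p (repl v (v @ b'))) \<and> lead (evt n p (repl v (v @ b'))) (v @ b') 1"
    if "LS (v @ b')" for b'
    using lead_foldl[of n v p "Lf None" "lfact b'"] is_lfact_lfact[of b'] assms that by (simp add: repl_def)
  show ?case
  proof (cases "1 < length u")
    case False
    then obtain x where "u = [x]" using LS_nonempty[OF less.prems(1)] by (cases u) auto
    then have "v = [x]" "a = []" "b = []" using less.prems(2) v0
      by (cases a; cases v; simp)+
    then show ?thesis using repl[of "[]"] \<open>u = [x]\<close> by (simp add: sbt_single)
  next
    case True
    obtain l r where lr: "u = l @ r" "LS l" "LS r" "wless r l" "length l = lsk u"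
      and take: "l = take (lsk u) u" and drop: "r = drop (lsk u) u"
      using LS_standard_factorization[OF less.prems(1) True] by metis
    have l0: "l \<noteq> []" and r0: "r \<noteq> []" using lr(2,3) LS_nonempty by auto
    then have len: "length l < length u" "length r < length u" using lr(1) by auto
    have sbt: "sbt u = Nd (sbt l) (sbt r)" using sbt_Nd[OF True] take drop by simp
    have rot: "wless (r @ l) (l @ r)" using LS_rotate less.prems(1) lr(1) l0 r0 by blast
    consider "length a + length v \<le> length l" | "\<not> length a + length v \<le> length l" "length l \<le> length a"
      | "length l < length a + length v" "length a < length l" by linarith
    then show ?thesis
    proof cases
      case 1
      have "l = take (length l) (a @ v @ b)" using less.prems(2) lr(1) by (metis append_eq_conv_conj)
      then have "l = a @ v @ take (length l - length a - length v) b" using 1 by simp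
      note IH = less.hyps[OF len(1) lr(2) this]
      show ?thesis
        using 1 IH hom_br[OF conjunct1[OF IH] hom_bracketing_LS[OF lr(3), of n]]
          lead_br[OF conjunct1[OF IH] hom_bracketing_LS[OF lr(3), of n] conjunct2[OF IH] lead_bracketing_LS[OF lr(3), of n] rot]
        unfolding sbt by (simp add: leaves_sbt[OF l0] evt_sbt[OF lr(3)] lr(1))
    next
      case 2
      have "r = drop (length l) (a @ v @ b)" using less.prems(2) lr(1) by (metis append_eq_conv_conj)
      then have "r = drop (length l) a @ v @ b" using 2 by simp
      note IH = less.hyps[OF len(2) lr(3) this]
      show ?thesis
        using 2 hom_br[OF hom_bracketing_LS[OF lr(2), of n] conjunct1[OF IH]]
          lead_br[OF hom_bracketing_LS[OF lr(2), of n] conjunct1[OF IH] lead_bracketing_LS[OF lr(2), of n] conjunct2[OF IH] rot]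
        unfolding sbt by (simp add: leaves_sbt[OF l0] evt_sbt[OF lr(2)] lr(1))
    next
      case 3
      then have "a = []"
        using LS_straddling_factor[OF True less.prems(1) assms(3) less.prems(2)] lr(5) by simp
      then show ?thesis using 3 repl[of b] less.prems lr
        unfolding sbt by (simp add: leaves_sbt[OF l0] leaves_sbt[OF r0])
    qed
  qed
qed

section \<open>A criterion for Groebner--Shirshov bases\<close>

lemma evt_free_lie:
  "s \<in> free_lie n \<Longrightarrow> \<forall>y. Some y \<in> set (leaves t) \<longrightarrow> inX n y \<Longrightarrow> evt n s t \<in> free_lie n"
  by (induction n s t rule: evt.induct) (auto intro: free_lie.intros)

lemma ex_hom_evt: "hom n b s \<Longrightarrow> \<exists>c. hom n c (evt n s t)"
  by (induction n s t rule: evt.induct) (auto intro: hom_lt dest: hom_br)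

text \<open>\<open>K\<close> stands for an ideal containing the relations \<open>S\<close> and
  meeting the span of \<open>B\<close> only in 0; the elements of \<open>B\<close> lead with the
  irreducible words. Irreducibility is tested on the root, because a relation inside v already
  reduces the square v v.\<close>

locale lie_reduction =
  fixes n :: nat and S B K :: "'k::field wpoly set"
  assumes two: "(2 :: 'k) \<noteq> 0"
    and S_free: "s \<in> S \<Longrightarrow> s \<in> free_lie n"
    and S_hom: "s \<in> S \<Longrightarrow> hom n (oddw n (lw s)) s"
    and S_lead: "s \<in> S \<Longrightarrow> LS (lw s) \<and> lead s (lw s) 1"
    and B_free: "b \<in> B \<Longrightarrow> b \<in> free_lie n"
    and B_lead: "superLS n u \<Longrightarrow> set u \<subseteq> {x. inX n x} \<Longrightarrow>
      (\<And>s a b. s \<in> S \<Longrightarrow> root u \<noteq> a @ lw s @ b) \<Longrightarrow> \<exists>b\<in>B. \<exists>c. lead b u c"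
    and K_add: "p \<in> K \<Longrightarrow> q \<in> K \<Longrightarrow> p + q \<in> K"
    and K_mult: "p \<in> K \<Longrightarrow> r * p \<in> K" "p \<in> K \<Longrightarrow> p * r \<in> K"
    and S_K: "s \<in> S \<Longrightarrow> s \<in> K"
    and B_K: "r \<in> wp.span B \<Longrightarrow> r \<in> K \<Longrightarrow> r = 0"
begin

lemma K_diff: "p \<in> K \<Longrightarrow> q \<in> K \<Longrightarrow> p - q \<in> K"
  using K_add[of p "- 1 * q"] K_mult(1)[of q "- 1"] by simp

lemma K_smul: "p \<in> K \<Longrightarrow> smul c p \<in> K"
  by (simp add: smul_eq K_mult)

lemma K_evt:
  assumes "s \<in> K" "hom n b s" "None \<in> set (leaves t)"
  shows "evt n s t \<in> K"
  using assms
proof (induction n s t rule: evt.induct)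
  case (3 n s l r)
  obtain c d where hom: "hom n c (evt n s l)" "hom n d (evt n s r)"
    using ex_hom_evt[OF 3(4)] by blast
  have "evt n s l \<in> K \<or> evt n s r \<in> K" using 3 by auto
  then have "evt n s l * evt n s r \<in> K" "evt n s r * evt n s l \<in> K" using K_mult by blast+
  then show ?case by (simp add: br_hom[OF hom] K_add K_diff)
qed auto

definition monomials :: "letter list \<Rightarrow> 'k wpoly set" where
  "monomials w = {evt n s t | s t. s \<in> S \<and> hole_tree n t \<and> wbelow w (evt n s t)}"

lemma monomials_K: "x \<in> monomials w \<Longrightarrow> x \<in> K"
proof -
  assume "x \<in> monomials w"
  then obtain s t where x: "x = evt n s t" "s \<in> S" "hole_tree n t" by (auto simp: monomials_def)
  then have "filter (\<lambda>x. x = None) (leaves t) \<noteq> []" by (auto simp: hole_tree_def)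
  then have "None \<in> set (leaves t)" by (auto simp: filter_empty_conv)
  then show ?thesis using K_evt[OF S_K S_hom] x by blast
qed

lemma congS_span:
  assumes "x \<in> wp.span (monomials w)"
  shows "congS n S w x 0"
  using assms
proof (induction rule: wp.span_induct_alt)
  case base
  then show ?case unfolding congS_def by (intro exI[of _ "[]"]) simp
next
  case (step c x y)
  obtain s t where x: "x = evt n s t" "s \<in> S" "hole_tree n t" "wbelow w (evt n s t)"
    using step by (auto simp: monomials_def)
  obtain xs where "y - 0 = (\<Sum>(c, s, t)\<leftarrow>xs. smul c (evt n s t))"
    "\<forall>(c, s, t)\<in>set xs. s \<in> S \<and> hole_tree n t \<and> (evt n s t = 0 \<or> dlless (lw (evt n s t)) w)"
    using step unfolding congS_def by blast
  then show ?case unfolding congS_def using x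
    by (intro exI[of _ "(c, s, t) # xs"]) (simp add: wbelow_lw)
qed

text \<open>For a square v v, the bracketed relation with leading word v is bracketed once more with
  [v]. Both are odd, so \<open>lead_br_square\<close> applies.\<close>

lemma ex_reducing_monomial:
  assumes u: "superLS n u" "set u \<subseteq> {x. inX n x}" and s: "s \<in> S" "root u = a @ lw s @ b"
  shows "\<exists>t c. hole_tree n t \<and> lead (evt n s t) u c"
  using u(1)
proof (cases rule: superLS_cases)
  case LS
  then have "lead (evt n s (mk (lw s) (length a) (sbt u))) u 1"
    using lead_mk[OF S_hom[OF s(1)] _ _ LS] S_lead[OF s(1)] s(2) by auto
  then show ?thesis using hole_tree_mk[OF LS_nonempty[OF LS] u(2)] by blast
next
  case (square v)
  let ?t = "mk (lw s) (length a) (sbt v)"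
  have "v = a @ lw s @ b" using s(2) square by simp
  from lead_mk[OF S_hom[OF s(1)] conjunct2[OF S_lead[OF s(1)]] conjunct1[OF S_lead[OF s(1)]] square(2) this]
  have mk: "hom n True (evt n s ?t) \<and> lead (evt n s ?t) v 1" using square(3) by simp
  have "hole_tree n ?t" using hole_tree_mk[OF LS_nonempty[OF square(2)]] u(2) square(1) by simp
  then have "hole_tree n (Nd ?t (map_btree Some (sbt v)))"
    using u(2) square by (auto simp: hole_tree_def leaves_map_btree leaves_sbt LS_nonempty filter_empty_conv)
  moreover have "hom n True (bracketing n v :: 'k wpoly)" using hom_bracketing_LS[OF square(2), of n] square by simp
  ultimately show ?thesis
    using lead_br_square[OF conjunct1[OF mk] _ conjunct2[OF mk] lead_bracketing_LS[OF square(2)] two]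
      evt_sbt[OF square(2), of n s] square(1) by fastforce
qed

text \<open>A bracketed relation or an element of \<open>B\<close> with leading word
  \<open>u\<close> is subtracted. The remainder is again a Lie element, so by the spanning theorem
  it consists of bracketings of words below \<open>u\<close>, to which the induction
  applies.\<close>

lemma reduce_bracketing:
  assumes "superLS n u" "set u \<subseteq> {x. inX n x}" "dlless u w"
  shows "bracketing n u \<in> wp.span (monomials w \<union> B)"
  using assms
proof (induction "card {v. set v \<subseteq> {x. inX n x} \<and> dlless v u}" arbitrary: u rule: less_induct)
  case less
  let ?X = "{x. inX n x}"
  have "\<exists>g c. lead g u c \<and> g \<in> free_lie n \<and> g \<in> wp.span (monomials w \<union> B)"
  proof (cases "\<exists>s a b. s \<in> S \<and> root u = a @ lw s @ b")
    case True
    then obtain s a b t c where *: "s \<in> S" "hole_tree n t" "lead (evt n s t) u c"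
      using ex_reducing_monomial[OF less.prems(1,2)] by blast
    then have "evt n s t \<in> monomials w"
      using lead_wbelow[OF *(3) less.prems(3)] by (auto simp: monomials_def)
    moreover have "evt n s t \<in> free_lie n"
      using evt_free_lie[OF S_free] * by (auto simp: hole_tree_def)
    ultimately show ?thesis using * by (blast intro: wp.span_base)
  next
    case False
    then show ?thesis using B_lead[OF less.prems(1,2)] B_free by (blast intro: wp.span_base)
  qed
  then obtain g c where g: "lead g u c" "g \<in> free_lie n" "g \<in> wp.span (monomials w \<union> B)" by blast
  obtain d where d: "lead (bracketing n u :: 'k wpoly) u d"
    using lead_bracketing[OF two less.prems(1)] by blast
  let ?r = "bracketing n u - smul (d / c) g"
  have "lead (smul (d / c) g) u d"
    using lead_smul[OF g(1), of "d / c"] lead_coeff[OF d] lead_coeff[OF g(1)] by simp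
  then have "wbelow u ?r" by (rule lead_diff_wbelow[OF d])
  moreover have "?r \<in> free_lie n"
    using free_lie_bracketing[OF less.prems(1,2)] g(2) by (intro free_lie_diff free_lie.scal)
  ultimately have "?r \<in> wp.span {bracketing n v | v. (superLS n v \<and> set v \<subseteq> ?X) \<and> dlless v u}"
    by (intro span_bracketing_wbelow[OF two] free_lie_span) auto
  moreover have "{bracketing n v | v. (superLS n v \<and> set v \<subseteq> ?X) \<and> dlless v u} \<subseteq> wp.span (monomials w \<union> B)"
  proof clarify
    fix v assume v: "superLS n v" "set v \<subseteq> ?X" "dlless v u"
    have "{x. set x \<subseteq> ?X \<and> dlless x v} \<subset> {x. set x \<subseteq> ?X \<and> dlless x u}"
    proof (rule psubsetI)
      show "{x. set x \<subseteq> ?X \<and> dlless x v} \<subseteq> {x. set x \<subseteq> ?X \<and> dlless x u}"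
        using v(3) by (auto dest: dlless_trans)
      show "{x. set x \<subseteq> ?X \<and> dlless x v} \<noteq> {x. set x \<subseteq> ?X \<and> dlless x u}"
        using v(2,3) dlless_irrefl by blast
    qed
    then have "card {x. set x \<subseteq> ?X \<and> dlless x v} < card {x. set x \<subseteq> ?X \<and> dlless x u}"
      by (rule psubset_card_mono[OF finite_dlless])
    then show "bracketing n v \<in> wp.span (monomials w \<union> B)"
      using less.hyps v less.prems(3) dlless_trans by blast
  qed
  ultimately have "?r \<in> wp.span (monomials w \<union> B)"
    using wp.span_minimal[OF _ wp.subspace_span] by blast
  then show ?case
    using wp.span_add[OF _ wp.span_scale[OF g(3), of "d / c"], of ?r] by simp
qed

text \<open>Reduction gives f = x + y with x a combination of bracketed relations and y in the span
  of \<open>B\<close>. As f and x lie in \<open>K\<close>, so does y, and therefore y = 0.\<close>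

lemma ideal_span_monomials:
  assumes "f \<in> free_lie n" "f \<in> K" "wbelow w f"
  shows "f \<in> wp.span (monomials w)"
proof -
  let ?X = "{x. inX n x}"
  have "f \<in> wp.span {bracketing n v | v. (superLS n v \<and> set v \<subseteq> ?X) \<and> dlless v w}"
    using assms(1,3) by (intro span_bracketing_wbelow[OF two] free_lie_span) auto
  moreover have "{bracketing n v | v. (superLS n v \<and> set v \<subseteq> ?X) \<and> dlless v w} \<subseteq> wp.span (monomials w \<union> B)"
    using reduce_bracketing by blast
  ultimately have "f \<in> wp.span (monomials w \<union> B)"
    using wp.span_minimal[OF _ wp.subspace_span] by blast
  then obtain x y where xy: "f = x + y" "x \<in> wp.span (monomials w)" "y \<in> wp.span B"
    unfolding wp.span_Un by blast
  have "0 \<in> K" using K_diff[OF assms(2) assms(2)] by simp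
  have "x \<in> K" using xy(2)
    by (induction rule: wp.span_induct_alt) (auto intro: K_add K_smul monomials_K \<open>0 \<in> K\<close>)
  then have "y \<in> K" using K_diff[OF assms(2), of x] xy(1) by simp
  then show ?thesis using B_K[OF xy(3)] xy by simp
qed

lemma composition:
  assumes "f \<in> free_lie n" "g \<in> free_lie n" "f \<in> K" "g \<in> K" "lead f w 1" "lead g w 1"
  shows "congS n S w (f - g) 0"
  using assms by (intro congS_span ideal_span_monomials free_lie_diff K_diff lead_diff_wbelow)

lemma brk:
  assumes s: "s \<in> S" and w: "LS w" "w = a @ lw s @ b" "set w \<subseteq> {x. inX n x}"
  shows "brk n w (length a) s \<in> free_lie n" "brk n w (length a) s \<in> K" "lead (brk n w (length a) s) w 1"
proof -
  let ?t = "mk (lw s) (length a) (sbt w)"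
  have lead: "lead (evt n s ?t) w 1"
    using lead_mk[OF S_hom[OF s] _ _ w(1,2)] S_lead[OF s] by auto
  have hole: "hole_tree n ?t" by (rule hole_tree_mk[OF LS_nonempty[OF w(1)] w(3)])
  \<comment> \<open>The leading coefficient is 1, so the normalization built into \<open>brk\<close>
    has no effect.\<close>
  have eq: "brk n w (length a) s = evt n s ?t"
    using lead w(1) by (simp add: brk_def sbw_def lead_def)
  have "filter (\<lambda>x. x = None) (leaves ?t) \<noteq> []" using hole by (auto simp: hole_tree_def)
  then have "None \<in> set (leaves ?t)" by (auto simp: filter_empty_conv)
  then show "brk n w (length a) s \<in> K" unfolding eq by (rule K_evt[OF S_K[OF s] S_hom[OF s]])
  show "brk n w (length a) s \<in> free_lie n" unfolding eq
    using evt_free_lie[OF S_free[OF s]] hole by (auto simp: hole_tree_def)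
  show "lead (brk n w (length a) s) w 1" unfolding eq by (rule lead)
qed

lemma S_letters: "s \<in> S \<Longrightarrow> set (lw s) \<subseteq> {x. inX n x}"
  using S_lead[of s] by (intro free_lie_letters[OF S_free]) (auto simp: lead_def)

theorem GSB: "GSB n S"
  unfolding GSB_def
proof (intro conjI ballI allI impI; (elim conjE)?)
  show "S \<subseteq> {p \<in> free_lie n. monic p}" using S_free S_lead lead_monic by blast
next
  fix p q w a b
  assume p: "p \<in> S" and q: "q \<in> S" and ab: "\<forall>x\<in>set a. inX n x" "\<forall>x\<in>set b. inX n x"
    and pw: "lw p @ a = w" and qw: "b @ lw q = w" and len: "length b < length (lw p)"
  have "lw p @ a = b @ lw q" using pw qw by simp
  then obtain y where "lw p @ y = b \<and> a = y @ lw q \<or> lw p = b @ y \<and> y @ a = lw q"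
    by (metis append_eq_append_conv2)
  then have y: "lw p = b @ y" "lw q = y @ a" using len by auto
  have "y \<noteq> []" using y len by auto
  then have LSw: "LS w" using LS_overlap[of b y a] S_lead[OF p] S_lead[OF q] y qw by simp
  have X: "set w \<subseteq> {x. inX n x}" using pw S_letters[OF p] ab by auto
  show "congS n S w (brk n w 0 p - brk n w (length b) q) 0"
    using brk[OF p LSw, of "[]" a] brk[OF q LSw, of b "[]"] X pw qw by (intro composition) auto
next
  fix p q a b
  assume p: "p \<in> S" and q: "q \<in> S" and w: "lw p = a @ lw q @ b"
  show "congS n S (lw p) (p - brk n (lw p) (length a) q) 0"
    using brk[OF q _ w] S_letters[OF p] S_lead[OF p] S_free[OF p] S_K[OF p] by (intro composition) auto
qed

end

section \<open>Irreducible words\<close>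

lemma LS_letter_le_hd:
  assumes "LS u" "x \<in> set u"
  shows "x = hd u \<or> lless x (hd u)"
proof -
  obtain a b where u: "u = a @ x # b" using assms(2) by (meson split_list)
  show ?thesis
  proof (cases a)
    case (Cons y a')
    then have "sless (x # b) (y # a' @ x # b)" using LS_suffix[of a "x # b"] assms(1) u by simp
    then show ?thesis using u Cons by auto
  qed (use u in simp)
qed

text \<open>Bundles what the criterion asks of the shape of a relation, in a form that brackets of
  elements with decreasing leading words preserve.\<close>

definition LS_poly :: "nat \<Rightarrow> 'k::field wpoly \<Rightarrow> letter list \<Rightarrow> bool" where
  "LS_poly n p u \<longleftrightarrow> LS u \<and> p \<in> free_lie n \<and> hom n (oddw n u) p \<and> lead p u 1"

lemma LS_poly_br:
  assumes "LS_poly n p u" "LS_poly n q v" "wless v u"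
  shows "LS_poly n (br n p q) (u @ v)"
proof -
  have LS: "LS (u @ v)" using assms by (auto simp: LS_poly_def intro: LS_concat)
  moreover have "wless (v @ u) (u @ v)"
    using LS_rotate[OF LS] assms LS_nonempty by (auto simp: LS_poly_def)
  ultimately show ?thesis
    using assms lead_br[of n "oddw n u" p "oddw n v" q u 1 v 1] hom_br[of n "oddw n u" p "oddw n v" q]
    by (auto simp: LS_poly_def intro: free_lie.brk)
qed

lemma LS_poly_lt: "inX n x \<Longrightarrow> LS_poly n (lt x) [x]"
  using hom_lt[of n x] by (cases "oddl n x") (simp_all add: LS_poly_def lead_lt free_lie.gen oddw_def)

text \<open>The entries will be end indices of blocks, and the last three assumptions come from the
  families (IV), (V), (VI). As x is maximal, the list begins with x x x or with x y x, y < x.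
  Dropping one or two entries leaves a list of the same kind whose second entry is at least y. Read
  as blocks, the final [x] or [x, y'] is also a prefix of the word, that is, a border.\<close>

lemma tail_shape:
  fixes js :: "nat list"
  assumes "js = x # y # z # zs" "\<forall>j\<in>set js. j \<le> x"
    and "\<And>A a b c B. js = A @ a # b # c # B \<Longrightarrow> b \<le> a \<Longrightarrow> b \<le> c"
    and "\<And>A a b c B. js = A @ a # b # c # B \<Longrightarrow> b < a \<Longrightarrow> a \<le> c"
    and "\<And>A a b c B. js = A @ a # b # a # c # B \<Longrightarrow> b < a \<Longrightarrow> b \<le> c"
  shows "\<exists>A. A \<noteq> [] \<and> (js = A @ [x] \<or> (\<exists>y'\<ge>y. js = A @ [x, y']))"
  using assms
proof (induction "length js" arbitrary: js y z zs rule: less_induct)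
  case less
  note IV = less.prems(3) and V = less.prems(4) and VI = less.prems(5)
  have yx: "y \<le> x" and zx: "z \<le> x" using less.prems(1,2) by auto
  show ?case
  proof (cases "y = x")
    case True
    have "z = x" using IV[of "[]" x y z zs] less.prems(1) yx zx True by simp
    show ?thesis
    proof (cases zs)
      case Nil
      then show ?thesis using less.prems(1) \<open>z = x\<close> by (intro exI[of _ "[x, y]"]) simp
    next
      case (Cons w ws)
      have js: "js = [x] @ (x # x # w # ws)" using less.prems(1) Cons True \<open>z = x\<close> by simp
      have "\<exists>A. A \<noteq> [] \<and> (x # x # w # ws = A @ [x] \<or> (\<exists>y'\<ge>x. x # x # w # ws = A @ [x, y']))"
      proof (rule less.hyps)
        show "length (x # x # w # ws) < length js" using js by simp
        show "\<forall>j\<in>set (x # x # w # ws). j \<le> x" using less.prems(2) js by auto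
        show "b \<le> c" if "x # x # w # ws = A @ a # b # c # B" "b \<le> a" for A a b c B
          using IV[of "[x] @ A" a b c B] js that by simp
        show "a \<le> c" if "x # x # w # ws = A @ a # b # c # B" "b < a" for A a b c B
          using V[of "[x] @ A" a b c B] js that by simp
        show "b \<le> c" if "x # x # w # ws = A @ a # b # a # c # B" "b < a" for A a b c B
          using VI[of "[x] @ A" a b c B] js that by simp
      qed simp
      then obtain A where "A \<noteq> []" "x # x # w # ws = A @ [x] \<or> (\<exists>y'\<ge>x. x # x # w # ws = A @ [x, y'])"
        by blast
      then show ?thesis using js True by (intro exI[of _ "[x] @ A"]) auto
    qed
  next
    case False
    then have yx: "y < x" using yx by simp
    have "z = x" using V[of "[]" x y z zs] less.prems(1) yx zx by simp
    show ?thesis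
    proof (cases zs)
      case Nil
      then show ?thesis using less.prems(1) \<open>z = x\<close> by (intro exI[of _ "[x, y]"]) simp
    next
      case (Cons w ws)
      have yw: "y \<le> w" using VI[of "[]" x y w ws] less.prems(1) \<open>z = x\<close> Cons yx by simp
      show ?thesis
      proof (cases ws)
        case Nil
        then show ?thesis using less.prems(1) \<open>z = x\<close> Cons yw by (intro exI[of _ "[x, y]"]) auto
      next
        case (Cons v vs)
        have js: "js = [x, y] @ (x # w # v # vs)" using less.prems(1) \<open>zs = w # ws\<close> Cons \<open>z = x\<close> by simp
        have "\<exists>A. A \<noteq> [] \<and> (x # w # v # vs = A @ [x] \<or> (\<exists>y'\<ge>w. x # w # v # vs = A @ [x, y']))"
        proof (rule less.hyps)
          show "length (x # w # v # vs) < length js" using js by simp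
          show "\<forall>j\<in>set (x # w # v # vs). j \<le> x" using less.prems(2) js by auto
          show "b \<le> c" if "x # w # v # vs = A @ a # b # c # B" "b \<le> a" for A a b c B
            using IV[of "[x, y] @ A" a b c B] js that by simp
          show "a \<le> c" if "x # w # v # vs = A @ a # b # c # B" "b < a" for A a b c B
            using V[of "[x, y] @ A" a b c B] js that by simp
          show "b \<le> c" if "x # w # v # vs = A @ a # b # a # c # B" "b < a" for A a b c B
            using VI[of "[x, y] @ A" a b c B] js that by simp
        qed simp
        then obtain A where "A \<noteq> []" "x # w # v # vs = A @ [x] \<or> (\<exists>y'\<ge>w. x # w # v # vs = A @ [x, y'])"
          by blast
        then show ?thesis using js yw by (intro exI[of _ "[x, y] @ A"]) (auto intro: order_trans)
      qed
    qed
  qed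
qed

lemma hd_le_last:
  fixes js :: "nat list"
  assumes "\<And>A x y B. js = A @ x # y # B \<Longrightarrow> x \<le> y" "js \<noteq> []"
  shows "hd js \<le> last js"
  using assms
proof (induction js)
  case (Cons x js)
  show ?case
  proof (cases js)
    case (Cons y zs)
    have "hd js \<le> last js"
    proof (rule Cons.IH)
      show "a \<le> b" if "js = A @ a # b # B" for A a b B using Cons.prems(1)[of "x # A" a b B] that by simp
    qed (use Cons in simp)
    then show ?thesis using Cons.prems(1)[of "[]" x y zs] Cons by simp
  qed simp
qed simp

text \<open>Treats both sides at once: the relations in the e and in the f have the same shape, and
  both kinds of letters are ordered by index.\<close>

locale chain =
  fixes n :: nat and C :: "nat \<Rightarrow> letter"
  assumes lless_C [simp]: "lless (C i) (C j) \<longleftrightarrow> i < j"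
    and lidx_C [simp]: "lidx (C i) = i"
begin

lemma inX_C: "inX n (C i) \<longleftrightarrow> 1 \<le> i \<and> i \<le> n"
  by (simp add: inX_def)

lemma C_inj [simp]: "C i = C j \<longleftrightarrow> i = j"
  by (metis lidx_C)

text \<open>The leading word of \<open>gij n C i j\<close>.\<close>

definition cw :: "nat \<Rightarrow> nat \<Rightarrow> letter list" where
  "cw i j = map C (rev [j..<Suc i])"

lemma cw_same [simp]: "cw i i = [C i]"
  by (simp add: cw_def)

lemma cw_Suc: "j \<le> Suc i \<Longrightarrow> cw (Suc i) j = C (Suc i) # cw i j"
  by (simp add: cw_def)

lemma cw_split: "j \<le> k \<Longrightarrow> k \<le> Suc i \<Longrightarrow> cw i j = cw i k @ (if k = 0 then [] else cw (k - 1) j)"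
proof -
  assume "j \<le> k" "k \<le> Suc i"
  then have "[j..<Suc i] = [j..<k] @ [k..<Suc i]"
    by (metis le_add_diff_inverse upt_add_eq_append)
  then show ?thesis by (cases k) (auto simp: cw_def)
qed

lemma cw_prefix: "j \<le> k \<Longrightarrow> k \<le> i \<Longrightarrow> \<exists>r. cw i j = cw i k @ r \<and> (j < k \<longrightarrow> (\<exists>r'. r = C (k - 1) # r'))"
proof (cases "j < k")
  case True
  assume "k \<le> i"
  then have "cw i j = cw i k @ cw (k - 1) j" using True cw_split[of j k i] by simp
  moreover have "\<exists>r'. cw (k - 1) j = C (k - 1) # r'"
  proof -
    obtain k' where "k = Suc k'" using True by (cases k) auto
    then show ?thesis using True by (cases k') (auto simp: cw_def)
  qed
  ultimately show ?thesis by blast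
qed auto

lemma cw_hd: "j \<le> i \<Longrightarrow> \<exists>r. cw i j = C i # r"
  using cw_prefix[of j i i] by auto

lemma cw_last: "j \<le> i \<Longrightarrow> \<exists>r. cw i j = r @ [C j]"
  using upt_conv_Cons[of j "Suc i"] by (simp add: cw_def del: upt_Suc)

lemma cw_snoc: "j \<le> i \<Longrightarrow> 1 \<le> j \<Longrightarrow> cw i j @ [C (j - 1)] = cw i (j - 1)"
  using cw_split[of "j - 1" j i] by simp

lemma wless_cw: "k < j \<Longrightarrow> j \<le> i \<Longrightarrow> wless (cw i k) (cw i j)"
  using cw_prefix[of k j i] by auto

lemma wless_cw_hd: "j \<le> i \<Longrightarrow> k < i \<Longrightarrow> wless (C k # u) (cw i j)"
  using cw_hd[of j i] by auto

lemma LS_poly_gij: "1 \<le> j \<Longrightarrow> j \<le> i \<Longrightarrow> i \<le> n \<Longrightarrow> LS_poly n (gij n C i j :: 'k::field wpoly) (cw i j)"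
proof (induction i)
  case (Suc i)
  show ?case
  proof (cases "j = Suc i")
    case True
    then show ?thesis using Suc.prems LS_poly_lt[of n "C (Suc i)"] by (simp add: inX_C)
  next
    case False
    obtain r where "cw i j = C i # r" using cw_hd[of j i] False Suc.prems by auto
    then have "wless (cw i j) [C (Suc i)]" by simp
    then have "LS_poly n (br n (lt (C (Suc i))) (gij n C i j :: 'k wpoly)) ([C (Suc i)] @ cw i j)"
      using Suc False by (intro LS_poly_br LS_poly_lt) (auto simp: inX_C)
    then show ?thesis using False Suc.prems by (simp add: cw_Suc)
  qed
qed simp

text \<open>The leading words of the families (I) to (VI), in this order.\<close>

definition Rwords :: "letter list set" where
  "Rwords = {[C i, C j] | i j. i \<le> n \<and> j + 1 < i \<and> 1 < j + 1}
    \<union> {cw i j @ [C (i - 1)] | i j. i \<le> n \<and> j < i \<and> 1 \<le> j}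
    \<union> {cw i j @ cw i (j - 1) | i j. i < n \<and> j \<le> i \<and> 1 < j}
    \<union> {cw n i @ cw n j @ cw n (j - 1) | i j. i \<le> n \<and> j \<le> i \<and> 1 < j}
    \<union> {(cw n i @ cw n j) @ cw n (i - 1) | i j. i \<le> n \<and> j < i \<and> 1 \<le> j}
    \<union> {(cw n i @ cw n j) @ cw n i @ cw n (j - 1) | i j. i \<le> n \<and> j < i \<and> 1 < j}"

lemma LS_poly_D:
  "j < i \<Longrightarrow> 1 \<le> j \<Longrightarrow> i \<le> n \<Longrightarrow> LS_poly n (br n (gij n C n i) (gij n C n j) :: 'k::field wpoly) (cw n i @ cw n j)"
  by (intro LS_poly_br LS_poly_gij wless_cw) auto

text \<open>In every family the two factors of the outer bracket have decreasing LS leading words,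
  so \<open>LS_poly_br\<close> gives the leading word with coefficient 1.\<close>

lemma LS_poly_relations:
  "i \<le> n \<Longrightarrow> j + 1 < i \<Longrightarrow> 1 < j + 1 \<Longrightarrow> LS_poly n (br n (lt (C i)) (lt (C j)) :: 'k::field wpoly) [C i, C j]"
  "i \<le> n \<Longrightarrow> j < i \<Longrightarrow> 1 \<le> j \<Longrightarrow>
    LS_poly n (br n (gij n C i j) (lt (C (i - 1))) :: 'k wpoly) (cw i j @ [C (i - 1)])"
  "i < n \<Longrightarrow> j \<le> i \<Longrightarrow> 1 < j \<Longrightarrow>
    LS_poly n (br n (gij n C i j) (gij n C i (j - 1)) :: 'k wpoly) (cw i j @ cw i (j - 1))"
  "i \<le> n \<Longrightarrow> j \<le> i \<Longrightarrow> 1 < j \<Longrightarrow>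
    LS_poly n (br n (gij n C n i) (br n (gij n C n j) (gij n C n (j - 1))) :: 'k wpoly)
      (cw n i @ cw n j @ cw n (j - 1))"
  "i \<le> n \<Longrightarrow> j < i \<Longrightarrow> 1 \<le> j \<Longrightarrow>
    LS_poly n (br n (br n (gij n C n i) (gij n C n j)) (gij n C n (i - 1)) :: 'k wpoly)
      ((cw n i @ cw n j) @ cw n (i - 1))"
  "i \<le> n \<Longrightarrow> j < i \<Longrightarrow> 1 < j \<Longrightarrow>
    LS_poly n (br n (br n (gij n C n i) (gij n C n j)) (br n (gij n C n i) (gij n C n (j - 1))) :: 'k wpoly)
      ((cw n i @ cw n j) @ cw n i @ cw n (j - 1))"
proof -
  assume "i \<le> n" "j + 1 < i" "1 < j + 1"
  then have "LS_poly n (br n (lt (C i)) (lt (C j)) :: 'k wpoly) ([C i] @ [C j])"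
    by (intro LS_poly_br LS_poly_lt) (auto simp: inX_C)
  then show "LS_poly n (br n (lt (C i)) (lt (C j)) :: 'k wpoly) [C i, C j]" by simp
next
  assume "i \<le> n" "j < i" "1 \<le> j"
  then show "LS_poly n (br n (gij n C i j) (lt (C (i - 1))) :: 'k wpoly) (cw i j @ [C (i - 1)])"
    by (intro LS_poly_br LS_poly_lt LS_poly_gij wless_cw_hd) (auto simp: inX_C)
next
  assume "i < n" "j \<le> i" "1 < j"
  then show "LS_poly n (br n (gij n C i j) (gij n C i (j - 1)) :: 'k wpoly) (cw i j @ cw i (j - 1))"
    by (intro LS_poly_br LS_poly_gij wless_cw) auto
next
  assume ij: "i \<le> n" "j \<le> i" "1 < j"
  obtain r where r: "cw n j = cw n i @ r" using cw_prefix[of j i n] ij by auto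
  have "cw n (j - 1) \<noteq> []" using cw_hd[of "j - 1" n] ij by fastforce
  then have "wless (cw n j @ cw n (j - 1)) (cw n i)" by (simp add: r)
  then show "LS_poly n (br n (gij n C n i) (br n (gij n C n j) (gij n C n (j - 1))) :: 'k wpoly)
      (cw n i @ cw n j @ cw n (j - 1))"
    using ij by (intro LS_poly_br LS_poly_gij LS_poly_D) auto
next
  assume ij: "i \<le> n" "j < i" "1 \<le> j"
  have "wless (cw n (i - 1)) (cw n i @ cw n j)"
    using cw_snoc[of i n, symmetric] ij wless_cw_hd[of j n "i - 1" "[]"] by simp
  then show "LS_poly n (br n (br n (gij n C n i) (gij n C n j)) (gij n C n (i - 1)) :: 'k wpoly)
      ((cw n i @ cw n j) @ cw n (i - 1))"
    using ij by (intro LS_poly_br[OF LS_poly_D] LS_poly_gij) auto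
next
  assume "i \<le> n" "j < i" "1 < j"
  then show "LS_poly n (br n (br n (gij n C n i) (gij n C n j)) (br n (gij n C n i) (gij n C n (j - 1))) :: 'k wpoly)
      ((cw n i @ cw n j) @ cw n i @ cw n (j - 1))"
    using wless_cw[of "j - 1" j n] by (intro LS_poly_br[OF LS_poly_D LS_poly_D]) auto
qed

lemma Rside_LS_poly: "p \<in> Rside n C \<Longrightarrow> \<exists>u. LS_poly n (p :: 'k::field wpoly) u"
  unfolding Rside_def
  apply (elim UnE CollectE exE conjE)
       apply (hypsubst, rule exI, rule LS_poly_relations(1); assumption)
      apply (hypsubst, rule exI, rule LS_poly_relations(2); assumption)
     apply (hypsubst, rule exI, rule LS_poly_relations(3); assumption)
    apply (hypsubst, rule exI, rule LS_poly_relations(4); assumption)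
   apply (hypsubst, rule exI, rule LS_poly_relations(5); assumption)
  apply (hypsubst, rule exI, rule LS_poly_relations(6); assumption)
  done

lemma Rwords_LS_poly: "w \<in> Rwords \<Longrightarrow> \<exists>p\<in>Rside n C. LS_poly n (p :: 'k::field wpoly) w"
proof -
  assume "w \<in> Rwords"
  then show ?thesis
    unfolding Rwords_def
  proof (elim UnE CollectE exE conjE)
    fix i j assume "w = [C i, C j]" "i \<le> n" "j + 1 < i" "1 < j + 1"
    with LS_poly_relations(1)[of i j, where ?'k = 'k] show ?thesis unfolding Rside_def by blast
  next
    fix i j assume "w = cw i j @ [C (i - 1)]" "i \<le> n" "j < i" "1 \<le> j"
    with LS_poly_relations(2)[of i j, where ?'k = 'k] show ?thesis unfolding Rside_def by blast
  next
    fix i j assume "w = cw i j @ cw i (j - 1)" "i < n" "j \<le> i" "1 < j"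
    with LS_poly_relations(3)[of i j, where ?'k = 'k] show ?thesis unfolding Rside_def by blast
  next
    fix i j assume "w = cw n i @ cw n j @ cw n (j - 1)" "i \<le> n" "j \<le> i" "1 < j"
    with LS_poly_relations(4)[of i j, where ?'k = 'k] show ?thesis unfolding Rside_def by blast
  next
    fix i j assume "w = (cw n i @ cw n j) @ cw n (i - 1)" "i \<le> n" "j < i" "1 \<le> j"
    with LS_poly_relations(5)[of i j, where ?'k = 'k] show ?thesis unfolding Rside_def by blast
  next
    fix i j assume "w = (cw n i @ cw n j) @ cw n i @ cw n (j - 1)" "i \<le> n" "j < i" "1 < j"
    with LS_poly_relations(6)[of i j, where ?'k = 'k] show ?thesis unfolding Rside_def by blast
  qed
qed

section \<open>Words avoiding the leading words of one side\<close>

definition avoids :: "letter list \<Rightarrow> bool" where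
  "avoids u \<longleftrightarrow> (\<forall>w\<in>Rwords. \<forall>a b. u \<noteq> a @ w @ b)"

lemma avoidsD: "avoids u \<Longrightarrow> w \<in> Rwords \<Longrightarrow> u \<noteq> a @ w @ b"
  by (auto simp: avoids_def)

lemma avoids_suffix: "avoids (a @ u) \<Longrightarrow> avoids u"
  unfolding avoids_def by (metis append_assoc)

abbreviation blocks :: "nat \<Rightarrow> nat list \<Rightarrow> letter list" where
  "blocks m js \<equiv> concat (map (cw m) js)"

text \<open>After a block ending with index j comes an index k: k = m opens a new block, k = j - 1
  prolongs the current one, k < j - 1 is excluded by (I), and j <= k < m by (II).\<close>

lemma ex_blocks:
  assumes "avoids (cw m j @ ys)" "1 \<le> j" "j \<le> m" "m \<le> n" "set ys \<subseteq> C ` {1..m}"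
  shows "\<exists>js. js \<noteq> [] \<and> set js \<subseteq> {1..m} \<and> cw m j @ ys = blocks m js"
  using assms
proof (induction ys arbitrary: j)
  case Nil
  then show ?case by (intro exI[of _ "[j]"]) simp
next
  case (Cons y ys)
  then obtain k where k: "y = C k" "1 \<le> k" "k \<le> m" by auto
  consider "k = m" | "k + 1 < j" | "k + 1 = j" | "j \<le> k" "k < m" using k by linarith
  then show ?case
  proof cases
    case 1
    then have "avoids (cw m m @ ys)" using avoids_suffix[of "cw m j"] Cons.prems(1) k by simp
    then obtain js where "js \<noteq> [] \<and> set js \<subseteq> {1..m} \<and> cw m m @ ys = blocks m js"
      using Cons.IH[of m] Cons.prems by auto
    then show ?thesis using 1 k Cons.prems by (intro exI[of _ "j # js"]) auto
  next
    case 2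
    obtain r where "cw m j = r @ [C j]" using cw_last Cons.prems(3) by blast
    moreover have "j \<le> n \<and> k + 1 < j \<and> 1 < k + 1" using 2 k Cons.prems(3,4) by simp
    then have "[C j, C k] \<in> Rwords" unfolding Rwords_def by blast
    ultimately show ?thesis using avoidsD[OF Cons.prems(1), of "[C j, C k]" r ys] k by simp
  next
    case 3
    then have "cw m j @ [y] = cw m k" using cw_snoc[of j m] Cons.prems k by auto
    then have eq: "cw m j @ y # ys = cw m k @ ys" by (metis append_Cons append_Nil append_assoc)
    have "set ys \<subseteq> C ` {1..m}" using Cons.prems(5) by simp
    from Cons.IH[OF Cons.prems(1)[unfolded eq] k(2,3) Cons.prems(4) this]
    show ?thesis unfolding eq .
  next
    case 4
    have "cw m j = cw m (k + 2) @ cw (k + 1) j" using cw_split[of j "k + 2" m] 4 by simp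
    moreover have "k + 1 \<le> n \<and> j < k + 1 \<and> 1 \<le> j" using 4 Cons.prems(2,4) by simp
    then have "cw (k + 1) j @ [C (k + 1 - 1)] \<in> Rwords" unfolding Rwords_def by blast
    ultimately show ?thesis
      using avoidsD[OF Cons.prems(1), of "cw (k + 1) j @ [C k]" "cw m (k + 2)" ys] k by simp
  qed
qed

lemma blocks_prefix_border:
  assumes "LS (blocks m (A @ B))" "A \<noteq> []" "B \<noteq> []" "set (A @ B) \<subseteq> {1..m}"
    "blocks m (A @ B) = blocks m B @ r"
  shows False
proof -
  have ne: "blocks m js \<noteq> []" if js: "js \<noteq> []" "set js \<subseteq> {1..m}" for js
  proof -
    obtain j js' where "js = j # js'" using js(1) by (cases js) auto
    then show ?thesis using cw_hd[of j m] js by auto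
  qed
  show ?thesis
    using LS_unbordered[OF assms(1), of "blocks m A" "blocks m B" r] ne[of A] ne[of B] assms by auto
qed

text \<open>By (III) the block indices do not decrease. With two or more blocks the last would be a
  prefix of the first, hence a border.\<close>

lemma single_block:
  assumes "LS (blocks m js)" "avoids (blocks m js)" "js \<noteq> []" "set js \<subseteq> {1..m}" "m < n"
  shows "\<exists>j. js = [j]"
proof (rule ccontr)
  assume no: "\<not> ?thesis"
  obtain A z where A: "js = A @ [z]" "A \<noteq> []"
    using assms(3) no by (cases js rule: rev_cases) auto
  have "x \<le> y" if js: "js = A @ x # y # B" for A x y B
  proof (rule ccontr)
    assume "\<not> x \<le> y"
    then have xy: "y \<le> x - 1" "1 < x" "x \<le> m" "1 \<le> y" using assms(4) js by auto
    then have "x - 1 \<le> m" by simp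
    then obtain r where r: "cw m y = cw m (x - 1) @ r" using cw_prefix[OF xy(1)] by blast
    have "cw m x @ cw m (x - 1) \<in> Rwords" using xy assms(5) unfolding Rwords_def by blast
    then show False
      using avoidsD[OF assms(2), of "cw m x @ cw m (x - 1)" "blocks m A" "r @ blocks m B"] js r by simp
  qed
  then have "hd js \<le> z" using hd_le_last[of js] assms(3) A by simp
  moreover obtain h A' where h: "A = h # A'" using A by (cases A) auto
  moreover have "z \<le> m" using A assms(4) by auto
  ultimately obtain r where "cw m h = cw m z @ r" using cw_prefix[of h z m] A by auto
  then show False
    using blocks_prefix_border[of m A "[z]"] assms A h by auto
qed

text \<open>If z exceeded the first index, the suffix starting at block z would agree with the word
  along \<open>cw m z\<close> and then either end, giving a border, or continue with
  \<open>C m\<close>, which is above the letter \<open>C (z - 1)\<close> of the word.\<close>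

lemma block_le_hd:
  assumes "LS (blocks m js)" "set js \<subseteq> {1..m}" "z \<in> set js"
  shows "z \<le> hd js"
proof (rule ccontr)
  assume gt: "\<not> z \<le> hd js"
  obtain A B where AB: "js = A @ z # B" using assms(3) by (meson split_list)
  then obtain h A' where h: "A = h # A'" using gt by (cases A) auto
  have z: "1 \<le> z" "z \<le> m" using assms by auto
  obtain r' where r: "cw m h = cw m z @ C (z - 1) # r'"
    using cw_prefix[of h z m] gt z h AB by auto
  show False
  proof (cases B)
    case Nil
    then show ?thesis
      using blocks_prefix_border[of m A "[z]" "C (z - 1) # r' @ blocks m A' @ blocks m [z]"] assms(1,2) AB h r by auto
  next
    case (Cons b B')
    then obtain s where s: "cw m b = C m # s" using cw_hd[of b m] assms(2) AB by auto
    have "cw m h \<noteq> []" using r by simp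
    then have "sless (cw m z @ C m # s @ blocks m B') (cw m z @ C (z - 1) # r' @ blocks m (A' @ z # B))"
      using LS_suffix[of "blocks m A" "blocks m (z # B)"] assms(1) AB h r s Cons by auto
    then show ?thesis using z by auto
  qed
qed

text \<open>A block with the larger end index is a prefix of one with the smaller. So three or more
  blocks have a border by \<open>tail_shape\<close>, and two blocks have one unless their indices
  decrease.\<close>

lemma at_most_two_blocks:
  assumes "LS (blocks n js)" "avoids (blocks n js)" "js \<noteq> []" "set js \<subseteq> {1..n}"
  shows "(\<exists>j. js = [j]) \<or> (\<exists>i j. js = [i, j] \<and> j < i)"
proof -
  have rng: "1 \<le> j \<and> j \<le> n" if "j \<in> set js" for j using that assms(4) by auto
  have ext: "\<exists>r. cw n a = cw n b @ r" if "a \<le> b" "b \<le> n" for a b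
    using cw_prefix[OF that] by blast
  consider j where "js = [j]" | i j where "js = [i, j]" | x y z zs where "js = x # y # z # zs"
    using assms(3) by (cases js; cases "tl js"; cases "tl (tl js)") auto
  then show ?thesis
  proof cases
    case (2 i j)
    have "j < i"
    proof (rule ccontr)
      assume "\<not> j < i"
      then obtain r where "cw n i = cw n j @ r" using ext[of i j] rng[of j] 2 by auto
      then have "blocks n ([i] @ [j]) = blocks n [j] @ (r @ cw n j)" by simp
      then show False using blocks_prefix_border[of n "[i]" "[j]"] assms(1,4) 2 by auto
    qed
    then show ?thesis using 2 by simp
  next
    case (3 x y z zs)
    have IV: "b \<le> c" if js: "js = A @ a # b # c # B" and "b \<le> a" for A a b c B
    proof (rule ccontr)
      assume "\<not> b \<le> c"
      then have *: "c \<le> b - 1" "1 < b" "a \<le> n" using rng[of a] rng[of b] rng[of c] js by auto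
      have "b - 1 \<le> n" using rng[of b] js by auto
      then obtain r where r: "cw n c = cw n (b - 1) @ r" using ext[OF *(1)] by blast
      have "cw n a @ cw n b @ cw n (b - 1) \<in> Rwords" using * \<open>b \<le> a\<close> unfolding Rwords_def by blast
      from avoidsD[OF assms(2) this, of "blocks n A" "r @ blocks n B"] show False using js r by simp
    qed
    have V: "a \<le> c" if js: "js = A @ a # b # c # B" and "b < a" for A a b c B
    proof (rule ccontr)
      assume "\<not> a \<le> c"
      then have *: "c \<le> a - 1" "1 \<le> b" "a \<le> n" using rng[of a] rng[of b] rng[of c] js by auto
      have "a - 1 \<le> n" using rng[of a] js by auto
      then obtain r where r: "cw n c = cw n (a - 1) @ r" using ext[OF *(1)] by blast
      have "(cw n a @ cw n b) @ cw n (a - 1) \<in> Rwords" using * \<open>b < a\<close> unfolding Rwords_def by blast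
      from avoidsD[OF assms(2) this, of "blocks n A" "r @ blocks n B"] show False using js r by simp
    qed
    have VI: "b \<le> c" if js: "js = A @ a # b # a # c # B" and "b < a" for A a b c B
    proof (rule ccontr)
      assume "\<not> b \<le> c"
      then have *: "c \<le> b - 1" "1 < b" "a \<le> n" using rng[of a] rng[of b] rng[of c] js by auto
      have "b - 1 \<le> n" using rng[of b] js by auto
      then obtain r where r: "cw n c = cw n (b - 1) @ r" using ext[OF *(1)] by blast
      have "(cw n a @ cw n b) @ cw n a @ cw n (b - 1) \<in> Rwords" using * \<open>b < a\<close> unfolding Rwords_def by blast
      from avoidsD[OF assms(2) this, of "blocks n A" "r @ blocks n B"] show False using js r by simp
    qed
    have le: "\<forall>j\<in>set js. j \<le> x" using block_le_hd[OF assms(1,4)] 3 by simp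
    have "\<exists>A. A \<noteq> [] \<and> (js = A @ [x] \<or> (\<exists>y'\<ge>y. js = A @ [x, y']))"
    proof (rule tail_shape[OF 3 le])
      show "b \<le> c" if "js = A @ a # b # c # B" "b \<le> a" for A a b c B using that by (rule IV)
      show "a \<le> c" if "js = A @ a # b # c # B" "b < a" for A a b c B using that by (rule V)
      show "b \<le> c" if "js = A @ a # b # a # c # B" "b < a" for A a b c B using that by (rule VI)
    qed
    then obtain A where A: "A \<noteq> []" "js = A @ [x] \<or> (\<exists>y'\<ge>y. js = A @ [x, y'])" by (elim exE conjE) (rule that)
    from A(2) show ?thesis
    proof (elim disjE exE conjE)
      assume js: "js = A @ [x]"
      have eq: "blocks n js = blocks n [x] @ blocks n (y # z # zs)" using 3 by simp
      show ?thesis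
        using blocks_prefix_border[OF assms(1)[unfolded js] A(1) _ assms(4)[unfolded js] eq[unfolded js]] by simp
    next
      fix y' assume y': "y \<le> y'" and js: "js = A @ [x, y']"
      then obtain r where r: "cw n y = cw n y' @ r" using ext[of y y'] rng[of y'] by auto
      have eq: "blocks n js = blocks n [x, y'] @ r @ blocks n (z # zs)" using 3 r by simp
      show ?thesis
        using blocks_prefix_border[OF assms(1)[unfolded js] A(1) _ assms(4)[unfolded js] eq[unfolded js]] by simp
    qed
  qed simp
qed

lemma irreducible_words:
  assumes u: "LS u" "set u \<subseteq> C ` {1..n}" "avoids u"
  shows "(\<exists>i j. 1 \<le> j \<and> j \<le> i \<and> i \<le> n \<and> u = cw i j)
    \<or> (\<exists>i j. 1 \<le> j \<and> j < i \<and> i \<le> n \<and> u = cw n i @ cw n j)"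
proof -
  obtain m ys where m: "u = C m # ys" "1 \<le> m" "m \<le> n"
    using LS_nonempty[OF u(1)] u(2) by (cases u) auto
  have "set ys \<subseteq> C ` {1..m}"
  proof
    fix x assume "x \<in> set ys"
    then obtain k where "x = C k" "1 \<le> k" using u(2) m(1) by auto
    then show "x \<in> C ` {1..m}" using LS_letter_le_hd[OF u(1), of x] \<open>x \<in> set ys\<close> m(1) by auto
  qed
  then obtain js where js: "js \<noteq> []" "set js \<subseteq> {1..m}" "u = blocks m js"
    using ex_blocks[of m m ys] u(3) m by auto
  show ?thesis
  proof (cases "m < n")
    case True
    then obtain j where "js = [j]" using single_block[of m js] js u by auto
    then show ?thesis using js m by auto
  next
    case False
    then have "m = n" using m by simp
    then have "(\<exists>j. js = [j]) \<or> (\<exists>i j. js = [i, j] \<and> j < i)"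
      using at_most_two_blocks[of js] js u by simp
    then show ?thesis
    proof (elim disjE exE conjE)
      fix j assume "js = [j]"
      then have "1 \<le> j \<and> j \<le> n \<and> u = cw n j" using js \<open>m = n\<close> by simp
      then show ?thesis by blast
    next
      fix i j assume "js = [i, j]" "j < i"
      then have "1 \<le> j \<and> j < i \<and> i \<le> n \<and> u = cw n i @ cw n j" using js \<open>m = n\<close> by simp
      then show ?thesis by blast
    qed
  qed
qed

end

section \<open>The natural representation\<close>

type_synonym 'k operator = "(int \<Rightarrow> 'k) \<Rightarrow> int \<Rightarrow> 'k"

text \<open>The entry at \<open>(r, c)\<close> takes precedence over the one at \<open>(r', c')\<close> if \<open>r = r'\<close>.\<close>

definition entries :: "int \<Rightarrow> int \<Rightarrow> 'k::field \<Rightarrow> int \<Rightarrow> int \<Rightarrow> 'k \<Rightarrow> 'k operator" where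
  "entries r c k r' c' k' v = (\<lambda>a. if a = r then k * v c else if a = r' then k' * v c' else 0)"

text \<open>With matrix units E(r,c) and s = 1, these are \<alpha> (E(i,i+1) - E(-i-1,-i)) for i < n
  and \<beta> E(n,0) + \<gamma> E(0,-n) for i = n; s = -1 negates all indices. If the e have all
  constants 1, the condition [e_i,f_i] = h_i forces -1, -2, 2 for the f.\<close>

definition chain_act :: "nat \<Rightarrow> int \<Rightarrow> 'k::field \<Rightarrow> 'k \<Rightarrow> 'k \<Rightarrow> nat \<Rightarrow> 'k operator" where
  "chain_act n s \<alpha> \<beta> \<gamma> i =
    (if i = n then entries (s * int n) 0 \<beta> 0 (- (s * int n)) \<gamma>
     else entries (s * int i) (s * (int i + 1)) \<alpha> (- (s * (int i + 1))) (- (s * int i)) (- \<alpha>))"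

text \<open>The diagonal of h_i. Indices a and -a carry the weights eps_a and -eps_a, and 0 the
  weight 0.\<close>

definition weight :: "nat \<Rightarrow> nat \<Rightarrow> int \<Rightarrow> int" where
  "weight n i a =
    (if i = n then if a = int n then 2 else if a = - int n then - 2 else 0
     else if a = int i \<or> a = - (int i + 1) then 1 else if a = int i + 1 \<or> a = - int i then - 1 else 0)"

text \<open>The natural representation of the orthosymplectic algebra on a space with basis indexed by
  \<open>{-n..n}\<close>, the vector with index \<open>0\<close> being of the opposite parity.\<close>

fun act :: "nat \<Rightarrow> letter \<Rightarrow> 'k::field operator" where
  "act n (E i) = chain_act n 1 1 1 1 i"
| "act n (H i) = (\<lambda>v a. of_int (weight n i a) * v a)"
| "act n (F i) = chain_act n (- 1) (- 1) (- 2) 2 i"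

fun actw :: "nat \<Rightarrow> letter list \<Rightarrow> 'k::field operator" where
  "actw n [] v = v"
| "actw n (x # u) v = act n x (actw n u v)"

text \<open>Matrices act on all functions on the integers, so products of letters become
  compositions of operators and no index bounds have to be carried along.\<close>

definition rho :: "nat \<Rightarrow> 'k::field wpoly \<Rightarrow> 'k operator" where
  "rho n p v = (\<lambda>a. \<Sum>u\<in>Poly_Mapping.keys p. Poly_Mapping.lookup p u * actw n u v a)"

lemma actw_append: "actw n (u @ w) v = actw n u (actw n w v)"
  by (induction u) auto

lemma act_sum: "act n x (\<lambda>b. \<Sum>i\<in>I. c i * f i b) a = (\<Sum>i\<in>I. c i * act n x (f i) a)"
  by (cases x) (auto simp: chain_act_def entries_def sum_distrib_left mult.left_commute)

lemma actw_sum: "actw n u (\<lambda>b. \<Sum>i\<in>I. c i * f i b) = (\<lambda>a. \<Sum>i\<in>I. c i * actw n u (f i) a)"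
  by (induction u) (auto simp: act_sum)

lemma rho_superset:
  "finite A \<Longrightarrow> Poly_Mapping.keys p \<subseteq> A \<Longrightarrow>
    rho n p v a = (\<Sum>u\<in>A. Poly_Mapping.lookup p u * actw n u v a)"
  unfolding rho_def by (rule sum.mono_neutral_left) (auto simp: in_keys_iff)

lemma rho_add: "rho n (p + q) v a = rho n p v a + rho n q v a"
  using rho_superset[of "Poly_Mapping.keys p \<union> Poly_Mapping.keys q" p n v a]
    rho_superset[of "Poly_Mapping.keys p \<union> Poly_Mapping.keys q" q n v a]
    rho_superset[of "Poly_Mapping.keys p \<union> Poly_Mapping.keys q" "p + q" n v a]
    keys_add[of p q]
  by (simp add: lookup_add distrib_right sum.distrib)

lemma rho_zero [simp]: "rho n 0 v a = 0"
  by (simp add: rho_def)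

lemma rho_smul: "rho n (smul c p) v a = c * rho n p v a"
proof -
  have "Poly_Mapping.keys (smul c p) \<subseteq> Poly_Mapping.keys p" by (auto simp: in_keys_iff)
  then show ?thesis
    using rho_superset[of "Poly_Mapping.keys p" "smul c p" n v a]
    by (simp add: rho_def sum_distrib_left mult.assoc)
qed

lemma rho_diff: "rho n (p - q) v a = rho n p v a - rho n q v a"
  using rho_add[of n p "smul (- 1) q" v a] rho_smul[of n "- 1" q v a] by simp

lemma rho_sum: "rho n (\<Sum>i\<in>I. f i) v a = (\<Sum>i\<in>I. rho n (f i) v a)"
  by (induction I rule: infinite_finite_induct) (auto simp: rho_add)

lemma rho_single: "rho n (Poly_Mapping.single u c) v a = c * actw n u v a"
  by (simp add: rho_def)

lemma rho_lt: "rho n (lt x) v a = act n x v a"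
  by (simp add: lt_def rho_single)

lemma rho_mult: "rho n (p * q) v = rho n p (rho n q v)"
proof
  fix a
  have "rho n (p * q) v a = (\<Sum>u\<in>Poly_Mapping.keys p. \<Sum>w\<in>Poly_Mapping.keys q.
      Poly_Mapping.lookup p u * Poly_Mapping.lookup q w * actw n (u @ w) v a)"
    unfolding pmul_eq[symmetric] pmul_def by (simp add: rho_sum rho_single)
  also have "\<dots> = rho n p (rho n q v) a"
    unfolding rho_def by (simp add: actw_append actw_sum sum_distrib_left mult.assoc)
  finally show "rho n (p * q) v a = rho n p (rho n q v) a" .
qed

text \<open>The sign is read off the parities of \<open>p\<close> and \<open>q\<close>; the
  operators themselves carry no grading.\<close>

lemma rho_br:
  assumes "hom n b p" "hom n c q"
  shows "rho n (br n p q) v a = rho n p (rho n q v) a + (if b \<and> c then 1 else - 1) * rho n q (rho n p v) a"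
  by (auto simp: br_hom[OF assms] rho_add rho_diff rho_mult)

definition kernel :: "nat \<Rightarrow> 'k::field wpoly set" where
  "kernel n = {p. \<forall>v a. rho n p v a = 0}"

lemma actw_zero: "actw n u (\<lambda>_. 0) = (\<lambda>_. 0)"
  using actw_sum[of n u "\<lambda>_. 0" "\<lambda>_ _. 0" "{}"] by simp

lemma rho_at_zero: "rho n p (\<lambda>_. 0) a = 0"
  by (simp add: rho_def actw_zero)

lemma kernel_add: "p \<in> kernel n \<Longrightarrow> q \<in> kernel n \<Longrightarrow> p + q \<in> kernel n"
  by (simp add: kernel_def rho_add)

lemma kernel_mult: "p \<in> kernel n \<Longrightarrow> r * p \<in> kernel n" "p \<in> kernel n \<Longrightarrow> p * r \<in> kernel n"
proof -
  assume p: "p \<in> kernel n"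
  then have "rho n p v = (\<lambda>_. 0)" for v by (auto simp: kernel_def)
  then show "r * p \<in> kernel n" "p * r \<in> kernel n" by (simp_all add: kernel_def rho_mult rho_at_zero)
qed

definition entry :: "nat \<Rightarrow> int \<Rightarrow> int \<Rightarrow> 'k::field wpoly \<Rightarrow> 'k" where
  "entry n a c p = rho n p (\<lambda>b. if b = c then 1 else 0) a"

text \<open>Among the elements with nonzero coefficient take one of least rank. At its distinguished
  entry all the others vanish, since a nonzero entry would force a smaller rank.\<close>

lemma kernel_independent:
  fixes rank :: "'k::field wpoly \<Rightarrow> nat"
  assumes triangular: "\<And>b. b \<in> B \<Longrightarrow> \<exists>a c. entry n a c b \<noteq> 0 \<and>
      (\<forall>b'\<in>B. b' \<noteq> b \<longrightarrow> entry n a c b' \<noteq> 0 \<longrightarrow> rank b' < rank b)"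
    and r: "r \<in> wp.span B" "r \<in> kernel n"
  shows "r = 0"
proof -
  obtain t k where t: "finite t" "t \<subseteq> B" and rt: "r = (\<Sum>b\<in>t. smul (k b) b)"
    using r(1) unfolding wp.span_explicit by blast
  define t' where "t' = {b\<in>t. k b \<noteq> 0}"
  have rt': "r = (\<Sum>b\<in>t'. smul (k b) b)"
    unfolding rt t'_def using t(1) by (intro sum.mono_neutral_right) auto
  have fin: "finite t'" using t by (simp add: t'_def)
  have "t' = {}"
  proof (rule ccontr)
    assume "t' \<noteq> {}"
    then obtain b where b: "b \<in> t'" and min: "\<And>b'. b' \<in> t' \<Longrightarrow> rank b \<le> rank b'"
      using arg_min_if_finite(1)[OF fin, of rank] arg_min_least[OF fin, of _ rank] by blast
    have "b \<in> B" using b t by (auto simp: t'_def)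
    from triangular[OF this] obtain a c where ac: "entry n a c b \<noteq> 0"
      "\<And>b'. b' \<in> B \<Longrightarrow> b' \<noteq> b \<Longrightarrow> entry n a c b' \<noteq> 0 \<Longrightarrow> rank b' < rank b"
      by blast
    have "entry n a c b' = 0" if "b' \<in> t' - {b}" for b'
      using ac(2)[of b'] min[of b'] that t by (auto simp: t'_def)
    then have "entry n a c r = k b * entry n a c b"
      unfolding rt' entry_def rho_sum rho_smul using fin b
      by (subst sum.remove[of _ b]) (auto intro!: sum.neutral)
    then show False using r(2) ac(1) b by (simp add: kernel_def entry_def t'_def)
  qed
  then show ?thesis using rt' by simp
qed

text \<open>No column of the left factor is a row of the right one, so the matrix product is
  0.\<close>

lemma entries_zero: "c \<noteq> r' \<Longrightarrow> c \<noteq> r'' \<Longrightarrow> c' \<noteq> r' \<Longrightarrow> c' \<noteq> r'' \<Longrightarrow>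
    entries r c k l c' k' (entries r' d m r'' d' m' v) = (\<lambda>_. 0)"
  by (auto simp: entries_def)

text \<open>Sign and constants stay symbolic so that one computation serves the e and the f.\<close>

locale chain_rep = chain n C for n C +
  fixes s :: int and \<alpha> \<beta> \<gamma> :: "'k::field"
  assumes act_C: "act n (C i) = chain_act n s \<alpha> \<beta> \<gamma> i"
    and s: "s = 1 \<or> s = - 1"
    and nonzero: "\<alpha> \<noteq> 0" "\<beta> \<noteq> 0" "\<gamma> \<noteq> 0" "(2 :: 'k) \<noteq> 0"
    and oddl_C: "oddl n (C i) \<longleftrightarrow> i = n"
begin

lemma oddw_cw: "1 \<le> j \<Longrightarrow> j \<le> i \<Longrightarrow> i \<le> n \<Longrightarrow> oddw n (cw i j) \<longleftrightarrow> i = n"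
proof (induction i)
  case (Suc i)
  have hd: "oddw n (x # u) \<longleftrightarrow> oddl n x \<noteq> oddw n u" for x u by (simp add: oddw_def)
  show ?case
  proof (cases "j = Suc i")
    case True
    then show ?thesis by (simp add: oddw_def oddl_C)
  next
    case False
    then show ?thesis using Suc by (simp add: cw_Suc hd oddl_C)
  qed
qed simp

lemma hom_gij: "1 \<le> j \<Longrightarrow> j \<le> i \<Longrightarrow> i \<le> n \<Longrightarrow> hom n (i = n) (gij n C i j :: 'k wpoly)"
  using LS_poly_gij[of j i] oddw_cw[of j i] by (auto simp: LS_poly_def)

lemma hom_lt_C: "hom n (i = n) (lt (C i) :: 'k wpoly)"
  using hom_lt[of n "C i"] by (simp add: oddl_C)

lemma rho_lt_C: "rho n (lt (C i)) = chain_act n s \<alpha> \<beta> \<gamma> i"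
  by (intro ext) (simp add: rho_lt act_C)

text \<open>A root vector for s (eps_j - eps_(i+1)). The scalar is \<alpha> to a power up to sign;
  what matters later is that it is nonzero.\<close>

lemma rho_gij_less:
  assumes "1 \<le> j" "j \<le> i" "i < n"
  shows "\<exists>k. k \<noteq> 0 \<and> rho n (gij n C i j :: 'k wpoly) =
    entries (s * int j) (s * (int i + 1)) k (- (s * (int i + 1))) (- (s * int j)) (- k)"
  using assms
proof (induction i)
  case (Suc i)
  show ?case
  proof (cases "j = Suc i")
    case True
    then show ?thesis using Suc.prems nonzero(1) by (intro exI[of _ \<alpha>]) (simp add: rho_lt_C chain_act_def)
  next
    case False
    then obtain k where k: "k \<noteq> 0" "rho n (gij n C i j :: 'k wpoly) =
        entries (s * int j) (s * (int i + 1)) k (- (s * (int i + 1))) (- (s * int j)) (- k)"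
      using Suc by auto
    have gij_Suc: "gij n C (Suc i) j = br n (lt (C (Suc i))) (gij n C i j :: 'k wpoly)"
      using Suc.prems False by simp
    have hom: "hom n (Suc i = n) (lt (C (Suc i)) :: 'k wpoly)" "hom n (i = n) (gij n C i j :: 'k wpoly)"
      using hom_lt_C[of "Suc i"] hom_gij[of j i] Suc.prems False by auto
    have "rho n (gij n C (Suc i) j :: 'k wpoly) v a =
        entries (s * int j) (s * (int (Suc i) + 1)) (- (\<alpha> * k))
          (- (s * (int (Suc i) + 1))) (- (s * int j)) (\<alpha> * k) v a" for v a
    proof -
      have "j \<le> i" "i < n" "Suc i \<noteq> n" "i \<noteq> n" using Suc.prems False by auto
      then show ?thesis using s \<open>1 \<le> j\<close> unfolding gij_Suc
        by (auto simp: rho_br[OF hom] k(2) rho_lt_C chain_act_def entries_def)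
    qed
    then show ?thesis using k(1) nonzero(1) by (intro exI[of _ "- (\<alpha> * k)"]) (auto intro!: ext)
  qed
qed simp

text \<open>A root vector for s eps_j: the bracket with the letter of index n moves the column s n
  to 0.\<close>

lemma rho_gij_n:
  assumes "1 \<le> j" "j \<le> n"
  shows "\<exists>k. k \<noteq> 0 \<and> rho n (gij n C n j :: 'k wpoly) =
    entries (s * int j) 0 (k * \<beta>) 0 (- (s * int j)) (k * \<gamma>)"
proof (cases "j = n")
  case True
  then obtain m where "n = Suc m" using assms by (cases n) auto
  then have "gij n C n j = (lt (C n) :: 'k wpoly)" using True by simp
  then show ?thesis using True by (intro exI[of _ 1]) (simp add: rho_lt_C chain_act_def)
next
  case False
  then obtain m where m: "n = Suc m" "1 \<le> j" "j \<le> m" using assms by (cases n) auto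
  then obtain k where k: "k \<noteq> 0" "rho n (gij n C m j :: 'k wpoly) =
      entries (s * int j) (s * (int m + 1)) k (- (s * (int m + 1))) (- (s * int j)) (- k)"
    using rho_gij_less[of j m] by auto
  have hom: "hom n True (lt (C n) :: 'k wpoly)" "hom n False (gij n C m j :: 'k wpoly)"
    using hom_lt_C[of n] hom_gij[of j m] m by auto
  have eq: "gij n C n j = br n (lt (C n)) (gij n C m j :: 'k wpoly)" using m by simp
  have "int n = int m + 1" using m(1) by simp
  then have "rho n (gij n C n j :: 'k wpoly) v a =
      entries (s * int j) 0 (- k * \<beta>) 0 (- (s * int j)) (- k * \<gamma>) v a" for v a
    using m(2,3) s unfolding eq by (auto simp: rho_br[OF hom] k(2) rho_lt_C chain_act_def entries_def)
  then show ?thesis using k(1) by (intro exI[of _ "- k"]) (auto intro!: ext)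
qed

text \<open>A root vector for s (eps_i + eps_j), including the long roots with i = j.\<close>

lemma rho_square:
  assumes "1 \<le> j" "j \<le> i" "i \<le> n"
  shows "\<exists>k. k \<noteq> 0 \<and> rho n (br n (gij n C n i) (gij n C n j) :: 'k wpoly) =
    entries (s * int i) (- (s * int j)) k (s * int j) (- (s * int i)) k"
proof -
  obtain k k' where k: "k \<noteq> 0" "rho n (gij n C n i :: 'k wpoly) =
      entries (s * int i) 0 (k * \<beta>) 0 (- (s * int i)) (k * \<gamma>)"
    "k' \<noteq> 0" "rho n (gij n C n j :: 'k wpoly) =
      entries (s * int j) 0 (k' * \<beta>) 0 (- (s * int j)) (k' * \<gamma>)"
    using rho_gij_n[of i] rho_gij_n[of j] assms by auto
  have hom: "hom n True (gij n C n i :: 'k wpoly)" "hom n True (gij n C n j :: 'k wpoly)"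
    using hom_gij[of i n] hom_gij[of j n] assms by auto
  \<comment> \<open>The two products contribute at the positions (i,-j) and (j,-i), up to the sign
    \<open>s\<close>; for i = j these coincide and the values add up.\<close>
  let ?k = "(if i = j then 2 else 1) * k * k' * \<beta> * \<gamma>"
  have "rho n (br n (gij n C n i) (gij n C n j) :: 'k wpoly) v a =
      entries (s * int i) (- (s * int j)) ?k (s * int j) (- (s * int i)) ?k v a" for v a
    using assms s by (auto simp: rho_br[OF hom] k entries_def algebra_simps)
  then have "rho n (br n (gij n C n i) (gij n C n j) :: 'k wpoly) =
      entries (s * int i) (- (s * int j)) ?k (s * int j) (- (s * int i)) ?k" by (intro ext)
  moreover have "?k \<noteq> 0" using k nonzero by simp
  ultimately show ?thesis by blast
qed

lemma br_kernel:
  assumes "hom n b p" "hom n c q"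
    and "\<And>v. rho n p (rho n q v) = (\<lambda>_. 0)" "\<And>v. rho n q (rho n p v) = (\<lambda>_. 0)"
  shows "br n p q \<in> kernel n"
  by (simp add: kernel_def rho_br[OF assms(1,2)] assms(3,4))

lemma hom_square: "1 \<le> j \<Longrightarrow> j \<le> i \<Longrightarrow> i \<le> n \<Longrightarrow>
    hom n False (br n (gij n C n i) (gij n C n j) :: 'k wpoly)"
  using hom_br[OF hom_gij[of i n] hom_gij[of j n]] by auto

text \<open>Each relation is a bracket of two factors whose operator products vanish in either
  order, because no column of one is a row of the other.\<close>

lemma Rside_kernel:
  assumes "p \<in> Rside n C"
  shows "(p :: 'k wpoly) \<in> kernel n"
proof -
  from assms consider
    i j where "p = br n (lt (C i)) (lt (C j))" "i \<le> n" "j + 1 < i" "1 < j + 1"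
  | i j where "p = br n (gij n C i j) (lt (C (i - 1)))" "i \<le> n" "j < i" "1 \<le> j"
  | i j where "p = br n (gij n C i j) (gij n C i (j - 1))" "i < n" "j \<le> i" "1 < j"
  | i j where "p = br n (gij n C n i) (br n (gij n C n j) (gij n C n (j - 1)))" "i \<le> n" "j \<le> i" "1 < j"
  | i j where "p = br n (br n (gij n C n i) (gij n C n j)) (gij n C n (i - 1))" "i \<le> n" "j < i" "1 \<le> j"
  | i j where "p = br n (br n (gij n C n i) (gij n C n j)) (br n (gij n C n i) (gij n C n (j - 1)))"
      "i \<le> n" "j < i" "1 < j"
    unfolding Rside_def by blast
  then show ?thesis
  proof cases
    case (1 i j)
    show ?thesis unfolding 1(1)
      by (rule br_kernel[OF hom_lt_C hom_lt_C]; unfold rho_lt_C chain_act_def)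
        (use 1 s in \<open>auto intro!: entries_zero\<close>)
  next
    case (2 i j)
    have hom: "hom n (i = n) (gij n C i j :: 'k wpoly)" using 2 by (intro hom_gij) auto
    show ?thesis
    proof (cases "i = n")
      case True
      obtain k where "rho n (gij n C n j :: 'k wpoly) =
          entries (s * int j) 0 (k * \<beta>) 0 (- (s * int j)) (k * \<gamma>)"
        using rho_gij_n[of j] 2 by auto
      then show ?thesis unfolding 2(1)
        by (intro br_kernel[OF hom hom_lt_C]; unfold rho_lt_C chain_act_def)
          (use 2 s True in \<open>auto intro!: entries_zero\<close>)
    next
      case False
      obtain k where "rho n (gij n C i j :: 'k wpoly) =
          entries (s * int j) (s * (int i + 1)) k (- (s * (int i + 1))) (- (s * int j)) (- k)"
        using rho_gij_less[of j i] 2 False by auto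
      then show ?thesis unfolding 2(1)
        by (intro br_kernel[OF hom hom_lt_C]; unfold rho_lt_C chain_act_def)
          (use 2 s False in \<open>auto intro!: entries_zero\<close>)
    qed
  next
    case (3 i j)
    have "1 \<le> j" "1 \<le> j - 1" "j - 1 \<le> i" using 3 by auto
    with rho_gij_less[OF this(1) 3(3,2)] rho_gij_less[OF this(2,3) 3(2)]
    obtain k k' where "rho n (gij n C i j :: 'k wpoly) =
          entries (s * int j) (s * (int i + 1)) k (- (s * (int i + 1))) (- (s * int j)) (- k)"
        "rho n (gij n C i (j - 1) :: 'k wpoly) =
          entries (s * int (j - 1)) (s * (int i + 1)) k' (- (s * (int i + 1))) (- (s * int (j - 1))) (- k')"
      by blast
    then show ?thesis unfolding 3(1)
      by (intro br_kernel[OF hom_gij hom_gij]) (use 3 s in \<open>auto intro!: entries_zero\<close>)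
  next
    case (4 i j)
    have "1 \<le> i" "1 \<le> j - 1" "j - 1 \<le> j" "j \<le> n" using 4 by auto
    with rho_gij_n[OF this(1) 4(2)] rho_square[OF this(2-4)]
    obtain k k' where "rho n (gij n C n i :: 'k wpoly) =
          entries (s * int i) 0 (k * \<beta>) 0 (- (s * int i)) (k * \<gamma>)"
        "rho n (br n (gij n C n j) (gij n C n (j - 1)) :: 'k wpoly) =
          entries (s * int j) (- (s * int (j - 1))) k' (s * int (j - 1)) (- (s * int j)) k'"
      by blast
    then show ?thesis unfolding 4(1)
      by (intro br_kernel[OF hom_gij hom_square]) (use 4 s in \<open>auto intro!: entries_zero\<close>)
  next
    case (5 i j)
    have "1 \<le> i - 1" "i - 1 \<le> n" "j \<le> i" using 5 by auto
    with rho_gij_n[OF this(1,2)] rho_square[OF 5(4) this(3) 5(2)]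
    obtain k k' where "rho n (gij n C n (i - 1) :: 'k wpoly) =
          entries (s * int (i - 1)) 0 (k * \<beta>) 0 (- (s * int (i - 1))) (k * \<gamma>)"
        "rho n (br n (gij n C n i) (gij n C n j) :: 'k wpoly) =
          entries (s * int i) (- (s * int j)) k' (s * int j) (- (s * int i)) k'"
      by blast
    then show ?thesis unfolding 5(1)
      by (intro br_kernel[OF hom_square hom_gij]) (use 5 s in \<open>auto intro!: entries_zero\<close>)
  next
    case (6 i j)
    have "1 \<le> j" "j \<le> i" "1 \<le> j - 1" "j - 1 \<le> i" using 6 by auto
    with rho_square[OF this(1,2) 6(2)] rho_square[OF this(3,4) 6(2)]
    obtain k k' where "rho n (br n (gij n C n i) (gij n C n j) :: 'k wpoly) =
          entries (s * int i) (- (s * int j)) k (s * int j) (- (s * int i)) k"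
        "rho n (br n (gij n C n i) (gij n C n (j - 1)) :: 'k wpoly) =
          entries (s * int i) (- (s * int (j - 1))) k' (s * int (j - 1)) (- (s * int i)) k'"
      by blast
    then show ?thesis unfolding 6(1)
      by (intro br_kernel[OF hom_square hom_square]) (use 6 s in \<open>auto intro!: entries_zero\<close>)
  qed
qed

end

section \<open>Matrix entries of root vectors\<close>

lemma entry_entries:
  "rho n p = entries r c k r' c' k' \<Longrightarrow>
    entry n a d p = (if a = r then if d = c then k else 0 else if a = r' \<and> d = c' then k' else 0)"
  by (simp add: entry_def entries_def)

text \<open>Positive root vectors have entries strictly above, negative ones strictly below the diagonal
  if the indices are ordered by decreasing height.\<close>

definition height :: "nat \<Rightarrow> int \<Rightarrow> int" where
  "height n a = (if a > 0 then int n + 1 - a else if a < 0 then - (int n + 1) - a else 0)"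

context chain_rep
begin

definition Bside :: "'k wpoly set" where
  "Bside = {gij n C i j | i j. 1 \<le> j \<and> j \<le> i \<and> i \<le> n}
    \<union> {br n (gij n C n i) (gij n C n j) | i j. 1 \<le> j \<and> j \<le> i \<and> i \<le> n}"

lemma entry_height:
  assumes "b \<in> Bside" "entry n a c b \<noteq> 0"
  shows "s * height n c < s * height n a"
  using assms(1) unfolding Bside_def
proof (elim UnE CollectE exE conjE)
  fix i j assume b: "b = gij n C i j" and ij: "1 \<le> j" "j \<le> i" "i \<le> n"
  show ?thesis
  proof (cases "i = n")
    case True
    then obtain k where "rho n b = entries (s * int j) 0 (k * \<beta>) 0 (- (s * int j)) (k * \<gamma>)"
      using rho_gij_n[of j] ij b by auto
    from assms(2)[unfolded entry_entries[OF this]] show ?thesis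
      using ij s by (auto simp: height_def split: if_splits)
  next
    case False
    then obtain k where "rho n b = entries (s * int j) (s * (int i + 1)) k (- (s * (int i + 1))) (- (s * int j)) (- k)"
      using rho_gij_less[of j i] ij b by auto
    from assms(2)[unfolded entry_entries[OF this]] show ?thesis
      using ij s by (auto simp: height_def split: if_splits)
  qed
next
  fix i j assume b: "b = br n (gij n C n i) (gij n C n j)" and ij: "1 \<le> j" "j \<le> i" "i \<le> n"
  then obtain k where "rho n b = entries (s * int i) (- (s * int j)) k (s * int j) (- (s * int i)) k"
    using rho_square[of j i] by auto
  from assms(2)[unfolded entry_entries[OF this]] show ?thesis
    using ij s by (auto simp: height_def split: if_splits)
qed

definition col :: "nat \<Rightarrow> int" where
  "col i = (if i = n then 0 else s * (int i + 1))"

text \<open>Of the two mirrored entries of a root vector of this kind, the rows s l with l >= 1 show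
  just one, and it already determines i and j.\<close>

lemma entry_gij:
  assumes "1 \<le> j" "j \<le> i" "i \<le> n"
  shows "\<exists>k. k \<noteq> 0 \<and> (\<forall>l x. 1 \<le> l \<longrightarrow> entry n (s * int l) x (gij n C i j :: 'k wpoly) =
    (if l = j \<and> x = col i then k else 0))"
proof (cases "i = n")
  case True
  then obtain k where k: "k \<noteq> 0" and
    rho: "rho n (gij n C i j :: 'k wpoly) = entries (s * int j) 0 (k * \<beta>) 0 (- (s * int j)) (k * \<gamma>)"
    using rho_gij_n[of j] assms by auto
  then show ?thesis
    using nonzero s True unfolding entry_entries[OF rho] by (intro exI[of _ "k * \<beta>"]) (auto simp: col_def)
next
  case False
  then obtain k where k: "k \<noteq> 0" and
    rho: "rho n (gij n C i j :: 'k wpoly) = entries (s * int j) (s * (int i + 1)) k (- (s * (int i + 1))) (- (s * int j)) (- k)"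
    using rho_gij_less[of j i] assms by auto
  then show ?thesis
    using s False unfolding entry_entries[OF rho] by (intro exI[of _ k]) (auto simp: col_def)
qed

lemma entry_square:
  assumes "1 \<le> j" "j \<le> i" "i \<le> n"
  shows "\<exists>k. k \<noteq> 0 \<and> (\<forall>l x. 1 \<le> l \<longrightarrow> entry n (s * int l) x (br n (gij n C n i) (gij n C n j) :: 'k wpoly) =
    (if l = i \<and> x = - (s * int j) \<or> l = j \<and> x = - (s * int i) then k else 0))"
proof -
  obtain k where k: "k \<noteq> 0" and rho: "rho n (br n (gij n C n i) (gij n C n j) :: 'k wpoly) =
      entries (s * int i) (- (s * int j)) k (s * int j) (- (s * int i)) k"
    using rho_square[OF assms] by blast
  then show ?thesis using s unfolding entry_entries[OF rho] by (intro exI[of _ k]) auto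
qed

lemma entry_gij_nonzeroD:
  "1 \<le> j \<Longrightarrow> j \<le> i \<Longrightarrow> i \<le> n \<Longrightarrow> 1 \<le> l \<Longrightarrow> entry n (s * int l) x (gij n C i j :: 'k wpoly) \<noteq> 0 \<Longrightarrow>
    l = j \<and> x = col i"
  using entry_gij[of j i] by metis

lemma entry_square_nonzeroD:
  "1 \<le> j \<Longrightarrow> j \<le> i \<Longrightarrow> i \<le> n \<Longrightarrow> 1 \<le> l \<Longrightarrow>
    entry n (s * int l) x (br n (gij n C n i) (gij n C n j) :: 'k wpoly) \<noteq> 0 \<Longrightarrow>
    l = i \<and> x = - (s * int j) \<or> l = j \<and> x = - (s * int i)"
  using entry_square[of j i] by metis

text \<open>In the rows s l with l >= 1, the columns of the \<open>gij\<close> are 0 or have the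
  sign of \<open>s\<close>, those of the brackets of two odd vectors have the opposite sign. Within
  each kind, row and column recover the indices.\<close>

lemma Bside_separated:
  assumes "b \<in> Bside"
  shows "\<exists>a c. entry n a c b \<noteq> 0 \<and> (\<forall>b'\<in>Bside. b' \<noteq> b \<longrightarrow> entry n a c b' = 0)"
proof -
  have "\<exists>l x. entry n (s * int l) x b \<noteq> 0 \<and> (\<forall>b'\<in>Bside. entry n (s * int l) x b' \<noteq> 0 \<longrightarrow> b' = b)"
    using assms[unfolded Bside_def]
  proof (elim UnE CollectE exE conjE)
    fix i j assume b: "b = gij n C i j" and ij: "1 \<le> j" "j \<le> i" "i \<le> n"
    have "b' = b" if "b' \<in> Bside" and nz: "entry n (s * int j) (col i) b' \<noteq> 0" for b'
      using that(1) unfolding Bside_def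
    proof (elim UnE CollectE exE conjE)
      fix i' j' assume b': "b' = gij n C i' j'" "1 \<le> j'" "j' \<le> i'" "i' \<le> n"
      then have "j = j' \<and> col i = col i'" using entry_gij_nonzeroD[OF b'(2-4) ij(1)] nz by simp
      then have "i = i'" using s ij(3) b'(4) by (auto simp: col_def split: if_splits)
      then show "b' = b" using b b'(1) \<open>j = j' \<and> col i = col i'\<close> by simp
    next
      fix i' j' assume b': "b' = br n (gij n C n i') (gij n C n j')" "1 \<le> j'" "j' \<le> i'" "i' \<le> n"
      then have "col i = - (s * int j') \<or> col i = - (s * int i')"
        using entry_square_nonzeroD[OF b'(2-4) ij(1)] nz by force
      then show "b' = b" using s b' by (auto simp: col_def split: if_splits)
    qed
    moreover have "entry n (s * int j) (col i) b \<noteq> 0" using entry_gij[OF ij] ij(1) b by auto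
    ultimately show ?thesis by blast
  next
    fix i j assume b: "b = br n (gij n C n i) (gij n C n j)" and ij: "1 \<le> j" "j \<le> i" "i \<le> n"
    have "b' = b" if "b' \<in> Bside" and nz: "entry n (s * int j) (- (s * int i)) b' \<noteq> 0" for b'
      using that(1) unfolding Bside_def
    proof (elim UnE CollectE exE conjE)
      fix i' j' assume b': "b' = gij n C i' j'" "1 \<le> j'" "j' \<le> i'" "i' \<le> n"
      then have "- (s * int i) = col i'" using entry_gij_nonzeroD[OF b'(2-4) ij(1)] nz by simp
      then show "b' = b" using s ij by (auto simp: col_def split: if_splits)
    next
      fix i' j' assume b': "b' = br n (gij n C n i') (gij n C n j')" "1 \<le> j'" "j' \<le> i'" "i' \<le> n"
      then have "j = i' \<and> s * int i = s * int j' \<or> j = j' \<and> s * int i = s * int i'"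
        using entry_square_nonzeroD[OF b'(2-4) ij(1)] nz by force
      then have "i = i' \<and> j = j'" using s ij b' by auto
      then show "b' = b" using b b'(1) by simp
    qed
    moreover have "entry n (s * int j) (- (s * int i)) b \<noteq> 0" using entry_square[OF ij] ij(1) b by auto
    ultimately show ?thesis by blast
  qed
  then show ?thesis by blast
qed

lemma Bside_free_lie: "b \<in> Bside \<Longrightarrow> b \<in> free_lie n"
  using LS_poly_gij by (auto simp: Bside_def LS_poly_def intro!: free_lie.brk)

text \<open>A square u = r r occurs only for odd r, that is r = \<open>cw n j\<close>. Then the
  bracket of \<open>gij n C n j\<close> with itself, whose leading coefficient is 2, is the required
  element.\<close>

lemma Bside_lead:
  assumes u: "superLS n u" "root u = r" and r: "LS r" "set r \<subseteq> C ` {1..n}" "avoids r"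
  shows "\<exists>b\<in>Bside. \<exists>c. lead b u c"
  using irreducible_words[OF r]
proof (elim disjE exE conjE)
  fix i j assume ij: "1 \<le> j" "j \<le> i" "i \<le> n" and rij: "r = cw i j"
  from u(1) show ?thesis
  proof (cases rule: superLS_cases)
    case LS
    then have "lead (gij n C i j :: 'k wpoly) u 1"
      using LS_poly_gij[OF ij, where ?'k = 'k] u(2) rij by (simp add: LS_poly_def)
    then show ?thesis using ij unfolding Bside_def by blast
  next
    case (square v)
    then have v: "v = r" using u(2) by simp
    then have i: "i = n" using oddw_cw[OF ij] square(3) rij by simp
    have hom: "hom n True (gij n C n j :: 'k wpoly)" using hom_gij[of j n] ij i by simp
    have "lead (gij n C n j :: 'k wpoly) r 1"
      using LS_poly_gij[OF ij, where ?'k = 'k] rij i by (simp add: LS_poly_def)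
    from lead_br_square[OF hom hom this this nonzero(4)]
    have "lead (br n (gij n C n j) (gij n C n j) :: 'k wpoly) u (2 * 1 * 1)" using v square(1) by simp
    moreover have "br n (gij n C n j) (gij n C n j) \<in> Bside" using ij i unfolding Bside_def by blast
    ultimately show ?thesis by blast
  qed
next
  fix i j assume ij: "1 \<le> j" "j < i" "i \<le> n" and rij: "r = cw n i @ cw n j"
  have "\<not> oddw n r" using oddw_cw[of i n] oddw_cw[of j n] ij rij by simp
  then have "u = r" using u by (auto elim!: superLS_cases)
  then have "lead (br n (gij n C n i) (gij n C n j) :: 'k wpoly) u 1"
    using LS_poly_D[OF ij(2,1,3), where ?'k = 'k] rij by (simp add: LS_poly_def)
  then show ?thesis using ij unfolding Bside_def by (blast intro: less_imp_le)
qed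

end

section \<open>The relations W\<close>

lemma LS_poly_add:
  "LS_poly n p u \<Longrightarrow> q \<in> free_lie n \<Longrightarrow> hom n (oddw n u) q \<Longrightarrow> wbelow u q \<Longrightarrow> LS_poly n (p + q) u"
  by (auto simp: LS_poly_def intro: free_lie.add hom_add lead_add_wbelow)

lemma LS_poly_letters: "inX n x \<Longrightarrow> inX n y \<Longrightarrow> lless y x \<Longrightarrow> LS_poly n (br n (lt x) (lt y)) [x, y]"
  using LS_poly_br[OF LS_poly_lt LS_poly_lt, of n x y] by simp

lemma wbelow_lt: "wbelow [x, y] (smul c (lt z))"
  by (rule wbelow_smul) (auto simp: wbelow_def lt_def lookup_single when_def dlless_def)

lemma LS_poly_Wrel:
  "1 \<le> j \<Longrightarrow> j < i \<Longrightarrow> i \<le> n \<Longrightarrow> LS_poly n (br n (lt (H i)) (lt (H j)) :: 'k::field wpoly) [H i, H j]"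
  "i \<in> {1..n} \<Longrightarrow> j \<in> {1..n} \<Longrightarrow>
    LS_poly n (br n (lt (E i)) (lt (F j)) - (if i = j then lt (H i) else 0) :: 'k wpoly) [E i, F j]"
  "i \<in> {1..n} \<Longrightarrow> j \<in> {1..n} \<Longrightarrow>
    LS_poly n (br n (lt (E j)) (lt (H i)) + smul c (lt (E j)) :: 'k wpoly) [E j, H i]"
  "i \<in> {1..n} \<Longrightarrow> j \<in> {1..n} \<Longrightarrow>
    LS_poly n (br n (lt (H i)) (lt (F j)) + smul c (lt (F j)) :: 'k wpoly) [H i, F j]"
proof -
  assume "1 \<le> j" "j < i" "i \<le> n"
  then show "LS_poly n (br n (lt (H i)) (lt (H j)) :: 'k wpoly) [H i, H j]"
    by (intro LS_poly_letters) (auto simp: inX_def lless_def)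
next
  assume ij: "i \<in> {1..n}" "j \<in> {1..n}"
  have *: "LS_poly n (br n (lt (E i)) (lt (F j)) :: 'k wpoly) [E i, F j]"
    using ij by (intro LS_poly_letters) (auto simp: inX_def lless_def)
  have "LS_poly n (br n (lt (E i)) (lt (F j)) + smul (- 1) (lt (H i)) :: 'k wpoly) [E i, F j]" if "i = j"
    using ij that hom_lt[of n "H i"]
    by (intro LS_poly_add * wbelow_lt free_lie.scal free_lie.gen hom_smul)
      (auto simp: inX_def oddw_def oddl_def)
  then show "LS_poly n (br n (lt (E i)) (lt (F j)) - (if i = j then lt (H i) else 0) :: 'k wpoly) [E i, F j]"
    using * by simp
next
  assume ij: "i \<in> {1..n}" "j \<in> {1..n}"
  have "LS_poly n (br n (lt (E j)) (lt (H i)) :: 'k wpoly) [E j, H i]"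
    using ij by (intro LS_poly_letters) (auto simp: inX_def lless_def)
  then show "LS_poly n (br n (lt (E j)) (lt (H i)) + smul c (lt (E j)) :: 'k wpoly) [E j, H i]"
    using ij hom_lt[of n "E j"] by (intro LS_poly_add wbelow_lt free_lie.scal free_lie.gen hom_smul)
      (auto simp: inX_def oddw_def oddl_def split: if_splits)
next
  assume ij: "i \<in> {1..n}" "j \<in> {1..n}"
  have "LS_poly n (br n (lt (H i)) (lt (F j)) :: 'k wpoly) [H i, F j]"
    using ij by (intro LS_poly_letters) (auto simp: inX_def lless_def)
  then show "LS_poly n (br n (lt (H i)) (lt (F j)) + smul c (lt (F j)) :: 'k wpoly) [H i, F j]"
    using ij hom_lt[of n "F j"] by (intro LS_poly_add wbelow_lt free_lie.scal free_lie.gen hom_smul)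
      (auto simp: inX_def oddw_def oddl_def split: if_splits)
qed

text \<open>The commutator with a diagonal operator multiplies the entry at (r,c) by w c - w r. If r
  = r', the second entry is shadowed, hence the guarded assumption.\<close>

lemma entries_weight:
  fixes k k' :: "'k::field"
  assumes "w c - w r + m = 0" "r \<noteq> r' \<Longrightarrow> w c' - w r' + m = 0"
  shows "entries r c k r' c' k' (\<lambda>a. of_int (w a) * v a) a - of_int (w a) * entries r c k r' c' k' v a
    + of_int m * entries r c k r' c' k' v a = 0"
proof -
  have 1: "(of_int (w c) :: 'k) - of_int (w r) + of_int m = 0"
    using assms(1) by (metis of_int_0 of_int_add of_int_diff)
  have 2: "(of_int (w c') :: 'k) - of_int (w r') + of_int m = 0" if "r \<noteq> r'"
    using assms(2)[OF that] by (metis of_int_0 of_int_add of_int_diff)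
  have "k * (of_int (w c) * v c) - of_int (w r) * (k * v c) + of_int m * (k * v c)
      = (of_int (w c) - of_int (w r) + of_int m) * (k * v c)" by (simp add: algebra_simps)
  moreover have "k' * (of_int (w c') * v c') - of_int (w r') * (k' * v c') + of_int m * (k' * v c')
      = (of_int (w c') - of_int (w r') + of_int m) * (k' * v c')" by (simp add: algebra_simps)
  ultimately show ?thesis using 1 2 by (auto simp: entries_def)
qed

lemma weight_uminus: "weight n i (- a) = - weight n i a" if "1 \<le> i"
  using that by (auto simp: weight_def)

text \<open>The Cartan integer is the value of h_i on the simple root eps_j - eps_(j+1), or on eps_n
  if j = n.\<close>

lemma acoef_weight:
  assumes "i \<in> {1..n}" "j \<in> {1..n}"
  shows "acoef n i j = weight n i (int j) - (if j = n then 0 else weight n i (int j + 1))"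
proof (cases "i = n")
  case True
  then show ?thesis using assms by (auto simp: weight_def acoef_def)
next
  case False
  consider "j = i" | "j = i + 1" | "i = j + 1" | "j \<noteq> i" "j \<noteq> i + 1" "i \<noteq> j + 1" by blast
  then show ?thesis using False assms by cases (simp_all add: weight_def acoef_def)
qed

lemma chain_act_weight:
  assumes "i \<in> {1..n}" "j \<in> {1..n}" "s = 1 \<or> s = - 1"
  shows "chain_act n s \<alpha> \<beta> \<gamma> j (\<lambda>a. of_int (weight n i a) * v a) a
    - of_int (weight n i a) * chain_act n s \<alpha> \<beta> \<gamma> j v a
    + of_int (s * acoef n i j) * chain_act n s \<alpha> \<beta> \<gamma> j v a = 0"
proof -
  have i: "1 \<le> i" using assms(1) by simp
  have scale: "weight n i (s * a) = s * weight n i a" "weight n i (- (s * a)) = - (s * weight n i a)" for a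
    using assms(3) weight_uminus[OF i] by auto
  have zero: "weight n i 0 = 0" using weight_uminus[OF i, of n 0] by simp
  show ?thesis
  proof (cases "j = n")
    case True
    have acoef: "acoef n i j = weight n i (int n)" using acoef_weight[OF assms(1,2)] True by simp
    have "weight n i 0 - weight n i (s * int n) + s * acoef n i j = 0"
      "weight n i (- (s * int n)) - weight n i 0 + s * acoef n i j = 0"
      unfolding scale acoef zero by simp_all
    then show ?thesis unfolding chain_act_def if_P[OF True] by (rule entries_weight)
  next
    case False
    have acoef: "acoef n i j = weight n i (int j) - weight n i (int j + 1)"
      using acoef_weight[OF assms(1,2)] False by simp
    have "weight n i (s * (int j + 1)) - weight n i (s * int j) + s * acoef n i j = 0"
      "weight n i (- (s * int j)) - weight n i (- (s * (int j + 1))) + s * acoef n i j = 0"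
      unfolding scale acoef by (simp_all add: right_diff_distrib)
    then show ?thesis unfolding chain_act_def if_not_P[OF False] by (rule entries_weight)
  qed
qed

lemma Wrel_kernel:
  assumes "p \<in> Wrel n"
  shows "(p :: 'k::field wpoly) \<in> kernel n"
proof -
  have hom: "hom n (i = n) (lt (E i) :: 'k wpoly)" "hom n (i = n) (lt (F i) :: 'k wpoly)"
    "hom n False (lt (H i) :: 'k wpoly)" for i
    using hom_lt[of n "E i"] hom_lt[of n "F i"] hom_lt[of n "H i"] by (auto simp: oddl_def)
  have lt: "rho n (lt x) = (act n x :: 'k operator)" for x by (intro ext rho_lt)
  from assms consider
    i j where "p = br n (lt (H i)) (lt (H j))"
  | i j where "p = br n (lt (E i)) (lt (F j)) - (if i = j then lt (H i) else 0)" "i \<in> {1..n}" "j \<in> {1..n}"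
  | i j where "p = br n (lt (E j)) (lt (H i)) + smul (of_int (acoef n i j)) (lt (E j))" "i \<in> {1..n}" "j \<in> {1..n}"
  | i j where "p = br n (lt (H i)) (lt (F j)) + smul (of_int (acoef n i j)) (lt (F j))" "i \<in> {1..n}" "j \<in> {1..n}"
    unfolding Wrel_def by blast
  then show ?thesis
  proof cases
    case (1 i j)
    then show ?thesis by (simp add: kernel_def rho_br[OF hom(3) hom(3)] lt)
  next
    case (2 i j)
    have "rho n (br n (lt (E i)) (lt (F j)) :: 'k wpoly) v a =
        (if i = j then of_int (weight n i a) * v a else 0)" for v a
      using 2(2,3) by (auto simp: rho_br[OF hom(1,2)] lt chain_act_def entries_def weight_def add.commute)
    then show ?thesis unfolding 2(1) by (simp add: kernel_def rho_diff lt)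
  next
    case (3 i j)
    show ?thesis unfolding 3(1) kernel_def
    proof (intro CollectI allI)
      fix v :: "int \<Rightarrow> 'k" and a
      show "rho n (br n (lt (E j)) (lt (H i)) + smul (of_int (acoef n i j)) (lt (E j))) v a = 0"
        using chain_act_weight[OF 3(2,3), of 1 1 1 1 v a]
        by (simp add: rho_add rho_smul rho_br[OF hom(1,3)] lt)
    qed
  next
    case (4 i j)
    show ?thesis unfolding 4(1) kernel_def
    proof (intro CollectI allI)
      fix v :: "int \<Rightarrow> 'k" and a
      show "rho n (br n (lt (H i)) (lt (F j)) + smul (of_int (acoef n i j)) (lt (F j))) v a = 0"
      proof -
        let ?c = "chain_act n (- 1) (- 1 :: 'k) (- 2) 2 j"
        have "?c (\<lambda>a. of_int (weight n i a) * v a) a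
            = of_int (weight n i a) * ?c v a + of_int (acoef n i j) * ?c v a"
          using chain_act_weight[OF 4(2,3), of "- 1" "- 1" "- 2" 2 v a] by (simp add: algebra_simps)
        then show ?thesis by (simp add: rho_add rho_smul rho_br[OF hom(3,2)] lt)
      qed
    qed
  qed
qed

section \<open>Irreducible words contain one kind of letter\<close>

lemma adjacent_induct:
  "(\<And>a x y b. u = a @ x # y # b \<Longrightarrow> P x \<Longrightarrow> P y) \<Longrightarrow> P (hd u) \<Longrightarrow> \<forall>x\<in>set u. P x"
proof (induction u)
  case (Cons z u)
  show ?case
  proof (cases u)
    case (Cons y u')
    have "P y" using Cons.prems(1)[of "[]" z y u'] Cons.prems(2) Cons by simp
    moreover have "P y'" if "u = a @ x # y' # b" "P x" for a x y' b
      using Cons.prems(1)[of "z # a" x y' b] that by simp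
    ultimately show ?thesis using Cons.IH Cons.prems(2) Cons by auto
  qed (use Cons.prems in simp)
qed simp

lemma LS_poly_lw: "LS_poly n p u \<Longrightarrow> lw p = u"
  by (auto simp: LS_poly_def dest: lead_lw)

lemma Wrel_LS_poly: "p \<in> Wrel n \<Longrightarrow> \<exists>u. LS_poly n (p :: 'k::field wpoly) u"
  unfolding Wrel_def
  apply (elim UnE CollectE exE conjE)
     apply (hypsubst, rule exI, rule LS_poly_Wrel(1); assumption)
    apply (hypsubst, rule exI, rule LS_poly_Wrel(2); assumption)
   apply (hypsubst, rule exI, rule LS_poly_Wrel(3); assumption)
  apply (hypsubst, rule exI, rule LS_poly_Wrel(4); assumption)
  done

lemma Wrel_words:
  "1 \<le> j \<Longrightarrow> j < i \<Longrightarrow> i \<le> n \<Longrightarrow> \<exists>p\<in>Wrel n. lw (p :: 'k::field wpoly) = [H i, H j]"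
  "i \<in> {1..n} \<Longrightarrow> j \<in> {1..n} \<Longrightarrow> \<exists>p\<in>Wrel n. lw (p :: 'k wpoly) = [E i, F j]"
  "i \<in> {1..n} \<Longrightarrow> j \<in> {1..n} \<Longrightarrow> \<exists>p\<in>Wrel n. lw (p :: 'k wpoly) = [E j, H i]"
  "i \<in> {1..n} \<Longrightarrow> j \<in> {1..n} \<Longrightarrow> \<exists>p\<in>Wrel n. lw (p :: 'k wpoly) = [H i, F j]"
proof -
  assume ij: "1 \<le> j" "j < i" "i \<le> n"
  then have "br n (lt (H i)) (lt (H j)) \<in> (Wrel n :: 'k wpoly set)" unfolding Wrel_def by blast
  then show "\<exists>p\<in>Wrel n. lw (p :: 'k wpoly) = [H i, H j]"
    using LS_poly_lw[OF LS_poly_Wrel(1)[OF ij]] by blast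
next
  assume ij: "i \<in> {1..n}" "j \<in> {1..n}"
  then have "br n (lt (E i)) (lt (F j)) - (if i = j then lt (H i) else 0) \<in> (Wrel n :: 'k wpoly set)"
    unfolding Wrel_def by blast
  then show "\<exists>p\<in>Wrel n. lw (p :: 'k wpoly) = [E i, F j]"
    using LS_poly_lw[OF LS_poly_Wrel(2)[OF ij]] by blast
next
  assume ij: "i \<in> {1..n}" "j \<in> {1..n}"
  then have "br n (lt (E j)) (lt (H i)) + smul (of_int (acoef n i j)) (lt (E j)) \<in> (Wrel n :: 'k wpoly set)"
    unfolding Wrel_def by blast
  then show "\<exists>p\<in>Wrel n. lw (p :: 'k wpoly) = [E j, H i]"
    using LS_poly_lw[OF LS_poly_Wrel(3)[OF ij]] by blast
next
  assume ij: "i \<in> {1..n}" "j \<in> {1..n}"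
  then have "br n (lt (H i)) (lt (F j)) + smul (of_int (acoef n i j)) (lt (F j)) \<in> (Wrel n :: 'k wpoly set)"
    unfolding Wrel_def by blast
  then show "\<exists>p\<in>Wrel n. lw (p :: 'k wpoly) = [H i, F j]"
    using LS_poly_lw[OF LS_poly_Wrel(4)[OF ij]] by blast
qed

text \<open>W forbids an e before an h or f, an h before an f, and an h before a smaller h. The
  first letter of an LS word is its largest, so the word stays within one kind; if that kind is h,
  it is a power of one letter, and a power above the first has a border.\<close>

lemma irreducible_letter_kinds:
  assumes r: "LS r" "set r \<subseteq> {x. inX n x}"
    and avoid: "\<And>p a b. p \<in> (Wrel n :: 'k::field wpoly set) \<Longrightarrow> r \<noteq> a @ lw p @ b"
  shows "set r \<subseteq> E ` {1..n} \<or> set r \<subseteq> F ` {1..n} \<or> (\<exists>i. r = [H i] \<and> 1 \<le> i \<and> i \<le> n)"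
proof -
  have rng: "lidx x \<in> {1..n}" if "x \<in> set r" for x using r(2) that by (auto simp: inX_def)
  have no: "r \<noteq> a @ w @ b" if "\<exists>p\<in>Wrel n. lw (p :: 'k wpoly) = w" for w a b
    using avoid that by blast
  have le: "x = hd r \<or> lless x (hd r)" if "x \<in> set r" for x by (rule LS_letter_le_hd[OF r(1) that])
  have hd: "hd r \<in> set r" using LS_nonempty[OF r(1)] by simp
  show ?thesis
  proof (cases "hd r")
    case (E m)
    have "\<forall>x\<in>set r. \<exists>i. x = E i"
    proof (rule adjacent_induct)
      fix a x y b assume ab: "r = a @ x # y # b" and "\<exists>i. x = E i"
      then obtain i where i: "x = E i" by blast
      have "lidx x \<in> {1..n}" "lidx y \<in> {1..n}" using ab rng by auto
      then show "\<exists>i. y = E i"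
        using no[OF Wrel_words(2), of i "lidx y" a b] no[OF Wrel_words(3), of "lidx y" i a b] ab i
        by (cases y) auto
    qed (use E in auto)
    then have "set r \<subseteq> E ` {1..n}" using rng by fastforce
    then show ?thesis by blast
  next
    case (F m)
    have "\<exists>i. x = F i" if "x \<in> set r" for x using le[OF that] F by (cases x) (auto simp: lless_def)
    then have "set r \<subseteq> F ` {1..n}" using rng by fastforce
    then show ?thesis by blast
  next
    case (H m)
    have "\<forall>x\<in>set r. \<exists>i. x = H i \<and> m \<le> i"
    proof (rule adjacent_induct)
      fix a x y b assume ab: "r = a @ x # y # b" and "\<exists>i. x = H i \<and> m \<le> i"
      then obtain i where i: "x = H i" "m \<le> i" by blast
      have rng': "lidx x \<in> {1..n}" "lidx y \<in> {1..n}" using ab rng by auto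
      have "y = H m \<or> lless y (H m)" using le[of y] ab H by auto
      moreover have "\<not> lidx y < i" if "y = H (lidx y)"
        using no[OF Wrel_words(1), of "lidx y" i a b] ab i(1) rng' that by auto
      moreover have "y \<noteq> F (lidx y)"
        using no[OF Wrel_words(4), of i "lidx y" a b] ab i(1) rng' by auto
      ultimately show "\<exists>i. y = H i \<and> m \<le> i" using i(2) by (cases y) (auto simp: lless_def)
    qed (use H in auto)
    then have all: "x = H m" if "x \<in> set r" for x using le[OF that] that H by (auto simp: lless_def)
    have "r = [H m]"
    proof (rule ccontr)
      assume "r \<noteq> [H m]"
      moreover obtain y ys where ys: "r = y # ys" using LS_nonempty[OF r(1)] by (cases r) auto
      ultimately obtain z zs where zs: "ys = zs @ [z]" using all by (cases ys rule: rev_cases) auto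
      then have "y = H m" "z = H m" using all ys by auto
      then show False using LS_unbordered[OF r(1), of "y # zs" "[z]" ys] ys zs by simp
    qed
    then show ?thesis using rng[OF hd] H by auto
  qed
qed

theorem theorem4p6:
  fixes n :: nat
  assumes "1 \<le> n"
    and "(2::'k::field) \<noteq> 0" and "(3::'k) \<noteq> 0"
  shows "GSB n (Rset n :: 'k wpoly set)"
proof -
  interpret Ec: chain_rep n E 1 "1 :: 'k" 1 1
    by standard (use assms(2) in \<open>auto simp: lless_def oddl_def\<close>)
  interpret Fc: chain_rep n F "- 1" "- 1 :: 'k" "- 2" 2
    by standard (use assms(2) in \<open>auto simp: lless_def oddl_def\<close>)
  define R :: "'k wpoly set" where "R = Rside n E \<union> Wrel n \<union> Rside n F"
  have LS_R: "\<exists>u. LS_poly n p u" if "p \<in> R" for p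
    using that Ec.Rside_LS_poly Fc.Rside_LS_poly Wrel_LS_poly unfolding R_def by blast
  \<comment> \<open>All relations are monic as they stand.\<close>
  have "mon p = p" if "p \<in> R" for p
    using LS_R[OF that] by (auto simp: LS_poly_def dest: lead_mon)
  then have Rset: "Rset n = R" by (simp add: Rset_def R_def)
  define Hs :: "'k wpoly set" where "Hs = {lt (H i) | i. 1 \<le> i \<and> i \<le> n}"
  define B where "B = Ec.Bside \<union> Fc.Bside \<union> Hs"
  \<comment> \<open>Besides h_i, only h_(i-1) can have a nonzero entry at (i,i), so the Cartan
    elements are triangular in their index. The root vectors are separated outright.\<close>
  define rank :: "'k wpoly \<Rightarrow> nat" where "rank p = (case lw p of [H i] \<Rightarrow> i | _ \<Rightarrow> 0)" for p
  have entry_H: "entry n a c (lt (H i) :: 'k wpoly) = (if a = c then of_int (weight n i a) else 0)" for a c i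
    by (simp add: entry_def rho_lt)
  have independent: "\<exists>a c. entry n a c b \<noteq> 0 \<and>
      (\<forall>b'\<in>B. b' \<noteq> b \<longrightarrow> entry n a c b' \<noteq> 0 \<longrightarrow> rank b' < rank b)" if "b \<in> B" for b
  proof -
    \<comment> \<open>Positive root vectors vanish on and below the diagonal, negative ones on and
      above it, and the h off it, so the three parts of \<open>B\<close> do not interfere.\<close>
    have nE: "entry n a c b' = 0" if "b' \<in> Ec.Bside" "height n a \<le> height n c" for b' a c
      using Ec.entry_height[of b' a c] that by force
    have nF: "entry n a c b' = 0" if "b' \<in> Fc.Bside" "height n c \<le> height n a" for b' a c
      using Fc.entry_height[of b' a c] that by force
    have nH: "entry n a c b' = 0" if "b' \<in> Hs" "a \<noteq> c" for b' a c
      using that entry_H unfolding Hs_def by auto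
    consider "b \<in> Ec.Bside" | "b \<in> Fc.Bside" | i where "b = lt (H i)" "1 \<le> i" "i \<le> n"
      using \<open>b \<in> B\<close> unfolding B_def Hs_def by blast
    then show ?thesis
    proof cases
      case 1
      then obtain a c where ac: "entry n a c b \<noteq> 0" "\<forall>b'\<in>Ec.Bside. b' \<noteq> b \<longrightarrow> entry n a c b' = 0"
        using Ec.Bside_separated by blast
      then have "height n c < height n a" using Ec.entry_height[OF 1] by simp
      then have "\<forall>b'\<in>B. b' \<noteq> b \<longrightarrow> entry n a c b' = 0"
        using ac(2) nF nH unfolding B_def by (metis UnE less_imp_le less_irrefl)
      then show ?thesis using ac(1) by blast
    next
      case 2
      then obtain a c where ac: "entry n a c b \<noteq> 0" "\<forall>b'\<in>Fc.Bside. b' \<noteq> b \<longrightarrow> entry n a c b' = 0"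
        using Fc.Bside_separated by blast
      then have "height n a < height n c" using Fc.entry_height[OF 2, of a c] by simp
      then have "\<forall>b'\<in>B. b' \<noteq> b \<longrightarrow> entry n a c b' = 0"
        using ac(2) nE nH unfolding B_def by (metis UnE less_imp_le less_irrefl)
      then show ?thesis using ac(1) by blast
    next
      case (3 i)
      have "lw (lt (H i) :: 'k wpoly) = [H i]" for i by (rule lead_lw[OF lead_lt])
      then have rank: "rank (lt (H i)) = i" for i by (simp add: rank_def)
      have "entry n (int i) (int i) b \<noteq> 0" using 3 assms(2) by (simp add: entry_H weight_def)
      moreover have "rank b' < rank b" if "b' \<in> B" "b' \<noteq> b" "entry n (int i) (int i) b' \<noteq> 0" for b'
      proof -
        have "b' \<in> Hs" using that nE[of b' "int i" "int i"] nF[of b' "int i" "int i"] unfolding B_def by auto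
        then obtain i' where i': "b' = lt (H i')" "1 \<le> i'" "i' \<le> n" unfolding Hs_def by blast
        then have "i' \<noteq> i" "weight n i' (int i) \<noteq> 0" using that 3 by (auto simp: entry_H)
        then have "i' < i" using i' 3 by (auto simp: weight_def split: if_splits)
        then show ?thesis using 3 i' rank by simp
      qed
      ultimately show ?thesis by blast
    qed
  qed
  interpret lie_reduction n "Rset n :: 'k wpoly set" B "kernel n"
    unfolding Rset
  proof
    show "(2 :: 'k) \<noteq> 0" by (rule assms(2))
    show "s \<in> free_lie n" "hom n (oddw n (lw s)) s" "LS (lw s) \<and> lead s (lw s) 1" if "s \<in> R" for s
      using LS_R[OF that] LS_poly_lw by (auto simp: LS_poly_def)
    show "b \<in> free_lie n" if "b \<in> B" for b
      using that Ec.Bside_free_lie Fc.Bside_free_lie unfolding B_def Hs_def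
      by (auto intro!: free_lie.gen simp: inX_def)
    show "p + q \<in> kernel n" if "p \<in> kernel n" "q \<in> kernel n" for p q :: "'k wpoly"
      using that by (rule kernel_add)
    show "r * p \<in> kernel n" "p * r \<in> kernel n" if "p \<in> kernel n" for p r :: "'k wpoly"
      using that by (rule kernel_mult)+
    show "s \<in> kernel n" if "s \<in> R" for s
      using that Ec.Rside_kernel Fc.Rside_kernel Wrel_kernel unfolding R_def by blast
    show "r = 0" if "r \<in> wp.span B" "r \<in> kernel n" for r
      using kernel_independent[OF independent that] .
  next
    fix u
    assume u: "superLS n u" "set u \<subseteq> {x. inX n x}"
      and avoid: "\<And>s a b. s \<in> R \<Longrightarrow> root u \<noteq> a @ lw s @ b"
    define r where "r = root u"
    have r: "LS r" "set r \<subseteq> {x. inX n x}"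
      using LS_root[OF u(1)] set_mset_mono[OF mset_root[OF u(1)]] u(2) by (auto simp: r_def)
    have "Ec.avoids r"
      unfolding Ec.avoids_def
      using avoid Ec.Rwords_LS_poly[where ?'k = 'k] LS_poly_lw unfolding R_def r_def by (metis UnI1)
    moreover have "Fc.avoids r"
      unfolding Fc.avoids_def
      using avoid Fc.Rwords_LS_poly[where ?'k = 'k] LS_poly_lw unfolding R_def r_def by (metis UnI2)
    moreover have "set r \<subseteq> E ` {1..n} \<or> set r \<subseteq> F ` {1..n} \<or> (\<exists>i. r = [H i] \<and> 1 \<le> i \<and> i \<le> n)"
      using avoid unfolding R_def r_def[symmetric]
      by (intro irreducible_letter_kinds[OF r, where ?'k = 'k]) blast
    ultimately consider "\<exists>b\<in>Ec.Bside. \<exists>c. lead b u c" | "\<exists>b\<in>Fc.Bside. \<exists>c. lead b u c"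
      | i where "r = [H i]" "1 \<le> i" "i \<le> n"
      using Ec.Bside_lead[OF u(1) r_def[symmetric] r(1)] Fc.Bside_lead[OF u(1) r_def[symmetric] r(1)] by blast
    then show "\<exists>b\<in>B. \<exists>c. lead b u c"
    proof cases
      case (3 i)
      \<comment> \<open>The letter h_i is even, so its square is not super-LS and \<open>u\<close>
        is the letter itself.\<close>
      then have "\<not> oddw n r" by (simp add: oddw_def oddl_def)
      then have "u = [H i]" using u(1) 3(1) unfolding r_def by (auto elim!: superLS_cases)
      then have "lead (lt (H i) :: 'k wpoly) u 1" by (simp add: lead_lt)
      moreover have "lt (H i) \<in> B" using 3 unfolding B_def Hs_def by blast
      ultimately show ?thesis by blast
    qed (auto simp: B_def)
  qed
  show ?thesis by (rule GSB)
qed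

end
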